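(* Fix integers $k,\ell\ge1$ and $\lambda\in(0,1)$. There exists a unique probability measure $\pi^\ell_{\infty,k}$ on $\Gamma_\ell$ such that $\pi^\ell_{n,k}$ converges to $\pi^\ell_{\infty,k}$ (in total variation) as $n\to\infty$.
   Context: For integers $n,k\ge1$, $\Lambda^0_{n,k}$ is the set of integer points in $[-n/2,n/2]\times[0,k]$. Edges are open straight segments with endpoints in $\Lambda^0_{n,k}$; $|e|$ is the $\ell_1$ length. A triangulation of $\Lambda^0_{n,k}$ is a maximal set of pairwise disjoint edges containing no point of $\Lambda^0_{n,k}$; all triangulations share the same set $\Lambda_{n,k}$ of edge midpoints, and $\sigma_x$ is the edge of $\sigma$ with midpoint $x$. $\Omega_{n,k}$ is the set of all triangulations of $\Lambda^0_{n,k}$ (free boundary condition) and $\pi_{n,k}(\sigma)\propto\lambda^{\sum_{x\in\Lambda_{n,k}}|\sigma_x|}$. For $0<\ell<n$, $\Upsilon_\ell=([-\ell/2,\ell/2]\times[0,k])\cap\Lambda_{n,k}$, $\sigma_{\Upsilon_\ell}=\{\sigma_x:x\in\Upsilon_\ell\}$, $\Gamma_\ell$ is the set of all configurations $\sigma_{\Upsilon_\ell}$ arising from some $n$ and some $\sigma\in\Omega_{n,k}$, and $\pi^\ell_{n,k}$ is the law of $\sigma_{\Upsilon_\ell}$ under $\sigma\sim\pi_{n,k}$, a probability measure on $\Gamma_\ell$. *)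

theory Defs
  imports "HOL-Analysis.Analysis" "HOL-Probability.Probability"
begin

type_synonym point = "int \<times> int"
type_synonym edge = "point set"   (* an edge is the 2-element set of its endpoints *)

definition box :: "nat \<Rightarrow> nat \<Rightarrow> point set" where
  "box n k = {(x, y). 2 * \<bar>x\<bar> \<le> int n \<and> 0 \<le> y \<and> y \<le> int k}"

definition toR :: "point \<Rightarrow> real \<times> real" where
  "toR p = (real_of_int (fst p), real_of_int (snd p))"

text \<open>The open straight segment of an edge (symmetric in the endpoints).\<close>
definition seg :: "edge \<Rightarrow> (real \<times> real) set" where
  "seg e = \<Union>{open_segment (toR p) (toR q) | p q. e = {p, q}}"

definition is_edge :: "nat \<Rightarrow> nat \<Rightarrow> edge \<Rightarrow> bool" where
  "is_edge n k e \<longleftrightarrow> (\<exists>p q. p \<in> box n k \<and> q \<in> box n k \<and> p \<noteq> q \<and> e = {p, q})"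

definition good_edge :: "nat \<Rightarrow> nat \<Rightarrow> edge \<Rightarrow> bool" where
  "good_edge n k e \<longleftrightarrow> is_edge n k e \<and> seg e \<inter> toR ` box n k = {}"

definition triangulation :: "nat \<Rightarrow> nat \<Rightarrow> edge set \<Rightarrow> bool" where
  "triangulation n k \<sigma> \<longleftrightarrow>
     (\<forall>e\<in>\<sigma>. good_edge n k e) \<and>
     (\<forall>e\<in>\<sigma>. \<forall>e'\<in>\<sigma>. e \<noteq> e' \<longrightarrow> seg e \<inter> seg e' = {}) \<and>
     (\<forall>e. good_edge n k e \<and> e \<notin> \<sigma> \<longrightarrow> (\<exists>e'\<in>\<sigma>. seg e \<inter> seg e' \<noteq> {}))"

definition Omega :: "nat \<Rightarrow> nat \<Rightarrow> edge set set" where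
  "Omega n k = {\<sigma>. triangulation n k \<sigma>}"

text \<open>l1 length of an edge {p,q}: the double sum counts |p-q|_1 twice.\<close>
definition len :: "edge \<Rightarrow> int" where
  "len e = (\<Sum>p\<in>e. \<Sum>q\<in>e. \<bar>fst p - fst q\<bar> + \<bar>snd p - snd q\<bar>) div 2"

definition mid2x :: "edge \<Rightarrow> int" where
  "mid2x e = (\<Sum>p\<in>e. fst p)"

text \<open>sum over midpoints x of |sigma_x|, i.e. the total l1 length of the edges.\<close>
definition weight :: "edge set \<Rightarrow> int" where
  "weight \<sigma> = (\<Sum>e\<in>\<sigma>. len e)"

text \<open>sigma restricted to Upsilon_l: edges whose midpoint lies in [-l/2,l/2] x [0,k].\<close>
definition restr :: "nat \<Rightarrow> edge set \<Rightarrow> edge set" where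
  "restr l \<sigma> = {e \<in> \<sigma>. \<bar>mid2x e\<bar> \<le> int l}"

definition Gamma :: "nat \<Rightarrow> nat \<Rightarrow> edge set set" where
  "Gamma k l = {restr l \<sigma> | n \<sigma>. l < n \<and> \<sigma> \<in> Omega n k}"

definition Zpart :: "nat \<Rightarrow> nat \<Rightarrow> real \<Rightarrow> real" where
  "Zpart n k lam = (\<Sum>\<sigma>\<in>Omega n k. lam powr real_of_int (weight \<sigma>))"

definition law :: "nat \<Rightarrow> nat \<Rightarrow> nat \<Rightarrow> real \<Rightarrow> edge set set \<Rightarrow> real" where
  "law n k l lam A =
     (\<Sum>\<sigma>\<in>Omega n k. if restr l \<sigma> \<in> A then lam powr real_of_int (weight \<sigma>) else 0) / Zpart n k lam"

definition tv_dist :: "nat \<Rightarrow> nat \<Rightarrow> nat \<Rightarrow> real \<Rightarrow> edge set pmf \<Rightarrow> real" where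
  "tv_dist n k l lam p = (SUP A. \<bar>law n k l lam A - measure_pmf.prob p A\<bar>)"

end

theory Submission
  imports "HOL-Complex_Analysis.Cauchy_Integral_Formula" Defs
begin

text \<open>
  A column all of whose unit vertical edges are present separates a triangulation into two independent
  parts, so the partition functions \<open>Z m\<close> of the boxes of width \<open>m\<close> form a renewal sequence generated
  by the weights \<open>f m\<close> of the triangulations without interior column. Everything rests on the bound
  \<open>m f m \<le> c \<Sum> f i f j + (exponentially small)\<close>, where \<open>i + j\<close> differs from \<open>m\<close> by a bounded amount.
  It holds because an irreducible triangulation has, up to an exponentially small weight, total length
  \<open>O(m)\<close>, whereas an edge of horizontal extent \<open>L\<close> forces about \<open>L\<close> further edges near it to have
  length of order \<open>L\<close>; hence a positive fraction of the columns is crossed by short edges only, and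
  such a column can be forced at bounded cost. Both steps use that every triangulation has an edge at
  each admissible midpoint. The bound gives \<open>f\<close> exponential tails relative to \<open>Z\<close>, so \<open>Z m \<rho>\<^sup>m\<close>
  converges to a positive limit, and decomposing at the first columns outside the window turns this
  into convergence of the restricted laws by dominated convergence.
\<close>

text \<open>Coercion inference is switched off: it would also coerce points componentwise.\<close>
declare [[coercion_enabled = false]]

section \<open>Lattice segments and maximal cliques\<close>

text \<open>A transfer matrix is not directly available: edges can be arbitrarily long, so the
  possible cuts of the strip form an infinite state space, and nothing prevents a priori that most
  of the weight sits on triangulations without any full column. A bound on \<open>m f m\<close> by a
  convolution of \<open>f\<close> with itself is the right tool because, with \<open>U\<close> the
  generating function of \<open>f\<close>, it reads \<open>s U' \<le> c U^2 + c'\<close>, and such a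
  differential inequality carries a finite value of \<open>U\<close> past the critical point. The
  error term is harmless because the critical point \<open>\<rho>\<close> satisfies
  \<open>f 1 * \<rho> \<le> 1\<close>: anything of order \<open>(f 1 / 2) ^ m\<close> is summable
  there and a little beyond, and this decides how large the energy cutoff must be. A triangulation
  is given only as a maximal set of disjoint edges, so no count of edges or faces is at hand. An
  edge at each midpoint is found directly, by studying the cell between the edges next below and
  above a point with half-integral abscissa. Comparing heights over a common column replaces planar
  topology throughout.\<close>

definition aff :: "(real \<Rightarrow> real) \<Rightarrow> bool" where
  "aff f \<longleftrightarrow> (\<exists>\<alpha> \<beta>. \<forall>x. f x = \<alpha> + \<beta> * x)"

lemma aff_diff: "aff f \<Longrightarrow> aff g \<Longrightarrow> aff (\<lambda>x. f x - g x)"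
proof -
  assume "aff f" "aff g"
  then obtain a b c d where "\<forall>x. f x = a + b * x" "\<forall>x. g x = c + d * x"
    unfolding aff_def by blast
  hence "\<forall>x. f x - g x = (a - c) + (b - d) * x" by (simp add: algebra_simps)
  thus ?thesis unfolding aff_def by blast
qed

lemma aff_left:
  fixes x x1 x2 :: real
  assumes "aff f" "f x1 < 0" "f x2 \<ge> 0" "x1 < x2" "x \<le> x1"
  shows "f x < 0"
proof -
  obtain a b where f: "\<And>x. f x = a + b * x" using assms(1) unfolding aff_def by blast
  have "b * (x2 - x1) > 0" using assms(2,3) f by (simp add: algebra_simps)
  hence "b > 0" using assms(4) by (simp add: zero_less_mult_iff)
  hence "b * x \<le> b * x1" using assms(5) by simp
  thus ?thesis using assms(2) f[of x] f[of x1] by linarith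
qed

lemma aff_zero:
  fixes x1 x2 :: real
  assumes "aff f" "f x1 < 0" "f x2 > 0"
  shows "\<exists>x. min x1 x2 < x \<and> x < max x1 x2 \<and> f x = 0"
proof -
  obtain a b where f: "\<And>x. f x = a + b * x" using assms(1) unfolding aff_def by blast
  have ne: "b * (x2 - x1) > 0" using assms(2,3) f by (simp add: algebra_simps)
  hence b: "b \<noteq> 0" by auto
  define x where "x = - a / b"
  have fx: "f x = 0" using b by (simp add: f x_def)
  have e: "f x1 = b * (x1 - x)" "f x2 = b * (x2 - x)"
    using fx f by (simp_all add: algebra_simps)
  have "min x1 x2 < x \<and> x < max x1 x2"
  proof (cases "b > 0")
    case True
    hence "x1 < x" "x < x2" using assms(2,3) e by (auto simp: mult_less_0_iff zero_less_mult_iff)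
    thus ?thesis by auto
  next
    case False
    hence "b < 0" using b by simp
    hence "x < x1" "x2 < x" using assms(2,3) e by (auto simp: mult_less_0_iff zero_less_mult_iff)
    thus ?thesis by auto
  qed
  thus ?thesis using fx by blast
qed

section \<open>Edges as graphs over the horizontal axis\<close>

abbreviation rx :: "point \<Rightarrow> real" where "rx p \<equiv> real_of_int (fst p)"
abbreviation ry :: "point \<Rightarrow> real" where "ry p \<equiv> real_of_int (snd p)"

text \<open>Ordinate at \<open>x\<close> of the line through \<open>p\<close> and \<open>q\<close>,
  used beyond the segment as well. For a vertical pair the division by zero makes it constantly
  \<open>ry p\<close>, so statements about the right end ask for
  \<open>fst p < fst q\<close>.\<close>

definition hgt :: "point \<Rightarrow> point \<Rightarrow> real \<Rightarrow> real" where
  "hgt p q x = ry p + (ry q - ry p) * (x - rx p) / (rx q - rx p)"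

lemma aff_hgt: "aff (hgt p q)"
proof -
  define m where "m = (ry q - ry p) / (rx q - rx p)"
  have "hgt p q x = ry p + m * (x - rx p)" for x by (simp add: hgt_def m_def)
  hence "\<forall>x. hgt p q x = (ry p - m * rx p) + m * x" by (simp add: algebra_simps)
  thus ?thesis unfolding aff_def by blast
qed

lemma hgt_left [simp]: "hgt p q (rx p) = ry p" by (simp add: hgt_def)
lemma hgt_right [simp]: "fst p < fst q \<Longrightarrow> hgt p q (rx q) = ry q"
  by (simp add: hgt_def)

lemma seg_pair: "seg {p, q} = open_segment (toR p) (toR q)"
proof
  show "seg {p, q} \<subseteq> open_segment (toR p) (toR q)"
    unfolding seg_def by (auto simp: doubleton_eq_iff open_segment_commute)
  show "open_segment (toR p) (toR q) \<subseteq> seg {p, q}"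
    unfolding seg_def by blast
qed

lemma toR_eq [simp]: "toR p = toR q \<longleftrightarrow> p = q"
  by (auto simp: toR_def prod_eq_iff)

lemma seg_param:
  "p \<noteq> q \<Longrightarrow> (x, y) \<in> seg {p, q} \<longleftrightarrow>
     (\<exists>u. 0 < u \<and> u < 1 \<and> x = (1 - u) * rx p + u * rx q \<and> y = (1 - u) * ry p + u * ry q)"
proof -
  assume "p \<noteq> q"
  have "(1 - u) *\<^sub>R toR p + u *\<^sub>R toR q = ((1 - u) * rx p + u * rx q, (1 - u) * ry p + u * ry q)" for u
    by (simp add: toR_def)
  thus ?thesis using \<open>p \<noteq> q\<close> unfolding seg_pair in_segment by simp
qed

lemma seg_nonvert:
  assumes "fst p < fst q"
  shows "(x, y) \<in> seg {p, q} \<longleftrightarrow> rx p < x \<and> x < rx q \<and> y = hgt p q x"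
proof -
  have pq: "p \<noteq> q" using assms by auto
  have d: "rx q - rx p > 0" using assms by simp
  show ?thesis
  proof
    assume "(x, y) \<in> seg {p, q}"
    then obtain u where u: "0 < u" "u < 1" "x = (1 - u) * rx p + u * rx q" "y = (1 - u) * ry p + u * ry q"
      using seg_param[OF pq] by blast
    have x: "x - rx p = u * (rx q - rx p)" by (simp add: u(3) algebra_simps)
    have x': "rx q - x = (1 - u) * (rx q - rx p)" by (simp add: u(3) algebra_simps)
    have "x - rx p > 0" unfolding x using u d by simp
    moreover have "rx q - x > 0" unfolding x' using u d by simp
    moreover have "(ry q - ry p) * (x - rx p) / (rx q - rx p) = (ry q - ry p) * u"
      unfolding x using d by simp
    hence "y = hgt p q x" unfolding hgt_def by (simp add: u(4) algebra_simps)
    ultimately show "rx p < x \<and> x < rx q \<and> y = hgt p q x" by simp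
  next
    assume h: "rx p < x \<and> x < rx q \<and> y = hgt p q x"
    define u where "u = (x - rx p) / (rx q - rx p)"
    have "0 < u" "u < 1" unfolding u_def using h d by auto
    moreover have ux: "u * (rx q - rx p) = x - rx p" unfolding u_def using d by simp
    moreover have "x = (1 - u) * rx p + u * rx q" using ux by (simp add: algebra_simps)
    moreover have "y = ry p + (ry q - ry p) * u" using h unfolding hgt_def u_def by simp
    hence "y = (1 - u) * ry p + u * ry q" by (simp add: algebra_simps)
    ultimately show "(x, y) \<in> seg {p, q}" using seg_param[OF pq] by blast
  qed
qed

lemma seg_vert:
  assumes "fst p = fst q" "snd p < snd q"
  shows "(x, y) \<in> seg {p, q} \<longleftrightarrow> x = rx p \<and> ry p < y \<and> y < ry q"
proof -
  have pq: "p \<noteq> q" using assms by auto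
  have d: "ry q - ry p > 0" using assms by simp
  show ?thesis
  proof
    assume "(x, y) \<in> seg {p, q}"
    then obtain u where u: "0 < u" "u < 1" "x = (1 - u) * rx p + u * rx q" "y = (1 - u) * ry p + u * ry q"
      using seg_param[OF pq] by blast
    have x: "y - ry p = u * (ry q - ry p)" by (simp add: u(4) algebra_simps)
    have x': "ry q - y = (1 - u) * (ry q - ry p)" by (simp add: u(4) algebra_simps)
    have "y - ry p > 0" unfolding x using u d by simp
    moreover have "ry q - y > 0" unfolding x' using u d by simp
    moreover have "x = rx p" by (simp add: u(3) assms algebra_simps)
    ultimately show "x = rx p \<and> ry p < y \<and> y < ry q" by simp
  next
    assume h: "x = rx p \<and> ry p < y \<and> y < ry q"
    define u where "u = (y - ry p) / (ry q - ry p)"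
    have "0 < u" "u < 1" unfolding u_def using h d by auto
    moreover have ux: "u * (ry q - ry p) = y - ry p" unfolding u_def using d by simp
    moreover have "y = (1 - u) * ry p + u * ry q" using ux by (simp add: algebra_simps)
    moreover have "x = (1 - u) * rx p + u * rx q" using h assms by (simp add: algebra_simps)
    ultimately show "(x, y) \<in> seg {p, q}" using seg_param[OF pq] by blast
  qed
qed

text \<open>The interior has to avoid the whole lattice and not just \<open>B\<close>. This makes
  the notion monotone in \<open>B\<close> and invariant under lattice maps; on a box convexity
  identifies it with \<open>good_edge\<close> (see \<open>good_edge_iff\<close>).\<close>

definition edges :: "point set \<Rightarrow> edge set" where
  "edges B = {{p, q} | p q. p \<in> B \<and> q \<in> B \<and> p \<noteq> q \<and> seg {p, q} \<inter> range toR = {}}"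

definition clique :: "edge set \<Rightarrow> bool" where
  "clique \<sigma> \<longleftrightarrow> (\<forall>e\<in>\<sigma>. \<forall>e'\<in>\<sigma>. e \<noteq> e' \<longrightarrow> seg e \<inter> seg e' = {})"

definition tri :: "point set \<Rightarrow> edge set \<Rightarrow> bool" where
  "tri B \<sigma> \<longleftrightarrow> \<sigma> \<subseteq> edges B \<and> clique \<sigma> \<and>
     (\<forall>e\<in>edges B - \<sigma>. \<exists>e'\<in>\<sigma>. seg e \<inter> seg e' \<noteq> {})"

definition rect :: "int \<Rightarrow> int \<Rightarrow> int \<Rightarrow> int \<Rightarrow> point set" where
  "rect a b c d = {a..b} \<times> {c..d}"

lemma finite_rect [simp]: "finite (rect a b c d)" by (simp add: rect_def)

lemma finite_edges [simp]: "finite B \<Longrightarrow> finite (edges B)"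
proof -
  assume "finite B"
  moreover have "edges B \<subseteq> Pow B" unfolding edges_def by auto
  ultimately show ?thesis by (meson finite_Pow_iff finite_subset)
qed

lemma edges_lattice: "{p, q} \<in> edges B \<Longrightarrow> toR w \<notin> seg {p, q}"
  unfolding edges_def by auto

lemma edges_ends: "{p, q} \<in> edges B \<Longrightarrow> p \<in> B \<and> q \<in> B \<and> p \<noteq> q"
  unfolding edges_def by (auto simp: doubleton_eq_iff)

lemma edges_cases:
  assumes "e \<in> edges B"
  obtains p q where "e = {p, q}" "p \<in> B" "q \<in> B" "fst p < fst q"
  | p q where "e = {p, q}" "p \<in> B" "q \<in> B" "fst p = fst q" "snd p < snd q"
proof -
  obtain p q where pq: "e = {p, q}" "p \<in> B" "q \<in> B" "p \<noteq> q" using assms unfolding edges_def by auto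
  consider "fst p < fst q" | "fst q < fst p" | "fst p = fst q" "snd p < snd q" | "fst p = fst q" "snd q < snd p"
    using pq(4) by (metis linorder_less_linear prod_eq_iff)
  thus thesis
  proof cases
    case 1 thus ?thesis by (rule that(1)[OF pq(1-3)])
  next
    case 2
    have "e = {q, p}" using pq(1) by (simp add: insert_commute)
    thus ?thesis using that(1)[OF _ pq(3,2) 2] by blast
  next
    case 3 thus ?thesis by (rule that(2)[OF pq(1-3)])
  next
    case 4
    have "e = {q, p}" using pq(1) by (simp add: insert_commute)
    thus ?thesis using that(2)[OF _ pq(3,2)] 4 by simp
  qed
qed

text \<open>Maximality in the form in which it produces edges: to exhibit a member of \<sigma> it is
  enough to exclude crossings.\<close>

lemma tri_mem:
  assumes "tri B \<sigma>" "e \<in> edges B" "\<And>d. d \<in> \<sigma> \<Longrightarrow> d \<noteq> e \<Longrightarrow> seg e \<inter> seg d = {}"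
  shows "e \<in> \<sigma>"
proof (rule ccontr)
  assume "e \<notin> \<sigma>"
  then obtain d where "d \<in> \<sigma>" "seg e \<inter> seg d \<noteq> {}" using assms(1,2) unfolding tri_def by blast
  thus False using assms(3) \<open>e \<notin> \<sigma>\<close> by blast
qed

text \<open>Turns weak inequalities between a lattice point and an edge into strict ones.\<close>

lemma edge_hgt_lattice:
  assumes "{p, q} \<in> edges B" "fst p < fst w" "fst w < fst q"
  shows "hgt p q (rx w) \<noteq> ry w"
proof
  assume "hgt p q (rx w) = ry w"
  hence "toR w \<in> seg {p, q}" unfolding toR_def
    by (subst seg_nonvert) (use assms in auto)
  thus False using edges_lattice assms by blast
qed

lemma clique_hgt_ne:
  fixes x :: real
  assumes "clique \<sigma>" "{p, q} \<in> \<sigma>" "{a, b} \<in> \<sigma>" "{p, q} \<noteq> {a, b}"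
    "rx p < x" "x < rx q" "rx a < x" "x < rx b"
  shows "hgt p q x \<noteq> hgt a b x"
proof
  assume h: "hgt p q x = hgt a b x"
  have "(x, hgt p q x) \<in> seg {p, q}" by (subst seg_nonvert) (use assms in auto)
  moreover have "(x, hgt p q x) \<in> seg {a, b}" unfolding h by (subst seg_nonvert) (use assms in auto)
  moreover have "seg {p, q} \<inter> seg {a, b} = {}" using assms(1-4) unfolding clique_def by simp
  ultimately show False by (metis disjoint_iff)
qed

text \<open>The difference of the two heights is affine, so a change of order would give it a zero
  strictly in between, which is a common interior point. The column \<open>y\<close> may be an
  endpoint of either edge; only the weak order survives there.\<close>

lemma clique_order:
  fixes x y :: real
  assumes "clique \<sigma>" "{p, q} \<in> \<sigma>" "{a, b} \<in> \<sigma>"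
    "rx p < x" "x < rx q" "rx a < x" "x < rx b" "hgt p q x < hgt a b x"
    "rx p \<le> y" "y \<le> rx q" "rx a \<le> y" "y \<le> rx b"
  shows "hgt p q y \<le> hgt a b y"
proof (rule ccontr)
  assume h: "\<not> ?thesis"
  have "{p, q} \<noteq> {a, b}"
  proof
    assume "{p, q} = {a, b}"
    moreover have "fst p < fst q" "fst a < fst b" using assms by auto
    ultimately show False using assms(8) by (auto simp: doubleton_eq_iff)
  qed
  moreover obtain z where "min x y < z" "z < max x y" "hgt p q z - hgt a b z = 0"
    using aff_zero[OF aff_diff[OF aff_hgt[of p q] aff_hgt[of a b]], of x y] h assms(8) by auto
  moreover from this have "rx p < z" "z < rx q" "rx a < z" "z < rx b"
    using assms by linarith+
  ultimately show False using clique_hgt_ne[OF assms(1-3)] by auto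
qed

lemma clique_order_strict:
  fixes x y :: real
  assumes "clique \<sigma>" "{p, q} \<in> \<sigma>" "{a, b} \<in> \<sigma>"
    "rx p < x" "x < rx q" "rx a < x" "x < rx b" "hgt p q x < hgt a b x"
    "rx p < y" "y < rx q" "rx a < y" "y < rx b"
  shows "hgt p q y < hgt a b y"
proof -
  have "{p, q} \<noteq> {a, b}"
  proof
    assume "{p, q} = {a, b}"
    moreover have "fst p < fst q" "fst a < fst b" using assms by auto
    ultimately show False using assms(8) by (auto simp: doubleton_eq_iff)
  qed
  hence "hgt p q y \<noteq> hgt a b y" using clique_hgt_ne assms by blast
  moreover have "hgt p q y \<le> hgt a b y" by (rule clique_order) (use assms in auto)
  ultimately show ?thesis by simp
qed

lemma aff_less:
  assumes "aff f" "f x1 < f x2" "x1 < x2" "y < z"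
  shows "f y < f z"
proof -
  obtain a b where f: "\<And>x. f x = a + b * x" using assms(1) unfolding aff_def by blast
  have "b * (x2 - x1) > 0" using assms(2) f by (simp add: algebra_simps)
  hence "b > 0" using assms(3) by (simp add: zero_less_mult_iff)
  thus ?thesis using assms(4) f by simp
qed

section \<open>Lattice symmetries, each paired with its affine extension to the plane\<close>

definition amap :: "(point \<Rightarrow> point) \<Rightarrow> (real \<times> real \<Rightarrow> real \<times> real) \<Rightarrow> bool" where
  "amap \<phi> \<Phi> \<longleftrightarrow> inj \<Phi> \<and> bij \<phi> \<and> (\<forall>p. \<Phi> (toR p) = toR (\<phi> p)) \<and>
     (\<forall>u P Q. \<Phi> ((1 - u) *\<^sub>R P + u *\<^sub>R Q) = (1 - u) *\<^sub>R \<Phi> P + u *\<^sub>R \<Phi> Q)"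

lemma amap_seg:
  assumes "amap \<phi> \<Phi>"
  shows "seg (\<phi> ` {p, q}) = \<Phi> ` seg {p, q}"
proof -
  have lin: "\<Phi> ((1 - u) *\<^sub>R P + u *\<^sub>R Q) = (1 - u) *\<^sub>R \<Phi> P + u *\<^sub>R \<Phi> Q" for u P Q
    using assms unfolding amap_def by blast
  have inj: "inj \<Phi>" and R: "\<And>p. \<Phi> (toR p) = toR (\<phi> p)" using assms unfolding amap_def by auto
  have "seg (\<phi> ` {p, q}) = open_segment (\<Phi> (toR p)) (\<Phi> (toR q))"
    by (simp add: seg_pair R)
  also have "\<dots> = \<Phi> ` open_segment (toR p) (toR q)"
  proof (intro set_eqI iffI)
    fix z assume "z \<in> open_segment (\<Phi> (toR p)) (\<Phi> (toR q))"
    then obtain u where u: "\<Phi> (toR p) \<noteq> \<Phi> (toR q)" "0 < u" "u < 1"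
      "z = (1 - u) *\<^sub>R \<Phi> (toR p) + u *\<^sub>R \<Phi> (toR q)" unfolding in_segment by blast
    have "z = \<Phi> ((1 - u) *\<^sub>R toR p + u *\<^sub>R toR q)" using u lin by simp
    moreover have "toR p \<noteq> toR q" using u(1) by metis
    hence "(1 - u) *\<^sub>R toR p + u *\<^sub>R toR q \<in> open_segment (toR p) (toR q)"
      unfolding in_segment using u(2,3) by blast
    ultimately show "z \<in> \<Phi> ` open_segment (toR p) (toR q)" by blast
  next
    fix z assume "z \<in> \<Phi> ` open_segment (toR p) (toR q)"
    then obtain u where u: "toR p \<noteq> toR q" "0 < u" "u < 1"
      "z = \<Phi> ((1 - u) *\<^sub>R toR p + u *\<^sub>R toR q)" unfolding image_iff Bex_def in_segment by metis
    moreover have "\<Phi> (toR p) \<noteq> \<Phi> (toR q)" using u(1) inj by (metis injD)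
    ultimately show "z \<in> open_segment (\<Phi> (toR p)) (\<Phi> (toR q))"
      unfolding in_segment lin by blast
  qed
  finally show ?thesis by (simp add: seg_pair)
qed

lemma amap_edges:
  assumes "amap \<phi> \<Phi>"
  shows "edges (\<phi> ` B) = (`) \<phi> ` edges B"
proof -
  have inj: "inj \<Phi>" and R: "\<And>p. \<Phi> (toR p) = toR (\<phi> p)" and bij: "bij \<phi>"
    using assms unfolding amap_def by auto
  have rng: "range toR = \<Phi> ` range toR"
  proof -
    have "\<Phi> ` range toR = range (\<lambda>p. toR (\<phi> p))" by (auto simp: R image_image)
    also have "\<dots> = toR ` range \<phi>" by (simp add: image_image)
    finally show ?thesis using bij by (simp add: bij_is_surj)
  qed
  have key: "seg (\<phi> ` {p, q}) \<inter> range toR = {} \<longleftrightarrow> seg {p, q} \<inter> range toR = {}" for p q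
  proof -
    have "seg (\<phi> ` {p, q}) \<inter> range toR = \<Phi> ` (seg {p, q} \<inter> range toR)"
      by (subst (1) rng) (simp only: amap_seg[OF assms] image_Int[OF inj])
    thus ?thesis by (metis image_is_empty)
  qed
  show ?thesis
  proof (intro set_eqI iffI)
    fix e assume "e \<in> edges (\<phi> ` B)"
    then obtain p' q' where "e = {p', q'}" "p' \<in> \<phi> ` B" "q' \<in> \<phi> ` B" "p' \<noteq> q'" "seg {p', q'} \<inter> range toR = {}"
      unfolding edges_def by blast
    then obtain p q where pq: "e = \<phi> ` {p, q}" "p \<in> B" "q \<in> B" "\<phi> p \<noteq> \<phi> q" "seg (\<phi> ` {p, q}) \<inter> range toR = {}"
      by (metis image_empty image_iff image_insert)
    hence "p \<noteq> q" "seg {p, q} \<inter> range toR = {}" using key[of p q] by blast+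
    hence "{p, q} \<in> edges B" unfolding edges_def using pq(2,3) by blast
    thus "e \<in> (`) \<phi> ` edges B" using pq(1) by blast
  next
    fix e assume "e \<in> (`) \<phi> ` edges B"
    then obtain p q where pq: "e = \<phi> ` {p, q}" "p \<in> B" "q \<in> B" "p \<noteq> q" "seg {p, q} \<inter> range toR = {}"
      unfolding edges_def by auto
    have "e = {\<phi> p, \<phi> q}" "\<phi> p \<noteq> \<phi> q" "seg {\<phi> p, \<phi> q} \<inter> range toR = {}"
      using pq key[of p q] bij by (auto simp: bij_def inj_eq)
    thus "e \<in> edges (\<phi> ` B)" unfolding edges_def using pq(2,3) by blast
  qed
qed

lemma amap_disj:
  assumes "amap \<phi> \<Phi>" "e \<in> edges B" "e' \<in> edges B'"
  shows "seg (\<phi> ` e) \<inter> seg (\<phi> ` e') = {} \<longleftrightarrow> seg e \<inter> seg e' = {}"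
proof -
  obtain p q p' q' where e: "e = {p, q}" "e' = {p', q'}" using assms unfolding edges_def by auto
  have inj: "inj \<Phi>" using assms unfolding amap_def by auto
  have "seg (\<phi> ` e) \<inter> seg (\<phi> ` e') = \<Phi> ` (seg e \<inter> seg e')"
    unfolding e amap_seg[OF assms(1)] by (simp add: image_Int[OF inj])
  thus ?thesis by simp
qed

text \<open>Left and right, top and bottom, rows and columns are interchanged by this: one case is
  proved and the others are transported.\<close>

lemma amap_tri:
  assumes "amap \<phi> \<Phi>" "tri B \<sigma>"
  shows "tri (\<phi> ` B) ((`) \<phi> ` \<sigma>)"
proof -
  have sub: "\<sigma> \<subseteq> edges B" using assms(2) unfolding tri_def by blast
  have bij: "bij \<phi>" using assms unfolding amap_def by auto
  have 1: "(`) \<phi> ` \<sigma> \<subseteq> edges (\<phi> ` B)" using sub by (auto simp: amap_edges[OF assms(1)])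
  have 2: "clique ((`) \<phi> ` \<sigma>)" unfolding clique_def
  proof (intro ballI impI)
    fix e e' assume "e \<in> (`) \<phi> ` \<sigma>" "e' \<in> (`) \<phi> ` \<sigma>" "e \<noteq> e'"
    then obtain f f' where f: "f \<in> \<sigma>" "f' \<in> \<sigma>" "e = \<phi> ` f" "e' = \<phi> ` f'" "f \<noteq> f'" by blast
    hence "seg f \<inter> seg f' = {}" using assms(2) unfolding tri_def clique_def by simp
    thus "seg e \<inter> seg e' = {}" using f sub amap_disj[OF assms(1), of f B f' B] by (simp add: subset_iff)
  qed
  have 3: "\<exists>e'\<in>(`) \<phi> ` \<sigma>. seg e \<inter> seg e' \<noteq> {}" if "e \<in> edges (\<phi> ` B) - (`) \<phi> ` \<sigma>" for e
  proof -
    have "e \<in> (`) \<phi> ` edges B" using that by (simp add: amap_edges[OF assms(1)])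
    then obtain f where f: "f \<in> edges B" "e = \<phi> ` f" by (rule imageE) simp
    have "f \<notin> \<sigma>" using that f(2) by (metis DiffD2 imageI)
    then obtain f' where f': "f' \<in> \<sigma>" "seg f \<inter> seg f' \<noteq> {}" using assms(2) f(1) unfolding tri_def by (metis DiffI)
    hence "seg e \<inter> seg (\<phi> ` f') \<noteq> {}" using f sub amap_disj[OF assms(1), of f B f' B] by (simp add: subset_iff)
    thus ?thesis using f' by blast
  qed
  show ?thesis unfolding tri_def by (intro conjI ballI 1 2 3)
qed

definition shiftx :: "int \<Rightarrow> point \<Rightarrow> point" where "shiftx t p = (fst p + t, snd p)"
definition negx :: "point \<Rightarrow> point" where "negx p = (- fst p, snd p)"
definition negy :: "point \<Rightarrow> point" where "negy p = (fst p, - snd p)"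

lemma amap_shiftx: "amap (shiftx t) (\<lambda>P. (fst P + real_of_int t, snd P))"
proof -
  have "bij (shiftx t)" by (rule bij_betw_byWitness[where f' = "shiftx (-t)"]) (auto simp: shiftx_def)
  thus ?thesis unfolding amap_def by (auto simp: inj_def toR_def shiftx_def prod_eq_iff algebra_simps)
qed
lemma amap_negx: "amap negx (\<lambda>P. (- fst P, snd P))"
proof -
  have "bij negx" by (rule bij_betw_byWitness[where f' = negx]) (auto simp: negx_def)
  thus ?thesis unfolding amap_def by (auto simp: inj_def toR_def negx_def prod_eq_iff)
qed
lemma amap_negy: "amap negy (\<lambda>P. (fst P, - snd P))"
proof -
  have "bij negy" by (rule bij_betw_byWitness[where f' = negy]) (auto simp: negy_def)
  thus ?thesis unfolding amap_def by (auto simp: inj_def toR_def negy_def prod_eq_iff)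
qed
lemma amap_swap: "amap prod.swap (\<lambda>P. (snd P, fst P))"
proof -
  have "bij (prod.swap :: point \<Rightarrow> point)" by (rule bij_betw_byWitness[where f' = prod.swap]) auto
  thus ?thesis unfolding amap_def by (auto simp: inj_def toR_def prod_eq_iff)
qed

lemma shiftx_rect: "shiftx t ` rect a b c d = rect (a + t) (b + t) c d"
proof -
  have "p \<in> shiftx t ` rect a b c d" if "p \<in> rect (a + t) (b + t) c d" for p
    by (rule image_eqI[of _ _ "shiftx (-t) p"]) (use that in \<open>auto simp: shiftx_def rect_def\<close>)
  thus ?thesis by (auto simp: shiftx_def rect_def)
qed
lemma negx_rect: "negx ` rect a b c d = rect (- b) (- a) c d"
proof -
  have "p \<in> negx ` rect a b c d" if "p \<in> rect (- b) (- a) c d" for p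
    by (rule image_eqI[of _ _ "negx p"]) (use that in \<open>auto simp: negx_def rect_def\<close>)
  thus ?thesis by (auto simp: negx_def rect_def)
qed
lemma negy_rect: "negy ` rect a b c d = rect a b (- d) (- c)"
proof -
  have "p \<in> negy ` rect a b c d" if "p \<in> rect a b (- d) (- c)" for p
    by (rule image_eqI[of _ _ "negy p"]) (use that in \<open>auto simp: negy_def rect_def\<close>)
  thus ?thesis by (auto simp: negy_def rect_def)
qed
lemma swap_rect: "prod.swap ` rect a b c d = rect c d a b"
proof -
  have "p \<in> prod.swap ` rect a b c d" if "p \<in> rect c d a b" for p
    by (rule image_eqI[of _ _ "prod.swap p"]) (use that in \<open>auto simp: rect_def\<close>)
  thus ?thesis by (auto simp: rect_def)
qed

lemma hgt_negx: "fst p < fst q \<Longrightarrow> hgt (negx q) (negx p) (- x) = hgt p q x"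
proof -
  assume "fst p < fst q"
  hence d: "rx q - rx p > 0" by simp
  have "hgt (negx q) (negx p) (- x) = ry q + (ry p - ry q) * (rx q - x) / (rx q - rx p)"
    by (simp add: hgt_def negx_def)
  moreover have "(ry q - ry p) * (x - rx p) / (rx q - rx p) = (ry q - ry p) - (ry q - ry p) * (rx q - x) / (rx q - rx p)"
    using d by (simp add: field_simps)
  moreover have "(ry p - ry q) * (rx q - x) / (rx q - rx p) = - ((ry q - ry p) * (rx q - x) / (rx q - rx p))"
  proof -
    have "ry p - ry q = - (ry q - ry p)" by simp
    thus ?thesis by (simp only: mult_minus_left minus_divide_left)
  qed
  ultimately show ?thesis unfolding hgt_def by simp
qed

lemma hgt_negy: "hgt (negy p) (negy q) x = - hgt p q x"
proof -
  have "- P + (- Q - - P) * t / d = - (P + (Q - P) * t / d)" for P Q t d :: real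
    by (simp add: left_diff_distrib diff_divide_distrib)
  from this[of "ry p" "ry q" "x - rx p" "rx q - rx p"] show ?thesis
    unfolding hgt_def negy_def fst_conv snd_conv of_int_minus .
qed

section \<open>The triangular face above an edge\<close>

definition unsep :: "edge set \<Rightarrow> point \<Rightarrow> point \<Rightarrow> point \<Rightarrow> bool" where
  "unsep \<sigma> p q u \<longleftrightarrow> fst p < fst u \<and> fst u < fst q \<and> hgt p q (rx u) < ry u \<and>
     (\<forall>v w. {v, w} \<in> \<sigma> \<and> fst v < fst u \<and> fst u < fst w \<longrightarrow>
        \<not> (hgt p q (rx u) < hgt v w (rx u) \<and> hgt v w (rx u) < ry u))"

definition excess :: "point \<Rightarrow> point \<Rightarrow> point \<Rightarrow> real" where
  "excess p q u = ry u - hgt p q (rx u)"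

text \<open>The excess times the horizontal extent of \<open>pq\<close> is twice the area of the
  triangle \<open>p q u\<close>, so a lowest point spans a triangle of least area. It turns out to
  be the apex of the face above \<open>pq\<close>.\<close>

definition lowest :: "point set \<Rightarrow> edge set \<Rightarrow> point \<Rightarrow> point \<Rightarrow> point \<Rightarrow> bool" where
  "lowest B \<sigma> p q u \<longleftrightarrow> u \<in> B \<and> unsep \<sigma> p q u \<and> (\<forall>w\<in>B. unsep \<sigma> p q w \<longrightarrow> excess p q u \<le> excess p q w)"

lemma hgt_slope: "hgt p w x = ry p + (ry w - ry p) / (rx w - rx p) * (x - rx p)"
  by (simp add: hgt_def)

lemma hgt_below_iff:
  assumes "fst p < fst v" "fst p < fst w"
  shows "ry v < hgt p w (rx v) \<longleftrightarrow> (ry v - ry p) / (rx v - rx p) < (ry w - ry p) / (rx w - rx p)"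
proof -
  have d: "rx v - rx p > 0" using assms by simp
  have "ry v < hgt p w (rx v) \<longleftrightarrow> ry v - ry p < (ry w - ry p) / (rx w - rx p) * (rx v - rx p)"
    unfolding hgt_slope by auto
  also have "\<dots> \<longleftrightarrow> (ry v - ry p) / (rx v - rx p) < (ry w - ry p) / (rx w - rx p)"
    using d by (simp add: pos_divide_less_eq)
  finally show ?thesis .
qed

text \<open>Among the offending points take one of least slope from \<open>p\<close>: the edge separating it from \<open>pq\<close>
  has an endpoint of smaller slope.\<close>
lemma lowest_left_empty:
  assumes T: "tri B \<sigma>" and fin: "finite B" and pq: "{p, q} \<in> \<sigma>" "fst p < fst q" and u: "lowest B \<sigma> p q u"
    and w0: "w0 \<in> B" "fst p < fst w0" "fst w0 \<le> fst u" "w0 \<noteq> u" "hgt p q (rx w0) < ry w0"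
      "ry w0 \<le> hgt p u (rx w0)"
  shows False
proof -
  have cl: "clique \<sigma>" and sub: "\<sigma> \<subseteq> edges B" using T unfolding tri_def by auto
  have uu: "u \<in> B" "unsep \<sigma> p q u" and umin: "\<And>w. w \<in> B \<Longrightarrow> unsep \<sigma> p q w \<Longrightarrow> excess p q u \<le> excess p q w"
    using u unfolding lowest_def by auto
  have ux: "fst p < fst u" "fst u < fst q" "hgt p q (rx u) < ry u"
    and usep: "\<And>v w. {v, w} \<in> \<sigma> \<Longrightarrow> fst v < fst u \<Longrightarrow> fst u < fst w \<Longrightarrow> hgt p q (rx u) < hgt v w (rx u)
       \<Longrightarrow> ry u \<le> hgt v w (rx u)"
    using uu(2) unfolding unsep_def not_less[symmetric] by blast+
  define S where "S = {w \<in> B. fst p < fst w \<and> fst w \<le> fst u \<and> w \<noteq> u \<and> hgt p q (rx w) < ry w \<and> ry w \<le> hgt p u (rx w)}"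
  define sl where "sl w = (ry w - ry p) / (rx w - rx p)" for w :: point
  have "w0 \<in> S" unfolding S_def using w0 by simp
  hence "S \<noteq> {}" by blast
  moreover have "finite S" unfolding S_def using fin by simp
  ultimately obtain w where w: "w \<in> S" "\<And>v. v \<in> S \<Longrightarrow> sl w \<le> sl v"
    using that[of "arg_min_on sl S"] arg_min_if_finite[of S sl] by (metis not_less)
  have w': "w \<in> B" "fst p < fst w" "fst w \<le> fst u" "w \<noteq> u" "hgt p q (rx w) < ry w" "ry w \<le> hgt p u (rx w)"
    using w(1) unfolding S_def by auto
  have noS: False if "v \<in> B" "fst p < fst v" "fst v \<le> fst u" "v \<noteq> u" "hgt p q (rx v) < ry v"
    "ry v \<le> hgt p u (rx v)" "ry v < hgt p w (rx v)" for v
  proof -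
    have "v \<in> S" unfolding S_def using that by auto
    moreover have "sl v < sl w" using hgt_below_iff[OF that(2) w'(2)] that(7) unfolding sl_def by simp
    ultimately show False using w(2) by fastforce
  qed
  \<comment> \<open>A point below \<open>u\<close> in its own column would be unseparated too, with
    a smaller excess.\<close>
  have wu: "fst w < fst u"
  proof (rule ccontr)
    assume "\<not> fst w < fst u"
    hence e: "fst w = fst u" using w' by simp
    have "ry w \<le> ry u" using w'(6) ux unfolding e by simp
    hence lt: "ry w < ry u" using w'(4) e by (metis of_int_eq_iff order_le_less prod_eq_iff)
    have "unsep \<sigma> p q w" unfolding unsep_def e using ux w'(5) usep lt unfolding e by fastforce
    hence "excess p q u \<le> excess p q w" using umin w' by blast
    thus False unfolding excess_def e using lt by simp
  qed
  have lP: "hgt p w x \<le> hgt p u x" if "x \<ge> rx p" for x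
  proof -
    have "sl w \<le> sl u"
      using hgt_below_iff[OF ux(1) w'(2)] w'(6) unfolding sl_def
      by (smt (verit) hgt_slope mult_le_cancel_right of_int_less_iff w'(2) nonzero_eq_divide_eq)
    hence "sl w * (x - rx p) \<le> sl u * (x - rx p)" using that by (intro mult_right_mono) auto
    thus ?thesis unfolding hgt_slope sl_def by simp
  qed
  \<comment> \<open>The line \<open>pu\<close> rises over \<open>pq\<close> in proportion to the
    distance from \<open>p\<close>. Hence a point under it and left of \<open>u\<close> has smaller
    excess than \<open>u\<close>, and some edge \<open>vv'\<close> must separate it from
    \<open>pq\<close>.\<close>
  have exw: "excess p q w < excess p q u"
  proof -
    have "aff (\<lambda>x. hgt p u x - hgt p q x)" by (intro aff_diff aff_hgt)
    hence "hgt p u (rx w) - hgt p q (rx w) < hgt p u (rx u) - hgt p q (rx u)"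
      by (rule aff_less[of _ "rx p" "rx u"]) (use ux wu in auto)
    thus ?thesis unfolding excess_def using w'(6) ux by simp
  qed
  hence "\<not> unsep \<sigma> p q w" using umin w' by fastforce
  then obtain v v' where v: "{v, v'} \<in> \<sigma>" "fst v < fst w" "fst w < fst v'"
      "hgt p q (rx w) < hgt v v' (rx w)" "hgt v v' (rx w) < ry w"
    unfolding unsep_def using w' wu ux by auto
  have vB: "v \<in> B" "v' \<in> B" using v(1) sub edges_ends by blast+
  have wq: "fst w < fst q" using wu ux by simp
  have ordc: "hgt p q y \<le> hgt v v' y" if "rx p \<le> y" "y \<le> rx q" "rx v \<le> y" "y \<le> rx v'" for y
    by (rule clique_order[OF cl pq(1) v(1), of "rx w"]) (use that v w' wq in auto)
  \<comment> \<open>If \<open>vv'\<close> catches up with the line \<open>pw\<close> right of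
    \<open>w\<close>, it is below that line on the left. Then it passes below \<open>p\<close>
    although it runs above \<open>pq\<close>, or its left end belongs to \<open>S\<close> and has a
    smaller slope than \<open>w\<close>.\<close>
  have LA: False if h: "hgt v v' \<xi> \<ge> hgt p w \<xi>" "\<xi> > rx w" for \<xi>
  proof -
    have lt: "hgt v v' x < hgt p w x" if "x \<le> rx w" for x
    proof -
      have "hgt v v' x - hgt p w x < 0"
        by (rule aff_left[OF aff_diff[OF aff_hgt[of v v'] aff_hgt[of p w]], of "rx w" \<xi>])
           (use v h w' that in auto)
      thus ?thesis by simp
    qed
    show False
    proof (cases "fst v \<le> fst p")
      case True
      have "hgt v v' (rx p) < ry p" using lt[of "rx p"] w' by simp
      moreover have "hgt p q (rx p) \<le> hgt v v' (rx p)"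
        by (rule ordc) (use True v w' pq in auto)
      ultimately show False by simp
    next
      case False
      have "hgt p q (rx v) \<le> hgt v v' (rx v)" by (rule ordc) (use False v w' wq in auto)
      moreover have "hgt p q (rx v) \<noteq> ry v"
        by (rule edge_hgt_lattice) (use pq sub False v wq in auto)
      ultimately have a: "hgt p q (rx v) < ry v" by simp
      have b: "ry v < hgt p w (rx v)" using lt[of "rx v"] v by simp
      show False by (rule noS[of v]) (use a b vB False v wu lP[of "rx v"] in auto)
    qed
  qed
  show False
  proof (cases "fst u < fst v'")
    case True
    have "hgt p q (rx u) < hgt v v' (rx u)"
      by (rule clique_order_strict[OF cl pq(1) v(1), of "rx w"]) (use v w' wq ux wu True in auto)
    hence "ry u \<le> hgt v v' (rx u)" using usep[OF v(1)] v wu True by simp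
    moreover have "hgt p w (rx u) \<le> ry u" using lP[of "rx u"] ux by simp
    ultimately show False using LA[of "rx u"] wu by simp
  next
    case False
    have vv: "fst v < fst v'" using v by simp
    show False
    proof (cases "ry v' \<ge> hgt p w (rx v')")
      case True
      show False using LA[of "rx v'"] True vv v by simp
    next
      case F: False
      have "hgt p q (rx v') \<le> hgt v v' (rx v')" by (rule ordc) (use False v w' ux in auto)
      moreover have "hgt p q (rx v') \<noteq> ry v'"
        by (rule edge_hgt_lattice) (use pq sub False v w' ux in auto)
      ultimately have a: "hgt p q (rx v') < ry v'" using vv by simp
      have l: "hgt p w (rx v') \<le> hgt p u (rx v')" using lP v w' by simp
      have "v' \<noteq> u" using F l ux by auto
      thus False using noS[of v'] a F vB False v w' l by simp
    qed
  qed
qed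

lemma edgesI:
  assumes "p \<in> B" "q \<in> B" "p \<noteq> q" "\<And>w. toR w \<notin> seg {p, q}"
  shows "{p, q} \<in> edges B"
proof -
  have "seg {p, q} \<inter> range toR = {}" using assms(4) by (simp add: disjoint_iff image_iff) metis
  thus ?thesis unfolding edges_def using assms(1-3) by blast
qed

lemma aff_uminus: "aff f \<Longrightarrow> aff (\<lambda>x. - f x)"
proof -
  assume "aff f"
  then obtain a b where "\<forall>x. f x = a + b * x" unfolding aff_def by blast
  hence "\<forall>x. - f x = (- a) + (- b) * x" by simp
  thus ?thesis unfolding aff_def by blast
qed

lemma negx_negx [simp]: "negx (negx p) = p" by (simp add: negx_def)
lemma negy_negy [simp]: "negy (negy p) = p" by (simp add: negy_def)
lemma fst_negx [simp]: "fst (negx p) = - fst p" by (simp add: negx_def)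
lemma snd_negx [simp]: "snd (negx p) = snd p" by (simp add: negx_def)
lemma fst_negy [simp]: "fst (negy p) = fst p" by (simp add: negy_def)
lemma snd_negy [simp]: "snd (negy p) = - snd p" by (simp add: negy_def)

lemma image_invol_mem:
  assumes "\<And>x. f (f x) = x"
  shows "{v, w} \<in> (`) f ` \<sigma> \<longleftrightarrow> {f v, f w} \<in> \<sigma>"
proof
  assume "{v, w} \<in> (`) f ` \<sigma>"
  then obtain e where e: "e \<in> \<sigma>" "{v, w} = f ` e" by (rule imageE) simp
  have "f ` {v, w} = e" unfolding e(2) image_image using assms by simp
  thus "{f v, f w} \<in> \<sigma>" using e(1) by simp
next
  assume "{f v, f w} \<in> \<sigma>"
  hence "f ` {f v, f w} \<in> (`) f ` \<sigma>" by (rule imageI)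
  thus "{v, w} \<in> (`) f ` \<sigma>" using assms by simp
qed

lemma image_image_invol: "(\<And>x. f (f x) = x) \<Longrightarrow> (`) f ` (`) f ` \<sigma> = \<sigma>"
  by (simp add: image_image)

lemma unsep_negx_imp:
  assumes "unsep \<sigma> p q u"
  shows "unsep ((`) negx ` \<sigma>) (negx q) (negx p) (negx u)"
proof -
  have h: "fst p < fst u" "fst u < fst q" "hgt p q (rx u) < ry u"
    and n: "\<And>v w. {v, w} \<in> \<sigma> \<Longrightarrow> fst v < fst u \<Longrightarrow> fst u < fst w \<Longrightarrow>
        \<not> (hgt p q (rx u) < hgt v w (rx u) \<and> hgt v w (rx u) < ry u)"
    using assms unfolding unsep_def by auto
  have pq: "hgt (negx q) (negx p) (- rx u) = hgt p q (rx u)" using h by (intro hgt_negx) simp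
  have "\<not> (hgt (negx q) (negx p) (- rx u) < hgt v w (- rx u) \<and> hgt v w (- rx u) < ry u)"
    if "{v, w} \<in> (`) negx ` \<sigma>" "fst v < - fst u" "- fst u < fst w" for v w
  proof -
    have "{negx w, negx v} \<in> \<sigma>" using that(1) image_invol_mem[of negx v w \<sigma>] by (simp add: insert_commute)
    moreover have "hgt v w (- rx u) = hgt (negx w) (negx v) (rx u)"
      using hgt_negx[of "negx w" "negx v" "rx u"] that by simp
    ultimately show ?thesis using n[of "negx w" "negx v"] that pq by simp
  qed
  thus ?thesis unfolding unsep_def using h pq by auto
qed

lemma unsep_negx: "unsep ((`) negx ` \<sigma>) (negx q) (negx p) (negx u) \<longleftrightarrow> unsep \<sigma> p q u"
  using unsep_negx_imp[of \<sigma> p q u] unsep_negx_imp[of "(`) negx ` \<sigma>" "negx q" "negx p" "negx u"]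
  by (auto simp: image_image_invol)

lemma lowest_negx:
  assumes "lowest B \<sigma> p q u"
  shows "lowest (negx ` B) ((`) negx ` \<sigma>) (negx q) (negx p) (negx u)"
proof -
  have u: "u \<in> B" "unsep \<sigma> p q u" and m: "\<And>w. w \<in> B \<Longrightarrow> unsep \<sigma> p q w \<Longrightarrow> excess p q u \<le> excess p q w"
    using assms unfolding lowest_def by auto
  have pq: "fst p < fst q" using u(2) unfolding unsep_def by linarith
  have ex: "excess (negx q) (negx p) (negx w) = excess p q w" for w
    unfolding excess_def using hgt_negx[OF pq, of "rx w"] by simp
  show ?thesis unfolding lowest_def using u m by (auto simp: unsep_negx ex)
qed

lemma lowest_right_empty:
  assumes T: "tri B \<sigma>" and fin: "finite B" and pq: "{p, q} \<in> \<sigma>" "fst p < fst q" and u: "lowest B \<sigma> p q u"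
    and w0: "w0 \<in> B" "fst u \<le> fst w0" "fst w0 < fst q" "w0 \<noteq> u" "hgt p q (rx w0) < ry w0"
      "ry w0 \<le> hgt u q (rx w0)"
  shows False
proof -
  have uq: "fst u < fst q" using u unfolding lowest_def unsep_def by blast
  show False
  proof (rule lowest_left_empty[OF amap_tri[OF amap_negx T] _ _ _ lowest_negx[OF u], of "negx w0"])
    show "{negx q, negx p} \<in> (`) negx ` \<sigma>" using pq by (subst image_invol_mem) (auto simp: insert_commute)
    show "hgt (negx q) (negx p) (rx (negx w0)) < ry (negx w0)" using hgt_negx[OF pq(2), of "rx w0"] w0 by simp
    show "ry (negx w0) \<le> hgt (negx q) (negx u) (rx (negx w0))" using hgt_negx[OF uq, of "rx w0"] w0 by simp
    show "negx w0 \<noteq> negx u" using w0(4) by (metis negx_negx)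
  qed (use fin pq w0 in auto)
qed

lemma aff_pos_between:
  assumes "aff f" "f x1 \<ge> 0" "f x2 > 0" "min x1 x2 < x" "x < max x1 x2"
  shows "f x > 0"
proof -
  obtain a b where f: "\<And>x. f x = a + b * x" using assms(1) unfolding aff_def by blast
  have id: "f x * (x2 - x1) = f x1 * (x2 - x) + f x2 * (x - x1)" unfolding f by (simp add: algebra_simps)
  have "x1 < x \<and> x < x2 \<or> x2 < x \<and> x < x1" using assms(4,5) by auto
  thus ?thesis
  proof
    assume h: "x1 < x \<and> x < x2"
    hence "f x1 * (x2 - x) \<ge> 0" "f x2 * (x - x1) > 0" using assms(2,3) by auto
    hence "f x * (x2 - x1) > 0" using id by linarith
    thus ?thesis using h by (auto simp: zero_less_mult_iff)
  next
    assume h: "x2 < x \<and> x < x1"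
    hence "f x1 * (x2 - x) \<le> 0" "f x2 * (x - x1) < 0" using assms(2,3) by (auto simp: mult_nonneg_nonpos mult_pos_neg)
    hence "f x * (x2 - x1) < 0" using id by linarith
    thus ?thesis using h by (auto simp: mult_less_0_iff)
  qed
qed

lemma hgt_between:
  assumes "fst p < fst q" "rx p \<le> x" "x \<le> rx q"
  shows "min (ry p) (ry q) \<le> hgt p q x \<and> hgt p q x \<le> max (ry p) (ry q)"
proof -
  have d: "rx q - rx p > 0" using assms by simp
  define t where "t = (x - rx p) / (rx q - rx p)"
  have t: "0 \<le> t" "t \<le> 1" unfolding t_def using assms d by auto
  have h: "hgt p q x = ry p + (ry q - ry p) * t" unfolding hgt_def t_def by simp
  show ?thesis
  proof (cases "ry p \<le> ry q")
    case True
    have "0 \<le> (ry q - ry p) * t" using t True by (intro mult_nonneg_nonneg) auto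
    moreover have "(ry q - ry p) * t \<le> (ry q - ry p) * 1" using t True by (intro mult_left_mono) auto
    moreover have "min (ry p) (ry q) = ry p" "max (ry p) (ry q) = ry q" using True by auto
    ultimately have "min (ry p) (ry q) \<le> ry p + (ry q - ry p) * t" "ry p + (ry q - ry p) * t \<le> max (ry p) (ry q)"
      by (simp_all only: mult_1_right)
    thus ?thesis unfolding h by (rule conjI)
  next
    case False
    have "(ry q - ry p) * t \<le> 0" using t False by (intro mult_nonpos_nonneg) auto
    moreover have "(ry q - ry p) * 1 \<le> (ry q - ry p) * t" using t False by (intro mult_left_mono_neg) auto
    moreover have "min (ry p) (ry q) = ry q" "max (ry p) (ry q) = ry p" using False by auto
    ultimately have "min (ry p) (ry q) \<le> ry p + (ry q - ry p) * t" "ry p + (ry q - ry p) * t \<le> max (ry p) (ry q)"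
      by (simp_all only: mult_1_right)
    thus ?thesis unfolding h by (rule conjI)
  qed
qed

lemma hgt_rect:
  assumes "fst p < fst q" "rx p \<le> x" "x \<le> rx q" "p \<in> rect a b c d" "q \<in> rect a b c d"
  shows "real_of_int c \<le> hgt p q x \<and> hgt p q x \<le> real_of_int d"
  using hgt_between[OF assms(1-3)] assms(4,5) by (auto simp: rect_def)

lemma vert_cross:
  assumes cl: "clique \<sigma>" and "{p, q} \<in> \<sigma>" "{v, v'} \<in> \<sigma>" "fst v = fst v'" "snd v < snd v'"
    "fst p < fst v" "fst v < fst q" "ry v < hgt p q (rx v)" "hgt p q (rx v) < ry v'"
  shows False
proof -
  have "(rx v, hgt p q (rx v)) \<in> seg {v, v'}" by (subst seg_vert) (use assms in auto)
  moreover have "(rx v, hgt p q (rx v)) \<in> seg {p, q}" by (subst seg_nonvert) (use assms in auto)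
  moreover have "{p, q} \<noteq> {v, v'}" using assms by (auto simp: doubleton_eq_iff)
  hence "seg {p, q} \<inter> seg {v, v'} = {}" using assms unfolding clique_def by simp
  ultimately show False by (metis disjoint_iff)
qed

text \<open>An edge crossing \<open>pu\<close> would have an end in the region that
  \<open>lowest_left_empty\<close> keeps free, or separate \<open>u\<close> from \<open>pq\<close>,
  or pass below \<open>p\<close> while staying above \<open>pq\<close>. So nothing crosses, and
  maximality supplies the edge.\<close>

lemma lowest_left_edge:
  assumes T: "tri B \<sigma>" and B: "B = rect a b c d" and pq: "{p, q} \<in> \<sigma>" "fst p < fst q" and u: "lowest B \<sigma> p q u"
  shows "{p, u} \<in> \<sigma>"
proof -
  have fin: "finite B" using B by simp
  have cl: "clique \<sigma>" and sub: "\<sigma> \<subseteq> edges B" using T unfolding tri_def by auto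
  have uB: "u \<in> B" and ux: "fst p < fst u" "fst u < fst q" "hgt p q (rx u) < ry u"
    and usep: "\<And>v w. {v, w} \<in> \<sigma> \<Longrightarrow> fst v < fst u \<Longrightarrow> fst u < fst w \<Longrightarrow> hgt p q (rx u) < hgt v w (rx u)
       \<Longrightarrow> ry u \<le> hgt v w (rx u)"
    using u unfolding lowest_def unsep_def not_less[symmetric] by blast+
  have pE: "{p, q} \<in> edges B" using pq sub by blast
  have pB: "p \<in> B" using edges_ends[OF pE] by simp
  note LE = lowest_left_empty[OF T fin pq u]
  have PT: "hgt p q x < hgt p u x" if "rx p < x" "x < rx u" for x
  proof -
    have "hgt p u x - hgt p q x > 0"
      by (rule aff_pos_between[OF aff_diff[OF aff_hgt[of p u] aff_hgt[of p q]], of "rx p" "rx u"])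
         (use that ux in auto)
    thus ?thesis by simp
  qed
  have nolat: False if "w \<in> B" "fst p < fst w" "fst w < fst u" "ry w = hgt p u (rx w)" for w
    by (rule LE[of w]) (use that PT[of "rx w"] in auto)
  have inB: "w \<in> B" if "fst p < fst w" "fst w < fst u" "ry w = hgt p u (rx w)" for w
  proof -
    have "real_of_int c \<le> ry w" "ry w \<le> real_of_int d"
      using hgt_rect[of p u "rx w" a b c d] that ux pB uB unfolding B by auto
    moreover have "a \<le> fst w" "fst w \<le> b" using that pB uB unfolding B rect_def by (auto simp: mem_Times_iff)
    ultimately show ?thesis unfolding B rect_def by (simp add: mem_Times_iff)
  qed
  have nv: False if v: "{v, v'} \<in> \<sigma>" "fst v < fst v'" "{v, v'} \<noteq> {p, u}"
    "rx v < x" "x < rx v'" "rx p < x" "x < rx u" "hgt v v' x = hgt p u x" for v v' x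
  proof -
    have E: "{v, v'} \<in> edges B" using v(1) sub by blast
    have vB: "v \<in> B" "v' \<in> B" using edges_ends[OF E] by auto
    have xq: "x < rx q" using v ux by linarith
    have lt: "hgt p q x < hgt v v' x" using PT v by simp
    have ordc: "hgt p q y \<le> hgt v v' y" if "rx p \<le> y" "y \<le> rx q" "rx v \<le> y" "y \<le> rx v'" for y
      by (rule clique_order[OF cl pq(1) v(1), of x]) (use that v xq lt in auto)
    have strict: "hgt p q (rx z) < ry z" if "hgt p q (rx z) \<le> ry z" "fst p < fst z" "fst z < fst q" for z
      using edge_hgt_lattice[OF pE that(2,3)] that(1) by simp
    define f where "f y = hgt v v' y - hgt p u y" for y
    have af: "aff f" unfolding f_def by (intro aff_diff aff_hgt)
    have fx: "f x = 0" unfolding f_def using v by simp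
    \<comment> \<open>As \<open>f x = 0\<close>, this is the sign of the slope of \<open>f\<close>:
      the edge runs along \<open>pu\<close>, crosses it downwards, or crosses it upwards.\<close>
    consider "f (x + 1) = 0" | "f (x + 1) < 0" | "f (x + 1) > 0" by linarith
    thus False
    proof cases
      case 1
      obtain \<alpha> \<beta> where ab: "\<And>x. f x = \<alpha> + \<beta> * x" using af unfolding aff_def by blast
      have "\<beta> = 0" using 1 fx unfolding ab by (simp add: algebra_simps)
      hence f0: "f y = 0" for y using fx unfolding ab by simp
      have same: "hgt v v' y = hgt p u y" for y using f0[of y] unfolding f_def by simp
      have "\<not> fst v < fst p"
        using edge_hgt_lattice[OF E, of p] same[of "rx p"] v by auto
      moreover have "\<not> fst p < fst v"
        using nolat[OF vB(1)] same[of "rx v"] v by auto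
      ultimately have "fst v = fst p" by simp
      hence "v = p" using same[of "rx p"] by (metis hgt_left of_int_eq_iff prod_eq_iff)
      moreover have "\<not> fst u < fst v'"
        using edge_hgt_lattice[OF E, of u] same[of "rx u"] v ux by auto
      moreover have "\<not> fst v' < fst u"
        using nolat[OF vB(2)] same[of "rx v'"] v by auto
      ultimately have "fst v' = fst u" by simp
      hence "v' = u" using same[of "rx u"] v(2) ux(1) by (metis hgt_right of_int_eq_iff prod_eq_iff)
      thus False using \<open>v = p\<close> v by simp
    next
      case 2
      have neg: "f y < 0" if "y > x" for y
      proof -
        have "(\<lambda>x. - f x) x < (\<lambda>x. - f x) y"
        proof (rule aff_less[of "\<lambda>x. - f x" x "x + 1"])
          show "aff (\<lambda>x. - f x)" by (rule aff_uminus[OF af])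
        qed (use 2 fx that in auto)
        thus ?thesis using fx by simp
      qed
      show False
      proof (cases "fst v' \<le> fst u")
        case True
        have "ry v' < hgt p u (rx v')" using neg[of "rx v'"] v unfolding f_def by simp
        moreover have "hgt p q (rx v') < ry v'" using ordc[of "rx v'"] v True ux by (intro strict) auto
        moreover have "v' \<noteq> u" using calculation ux by auto
        ultimately show False using LE[OF vB(2)] v True by auto
      next
        case False
        have "hgt v v' (rx u) < ry u" using neg[of "rx u"] v ux unfolding f_def by simp
        moreover have "hgt p q (rx u) < hgt v v' (rx u)"
          by (rule clique_order_strict[OF cl pq(1) v(1), of x]) (use v xq lt ux False in auto)
        ultimately show False using usep[OF v(1)] v False by fastforce
      qed
    next
      case 3
      have neg: "f y < 0" if "y < x" for y
        using aff_less[OF af, of x "x + 1" y x] 3 fx that by simp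
      show False
      proof (cases "fst v \<le> fst p")
        case True
        have "hgt v v' (rx p) < ry p" using neg[of "rx p"] v unfolding f_def by simp
        moreover have "hgt p q (rx p) \<le> hgt v v' (rx p)" using True v pq by (intro ordc) auto
        ultimately show False by simp
      next
        case False
        have "ry v < hgt p u (rx v)" using neg[of "rx v"] v unfolding f_def by simp
        moreover have "hgt p q (rx v) < ry v" using ordc[of "rx v"] v False ux xq by (intro strict) auto
        moreover have "v \<noteq> u" using v by auto
        ultimately show False using LE[OF vB(1)] v False by auto
      qed
    qed
  qed
  have vert: False if v: "{v, v'} \<in> \<sigma>" "fst v = fst v'" "snd v < snd v'" "fst p < fst v" "fst v < fst u"
    "ry v < hgt p u (rx v)" "hgt p u (rx v) < ry v'" for v v'
  proof -
    have vB: "v \<in> B" using v(1) sub edges_ends by blast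
    have "hgt p q (rx v) \<noteq> ry v" by (rule edge_hgt_lattice[OF pE]) (use v ux in auto)
    then consider "hgt p q (rx v) < ry v" | "ry v < hgt p q (rx v)" by linarith
    thus False
    proof cases
      case 1
      moreover have "v \<noteq> u" using v by auto
      ultimately show False using LE[OF vB] v by auto
    next
      case 2
      show False by (rule vert_cross[OF cl pq(1) v(1)]) (use 2 v ux PT[of "rx v"] in auto)
    qed
  qed
  show ?thesis
  proof (rule tri_mem[OF T])
    have "toR w \<notin> seg {p, u}" for w
    proof
      assume "toR w \<in> seg {p, u}"
      hence "fst p < fst w" "fst w < fst u" "ry w = hgt p u (rx w)"
        unfolding toR_def seg_nonvert[OF ux(1)] by auto
      thus False using nolat inB by blast
    qed
    thus "{p, u} \<in> edges B" using pB uB ux by (intro edgesI) auto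
  next
    fix e assume e: "e \<in> \<sigma>" "e \<noteq> {p, u}"
    hence "e \<in> edges B" using sub by blast
    thus "seg {p, u} \<inter> seg e = {}"
    proof (cases rule: edges_cases)
      case (1 v v')
      show ?thesis
      proof (rule ccontr)
        assume "seg {p, u} \<inter> seg e \<noteq> {}"
        then obtain x y where "(x, y) \<in> seg {p, u}" "(x, y) \<in> seg {v, v'}" unfolding 1(1) by auto
        thus False using nv[of v v' x] e 1 unfolding seg_nonvert[OF ux(1)] seg_nonvert[OF 1(4)] by auto
      qed
    next
      case (2 v v')
      show ?thesis
      proof (rule ccontr)
        assume "seg {p, u} \<inter> seg e \<noteq> {}"
        then obtain x y where "(x, y) \<in> seg {p, u}" "(x, y) \<in> seg {v, v'}" unfolding 2(1) by auto
        thus False using vert[of v v'] e 2 unfolding seg_nonvert[OF ux(1)] seg_vert[OF 2(4,5)] by auto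
      qed
    qed
  qed
qed

lemma lowest_right_edge:
  assumes T: "tri B \<sigma>" and B: "B = rect a b c d" and pq: "{p, q} \<in> \<sigma>" "fst p < fst q" and u: "lowest B \<sigma> p q u"
  shows "{u, q} \<in> \<sigma>"
proof -
  have "{negx q, negx u} \<in> (`) negx ` \<sigma>"
  proof (rule lowest_left_edge[OF amap_tri[OF amap_negx T] _ _ _ lowest_negx[OF u]])
    show "negx ` B = rect (-b) (-a) c d" unfolding B by (rule negx_rect)
    show "{negx q, negx p} \<in> (`) negx ` \<sigma>" using pq by (subst image_invol_mem) (auto simp: insert_commute)
  qed (use pq in auto)
  thus ?thesis by (subst (asm) image_invol_mem) (auto simp: insert_commute)
qed

section \<open>Signed areas (\<open>cr\<close> is a cross product, twice an oriented area) and
  triangles without lattice points\<close>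

definition cr :: "point \<Rightarrow> point \<Rightarrow> real \<Rightarrow> real \<Rightarrow> real" where
  "cr p q x y = (rx q - rx p) * (y - ry p) - (ry q - ry p) * (x - rx p)"

lemma cr_hgt: "fst p < fst q \<Longrightarrow> cr p q x y = (rx q - rx p) * (y - hgt p q x)"
  by (simp add: cr_def hgt_def field_simps)

lemma cr_swap: "cr q p x y = - cr p q x y"
  by (simp add: cr_def algebra_simps)

lemma cr_pos: "fst p < fst q \<Longrightarrow> cr p q x y > 0 \<longleftrightarrow> hgt p q x < y"
  by (simp add: cr_hgt zero_less_mult_iff)
lemma cr_nonneg: "fst p < fst q \<Longrightarrow> cr p q x y \<ge> 0 \<longleftrightarrow> hgt p q x \<le> y"
  by (simp add: cr_hgt zero_le_mult_iff)

text \<open>If the half-lattice point \<open>m/2\<close> lies in the interior of a lattice triangle, then one of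
  \<open>p + q + u - m\<close>, \<open>m - p\<close>, \<open>m - q\<close>, \<open>m - u\<close> is a further lattice point of the closed triangle.\<close>
lemma empty_triangle_no_half_point:
  assumes vert: "\<And>w. cr p q (rx w) (ry w) \<ge> 0 \<Longrightarrow> cr q u (rx w) (ry w) \<ge> 0 \<Longrightarrow> cr u p (rx w) (ry w) \<ge> 0 \<Longrightarrow> w \<in> {p, q, u}"
    and m: "cr p q (rx m / 2) (ry m / 2) > 0" "cr q u (rx m / 2) (ry m / 2) > 0" "cr u p (rx m / 2) (ry m / 2) > 0"
  shows False
proof -
  define A where "A = cr p q (rx u) (ry u)"
  define g1 where "g1 = cr p q (rx m / 2) (ry m / 2)"
  define g2 where "g2 = cr q u (rx m / 2) (ry m / 2)"
  define g3 where "g3 = cr u p (rx m / 2) (ry m / 2)"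
  \<comment> \<open>Barycentric coordinates: the areas cut off by a point add up to the area of the
    whole triangle.\<close>
  have "cr p q x y + cr q u x y + cr u p x y = A" for x y unfolding A_def cr_def by (simp add: algebra_simps)
  hence sum: "g1 + g2 + g3 = A" unfolding g1_def g2_def g3_def .
  have verts: "cr p q (rx p) (ry p) = 0" "cr p q (rx q) (ry q) = 0" "cr q u (rx q) (ry q) = 0" "cr q u (rx u) (ry u) = 0"
     "cr u p (rx u) (ry u) = 0" "cr u p (rx p) (ry p) = 0" unfolding cr_def by (simp_all add: algebra_simps)
  have vertA: "cr q u (rx p) (ry p) = A" "cr u p (rx q) (ry q) = A" unfolding A_def cr_def by (simp_all add: algebra_simps)
  have refl: "cr s t (rx m - x) (ry m - y) = 2 * cr s t (rx m / 2) (ry m / 2) - cr s t x y" for s t x y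
  proof -
    have "cr s t (2 * X - x) (2 * Y - y) = 2 * cr s t X Y - cr s t x y" for X Y
      unfolding cr_def by (simp add: algebra_simps)
    from this[of "rx m / 2" "ry m / 2"] show ?thesis by simp
  qed
  have pos: False if "cr p q (rx w) (ry w) > 0" "cr q u (rx w) (ry w) > 0" "cr u p (rx w) (ry w) > 0" for w
    using vert[of w] that verts by auto
  define w0 where "w0 = (fst p + fst q + fst u - fst m, snd p + snd q + snd u - snd m)"
  have W: "cr p q (rx w0) (ry w0) = A - 2 * g1" "cr q u (rx w0) (ry w0) = A - 2 * g2" "cr u p (rx w0) (ry w0) = A - 2 * g3"
  proof -
    have "cr p q (rx p + rx q + rx u - 2 * X) (ry p + ry q + ry u - 2 * Y) = A - 2 * cr p q X Y"
      "cr q u (rx p + rx q + rx u - 2 * X) (ry p + ry q + ry u - 2 * Y) = A - 2 * cr q u X Y"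
      "cr u p (rx p + rx q + rx u - 2 * X) (ry p + ry q + ry u - 2 * Y) = A - 2 * cr u p X Y" for X Y
      unfolding A_def cr_def by (simp_all add: algebra_simps)
    from this[of "rx m / 2" "ry m / 2"]
    show "cr p q (rx w0) (ry w0) = A - 2 * g1" "cr q u (rx w0) (ry w0) = A - 2 * g2" "cr u p (rx w0) (ry w0) = A - 2 * g3"
      unfolding w0_def g1_def g2_def g3_def by simp_all
  qed
  \<comment> \<open>The coordinates of \<open>w0\<close> are \<open>A - 2 * g\<close> for the three
    values of \<open>g\<close>, so it lies in the triangle unless one of them exceeds
    \<open>A / 2\<close>. In that case the vertex opposite to the side in question, reflected in
    \<open>m/2\<close>, is an interior lattice point.\<close>
  consider "A - 2 * g1 \<ge> 0" "A - 2 * g2 \<ge> 0" "A - 2 * g3 \<ge> 0" | "2 * g1 > A" | "2 * g2 > A" | "2 * g3 > A" by linarith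
  thus False
  proof cases
    case 1
    hence "w0 \<in> {p, q, u}" by (intro vert) (simp_all add: W)
    thus False
    proof (elim insertE emptyE)
      assume "w0 = p" hence "A - 2 * g2 = A" using W(2) vertA(1) by simp thus False using m(2) unfolding g2_def by simp
    next
      assume "w0 = q" hence "A - 2 * g3 = A" using W(3) vertA(2) by simp thus False using m(3) unfolding g3_def by simp
    next
      assume "w0 = u" hence "A - 2 * g1 = A" using W(1) unfolding A_def by simp thus False using m(1) unfolding g1_def by simp
    qed
  next
    case 2
    show False by (rule pos[of "(fst m - fst u, snd m - snd u)"])
      (use 2 m sum in \<open>simp_all add: refl verts g1_def[symmetric] g2_def[symmetric] g3_def[symmetric] A_def[symmetric]\<close>)
  next
    case 3
    show False by (rule pos[of "(fst m - fst p, snd m - snd p)"])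
      (use 3 m sum in \<open>simp_all add: refl verts vertA g1_def[symmetric] g2_def[symmetric] g3_def[symmetric]\<close>)
  next
    case 4
    show False by (rule pos[of "(fst m - fst q, snd m - snd q)"])
      (use 4 m sum in \<open>simp_all add: refl verts vertA g1_def[symmetric] g2_def[symmetric] g3_def[symmetric]\<close>)
  qed
qed

text \<open>The areas are barycentric weights, so each coordinate of \<open>w\<close> is a convex
  combination of those of the vertices. This keeps lattice points of the triangle inside the
  rectangle.\<close>

lemma triangle_bounds:
  fixes f :: "point \<Rightarrow> real"
  assumes "cr p q (rx u) (ry u) > 0"
    "cr p q (rx w) (ry w) \<ge> 0" "cr q u (rx w) (ry w) \<ge> 0" "cr u p (rx w) (ry w) \<ge> 0"
    and f: "f = rx \<or> f = ry"
  shows "f p \<ge> t \<Longrightarrow> f q \<ge> t \<Longrightarrow> f u \<ge> t \<Longrightarrow> f w \<ge> t"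
    and "f p \<le> t \<Longrightarrow> f q \<le> t \<Longrightarrow> f u \<le> t \<Longrightarrow> f w \<le> t"
proof -
  let ?A = "cr p q (rx u) (ry u)" let ?g1 = "cr p q (rx w) (ry w)" let ?g2 = "cr q u (rx w) (ry w)" let ?g3 = "cr u p (rx w) (ry w)"
  have "?A * (rx w - t) = ?g2 * (rx p - t) + ?g3 * (rx q - t) + ?g1 * (rx u - t)"
    "?A * (ry w - t) = ?g2 * (ry p - t) + ?g3 * (ry q - t) + ?g1 * (ry u - t)" for t
    unfolding cr_def by (simp_all add: algebra_simps)
  hence id: "?A * (f w - t) = ?g2 * (f p - t) + ?g3 * (f q - t) + ?g1 * (f u - t)" for t using f by auto
  {
    assume "f p \<ge> t" "f q \<ge> t" "f u \<ge> t"
    hence "?A * (f w - t) \<ge> 0" unfolding id using assms by (intro add_nonneg_nonneg mult_nonneg_nonneg) auto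
    thus "f w \<ge> t" using assms(1) by (simp add: zero_le_mult_iff)
  }
  {
    assume "f p \<le> t" "f q \<le> t" "f u \<le> t"
    hence "?A * (f w - t) \<le> 0" unfolding id using assms by (intro add_nonpos_nonpos mult_nonneg_nonpos) auto
    thus "f w \<le> t" using assms(1) by (simp add: mult_le_0_iff)
  }
qed

text \<open>The lowest unseparated point \<open>u\<close> provides the edges \<open>pu\<close> and
  \<open>uq\<close>, and the triangle \<open>p q u\<close> has no further lattice point. By
  \<open>cons\<close> the point \<open>m/2\<close> is trapped between \<open>pq\<close> and these
  edges, hence inside an empty triangle. Since \<open>fst m\<close> is odd, its column contains no
  lattice point.\<close>

lemma face_above:
  assumes T: "tri B \<sigma>" and B: "B = rect a b c d" and pq: "{p, q} \<in> \<sigma>" and u0: "u0 \<in> B" "unsep \<sigma> p q u0"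
    and m: "odd (fst m)" "rx p < rx m / 2" "rx m / 2 < rx q" "hgt p q (rx m / 2) < ry m / 2"
    and cons: "\<And>v w. {v, w} \<in> \<sigma> \<Longrightarrow> rx v < rx m / 2 \<Longrightarrow> rx m / 2 < rx w \<Longrightarrow>
       hgt v w (rx m / 2) \<le> hgt p q (rx m / 2) \<or> ry m / 2 < hgt v w (rx m / 2)"
  shows False
proof -
  let ?z = "rx m / 2"
  have fin: "finite B" using B by simp
  define U where "U = {w \<in> B. unsep \<sigma> p q w}"
  have "u0 \<in> U" unfolding U_def using u0 by simp
  hence "U \<noteq> {}" by blast
  have "finite U" unfolding U_def using fin by simp
  define u where "u = arg_min_on (excess p q) U"
  have "u \<in> U" "\<forall>w\<in>U. excess p q u \<le> excess p q w"
    using arg_min_if_finite[OF \<open>finite U\<close> \<open>U \<noteq> {}\<close>, of "excess p q"] unfolding u_def by (auto simp: not_less)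
  hence u: "lowest B \<sigma> p q u" unfolding lowest_def U_def by auto
  have uB: "u \<in> B" and ux: "fst p < fst u" "fst u < fst q" "hgt p q (rx u) < ry u"
    using u unfolding lowest_def unsep_def by auto
  have pq': "fst p < fst q" using ux by simp
  have sub: "\<sigma> \<subseteq> edges B" using T unfolding tri_def by auto
  have pE: "{p, q} \<in> edges B" using pq sub by blast
  have pB: "p \<in> B" "q \<in> B" using edges_ends[OF pE] by auto
  have A: "cr p q (rx u) (ry u) > 0" using cr_pos[OF pq'] ux by simp
  have vert: "w \<in> {p, q, u}" if g: "cr p q (rx w) (ry w) \<ge> 0" "cr q u (rx w) (ry w) \<ge> 0" "cr u p (rx w) (ry w) \<ge> 0" for w
  proof (rule ccontr)
    assume nw: "w \<notin> {p, q, u}"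
    note tb = triangle_bounds[OF A g]
    have bd: "a \<le> fst v \<and> fst v \<le> b \<and> c \<le> snd v \<and> snd v \<le> d" if "v \<in> B" for v
      using that unfolding B rect_def by (simp add: mem_Times_iff)
    have "real_of_int a \<le> rx w" by (rule tb(1)) (use bd[OF pB(1)] bd[OF pB(2)] bd[OF uB] in simp_all)
    moreover have "rx w \<le> real_of_int b" by (rule tb(2)) (use bd[OF pB(1)] bd[OF pB(2)] bd[OF uB] in simp_all)
    moreover have "real_of_int c \<le> ry w" by (rule tb(1)) (use bd[OF pB(1)] bd[OF pB(2)] bd[OF uB] in simp_all)
    moreover have "ry w \<le> real_of_int d" by (rule tb(2)) (use bd[OF pB(1)] bd[OF pB(2)] bd[OF uB] in simp_all)
    ultimately have wB: "w \<in> B" unfolding B rect_def by (simp add: mem_Times_iff)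
    have pw: "fst p \<le> fst w" "fst w \<le> fst q" using tb(1)[of rx "rx p"] tb(2)[of rx "rx q"] ux by auto
    have h: "hgt p q (rx w) \<le> ry w" using g(1) cr_nonneg[OF pq'] by simp
    have l: "ry w \<le> hgt p u (rx w)" using g(3) cr_hgt[OF ux(1)] ux by (simp add: cr_swap[of u p] mult_le_0_iff)
    have r: "ry w \<le> hgt u q (rx w)" using g(2) cr_hgt[OF ux(2)] ux by (simp add: cr_swap[of q u] mult_le_0_iff)
    have "fst w \<noteq> fst p"
    proof
      assume e: "fst w = fst p"
      have "snd w = snd p" using h l unfolding e by simp
      thus False using e nw by (auto simp: prod_eq_iff)
    qed
    moreover have "fst w \<noteq> fst q"
    proof
      assume e: "fst w = fst q"
      have "snd w = snd q" using h r ux unfolding e by simp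
      thus False using e nw by (auto simp: prod_eq_iff)
    qed
    ultimately have s: "fst p < fst w" "fst w < fst q" using pw by auto
    have "hgt p q (rx w) \<noteq> ry w" by (rule edge_hgt_lattice[OF pE s])
    hence h': "hgt p q (rx w) < ry w" using h by simp
    show False
    proof (cases "fst w \<le> fst u")
      case True
      show False by (rule lowest_left_empty[OF T fin pq pq' u wB]) (use s True nw h' l in auto)
    next
      case False
      show False by (rule lowest_right_empty[OF T fin pq pq' u wB]) (use s False nw h' r in auto)
    qed
  qed
  have e1: "{p, u} \<in> \<sigma>" by (rule lowest_left_edge[OF T B pq pq' u])
  have e2: "{u, q} \<in> \<sigma>" by (rule lowest_right_edge[OF T B pq pq' u])
  have ne: "?z \<noteq> rx u"
  proof
    assume "?z = rx u"
    hence "rx m = real_of_int (2 * fst u)" by simp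
    thus False using m(1) by (metis dvd_triv_left of_int_eq_iff)
  qed
  have k1: "cr p q ?z (ry m / 2) > 0" using cr_pos[OF pq'] m by simp
  \<comment> \<open>On its own side of \<open>u\<close> the point is under the triangle side because
    of \<open>cons\<close>. The line of the other side is at least as high there, since the path
    from \<open>p\<close> over \<open>u\<close> to \<open>q\<close> is concave.\<close>
  have below: "cr u p ?z (ry m / 2) > 0 \<and> cr q u ?z (ry m / 2) > 0"
  proof (cases "?z < rx u")
    case True
    have "hgt p u ?z - hgt p q ?z > 0"
      by (rule aff_pos_between[OF aff_diff[OF aff_hgt[of p u] aff_hgt[of p q]], of "rx p" "rx u"])
         (use True m ux in auto)
    hence "ry m / 2 < hgt p u ?z" using cons[OF e1] True m by auto
    hence a: "cr u p ?z (ry m / 2) > 0" using cr_hgt[OF ux(1)] ux by (simp add: cr_swap[of u p] mult_less_0_iff)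
    have "hgt u q ?z - hgt p u ?z \<ge> 0"
    proof (rule ccontr)
      assume n: "\<not> ?thesis"
      have "hgt u q ?z - hgt p u ?z < 0" using n by simp
      moreover have "hgt u q (rx u) - hgt p u (rx u) = 0" using ux by simp
      ultimately have "(\<lambda>x. hgt u q x - hgt p u x) (rx q) > 0"
        using aff_less[OF aff_diff[OF aff_hgt[of u q] aff_hgt[of p u]], of ?z "rx u" "rx u" "rx q"] True ux by simp
      hence "hgt p u (rx q) - ry q < 0" using pq' ux by simp
      moreover have "hgt p u (rx q) - hgt p q (rx q) > hgt p u (rx u) - hgt p q (rx u)"
        by (rule aff_less[OF aff_diff[OF aff_hgt[of p u] aff_hgt[of p q]], of "rx p" "rx u"]) (use ux in auto)
      ultimately show False using ux pq' by simp
    qed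
    hence "ry m / 2 < hgt u q ?z" using \<open>ry m / 2 < hgt p u ?z\<close> by simp
    hence "cr q u ?z (ry m / 2) > 0" using cr_hgt[OF ux(2)] ux by (simp add: cr_swap[of q u] mult_less_0_iff)
    thus ?thesis using a by simp
  next
    case False
    hence gt: "rx u < ?z" using ne by simp
    have "hgt u q ?z - hgt p q ?z > 0"
      by (rule aff_pos_between[OF aff_diff[OF aff_hgt[of u q] aff_hgt[of p q]], of "rx q" "rx u"])
         (use gt m ux in auto)
    hence lt: "ry m / 2 < hgt u q ?z" using cons[OF e2] gt m by auto
    hence a: "cr q u ?z (ry m / 2) > 0" using cr_hgt[OF ux(2)] ux by (simp add: cr_swap[of q u] mult_less_0_iff)
    have "hgt p u ?z - hgt u q ?z \<ge> 0"
    proof (rule ccontr)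
      assume n: "\<not> ?thesis"
      have i: "hgt u q (rx u) - hgt p u (rx u) = 0" using ux by simp
      hence "hgt u q (rx q) - hgt p u (rx q) > hgt u q (rx u) - hgt p u (rx u)"
        using aff_less[OF aff_diff[OF aff_hgt[of u q] aff_hgt[of p u]], of "rx u" ?z "rx u" "rx q"] n gt ux by simp
      hence "hgt p u (rx q) - ry q < 0" using pq' ux by simp
      moreover have "hgt p u (rx q) - hgt p q (rx q) > hgt p u (rx u) - hgt p q (rx u)"
        by (rule aff_less[OF aff_diff[OF aff_hgt[of p u] aff_hgt[of p q]], of "rx p" "rx u"]) (use ux in auto)
      ultimately show False using ux pq' by simp
    qed
    hence "ry m / 2 < hgt p u ?z" using lt by simp
    hence "cr u p ?z (ry m / 2) > 0" using cr_hgt[OF ux(1)] ux by (simp add: cr_swap[of u p] mult_less_0_iff)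
    thus ?thesis using a by simp
  qed
  show False by (rule empty_triangle_no_half_point[of p q u m]) (use vert k1 below in blast)+
qed

text \<open>Mirror image of \<open>face_above\<close> in the horizontal axis. The condition on
  \<open>u0\<close> is spelled out because \<open>unsep\<close> only looks upwards.\<close>

lemma face_below:
  assumes T: "tri B \<sigma>" and B: "B = rect a b c d" and pq: "{p, q} \<in> \<sigma>" and u0: "u0 \<in> B"
      "fst p < fst u0" "fst u0 < fst q" "ry u0 < hgt p q (rx u0)"
      "\<And>v w. {v, w} \<in> \<sigma> \<Longrightarrow> fst v < fst u0 \<Longrightarrow> fst u0 < fst w \<Longrightarrow>
        \<not> (ry u0 < hgt v w (rx u0) \<and> hgt v w (rx u0) < hgt p q (rx u0))"
    and m: "odd (fst m)" "rx p < rx m / 2" "rx m / 2 < rx q" "ry m / 2 < hgt p q (rx m / 2)"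
    and cons: "\<And>v w. {v, w} \<in> \<sigma> \<Longrightarrow> rx v < rx m / 2 \<Longrightarrow> rx m / 2 < rx w \<Longrightarrow>
       hgt v w (rx m / 2) \<ge> hgt p q (rx m / 2) \<or> ry m / 2 > hgt v w (rx m / 2)"
  shows False
proof -
  have ed: "{negy v, negy w} \<in> \<sigma>" if "{v, w} \<in> (`) negy ` \<sigma>" for v w
    using that by (subst (asm) image_invol_mem) auto
  have un: "unsep ((`) negy ` \<sigma>) (negy p) (negy q) (negy u0)"
    unfolding unsep_def
  proof (intro conjI allI impI)
    fix v w assume h: "{v, w} \<in> (`) negy ` \<sigma> \<and> fst v < fst (negy u0) \<and> fst (negy u0) < fst w"
    show "\<not> (hgt (negy p) (negy q) (rx (negy u0)) < hgt v w (rx (negy u0)) \<and> hgt v w (rx (negy u0)) < ry (negy u0))"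
      using u0(5)[OF ed, of v w] h by (auto simp: hgt_negy)
  qed (use u0 in \<open>auto simp: hgt_negy\<close>)
  show False
  proof (rule face_above[OF amap_tri[OF amap_negy T] _ _ _ un, of a b "- d" "- c" "negy m"])
    show "negy ` B = rect a b (-d) (-c)" unfolding B by (rule negy_rect)
    show "{negy p, negy q} \<in> (`) negy ` \<sigma>" using pq by (subst image_invol_mem) auto
    fix v w assume h: "{v, w} \<in> (`) negy ` \<sigma>" "rx v < rx (negy m) / 2" "rx (negy m) / 2 < rx w"
    show "hgt v w (rx (negy m) / 2) \<le> hgt (negy p) (negy q) (rx (negy m) / 2) \<or> ry (negy m) / 2 < hgt v w (rx (negy m) / 2)"
      using cons[OF ed[OF h(1)]] h by (auto simp: hgt_negy)
  qed (use u0 m in \<open>auto simp: hgt_negy\<close>)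
qed

section \<open>Midpoints of triangulations\<close>

lemma aff_const: "aff (\<lambda>_. r)"
proof -
  have "\<forall>x. r = r + 0 * x" by simp
  thus ?thesis unfolding aff_def by blast
qed

text \<open>An edge meeting this boundary segment must have both ends in the bottom row, as the
  rectangle lies on one side of it; missing the lattice then leaves only the unit edge itself. So
  nothing crosses it.\<close>

lemma bottom_edge:
  assumes T: "tri (rect a b c d) \<sigma>" and j: "a \<le> j" "j + 1 \<le> b" "c \<le> d"
  shows "{(j, c), (j + 1, c)} \<in> \<sigma>"
proof (rule tri_mem[OF T])
  let ?p = "(j, c)" let ?q = "(j + 1, c)"
  have pq: "fst ?p < fst ?q" by simp
  have h: "hgt ?p ?q x = real_of_int c" for x by (simp add: hgt_def)
  have E: "{?p, ?q} \<in> edges (rect a b c d)"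
  proof (rule edgesI)
    fix w show "toR w \<notin> seg {?p, ?q}" unfolding toR_def seg_nonvert[OF pq] by auto
  qed (use j in \<open>auto simp: rect_def\<close>)
  show "{?p, ?q} \<in> edges (rect a b c d)" by (rule E)
  fix e assume e: "e \<in> \<sigma>" "e \<noteq> {?p, ?q}"
  hence eE: "e \<in> edges (rect a b c d)" using T unfolding tri_def by blast
  show "seg {?p, ?q} \<inter> seg e = {}"
  proof (rule ccontr)
    assume "seg {?p, ?q} \<inter> seg e \<noteq> {}"
    then obtain x y where "(x, y) \<in> seg {?p, ?q}" and xe: "(x, y) \<in> seg e" by auto
    hence xy: "real_of_int j < x" "x < real_of_int (j + 1)" "y = real_of_int c"
      unfolding seg_nonvert[OF pq] h by auto
    from eE show False
    proof (cases rule: edges_cases)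
      case (1 v w)
      have vw: "rx v < x" "x < rx w" "hgt v w x = real_of_int c"
        using xe xy unfolding 1(1) seg_nonvert[OF 1(4)] by auto
      have "fst v < j + 1" using vw xy by linarith
      hence vj: "fst v \<le> j" by simp
      have wj: "j + 1 \<le> fst w" using vw xy by linarith
      have vc: "c \<le> snd v" "c \<le> snd w" using 1 by (auto simp: rect_def)
      have "\<not> c < snd v"
      proof
        assume cv: "c < snd v"
        have "hgt v w x - real_of_int c > 0"
          by (rule aff_pos_between[of "\<lambda>x. hgt v w x - real_of_int c" "rx w" "rx v" x, OF aff_diff[OF aff_hgt aff_const]])
             (use cv vc vw 1(4) in auto)
        thus False using vw by simp
      qed
      moreover have "\<not> c < snd w"
      proof
        assume cv: "c < snd w"
        have "hgt v w x - real_of_int c > 0"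
          by (rule aff_pos_between[of "\<lambda>x. hgt v w x - real_of_int c" "rx v" "rx w" x, OF aff_diff[OF aff_hgt aff_const]])
             (use cv vc vw 1(4) in auto)
        thus False using vw by simp
      qed
      ultimately have s: "snd v = c" "snd w = c" using vc by auto
      have hh: "hgt v w x = real_of_int c" for x using s by (simp add: hgt_def)
      have "\<not> fst v < j" using edge_hgt_lattice[of v w "rect a b c d" "(j, c)"] eE hh wj unfolding 1(1) by auto
      moreover have "\<not> j + 1 < fst w" using edge_hgt_lattice[of v w "rect a b c d" "(j + 1, c)"] eE hh vj unfolding 1(1) by auto
      ultimately have "v = (j, c)" "w = (j + 1, c)" using s vj wj by (auto simp: prod_eq_iff)
      thus False using e 1 by simp
    next
      case (2 v w)
      have "x = rx v" using xe unfolding 2(1) seg_vert[OF 2(4,5)] by simp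
      hence "j < fst v" "fst v < j + 1" using xy by simp_all
      thus False by simp
    qed
  qed
qed

lemma top_edge:
  assumes T: "tri (rect a b c d) \<sigma>" and j: "a \<le> j" "j + 1 \<le> b" "c \<le> d"
  shows "{(j, d), (j + 1, d)} \<in> \<sigma>"
proof -
  have "{(j, - d), (j + 1, - d)} \<in> (`) negy ` \<sigma>"
    using amap_tri[OF amap_negy T] j by (intro bottom_edge[of a b _ "- c"]) (auto simp: negy_rect)
  thus ?thesis by (subst (asm) image_invol_mem) (auto simp: negy_def)
qed

lemma left_edge:
  assumes T: "tri (rect a b c d) \<sigma>" and j: "c \<le> j" "j + 1 \<le> d" "a \<le> b"
  shows "{(a, j), (a, j + 1)} \<in> \<sigma>"
proof -
  have "{(j, a), (j + 1, a)} \<in> (`) prod.swap ` \<sigma>"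
    using amap_tri[OF amap_swap T] j by (intro bottom_edge[of c d _ b]) (auto simp: swap_rect)
  thus ?thesis by (subst (asm) image_invol_mem) auto
qed

lemma right_edge:
  assumes T: "tri (rect a b c d) \<sigma>" and j: "c \<le> j" "j + 1 \<le> d" "a \<le> b"
  shows "{(b, j), (b, j + 1)} \<in> \<sigma>"
proof -
  have "{(j, b), (j + 1, b)} \<in> (`) prod.swap ` \<sigma>"
    using amap_tri[OF amap_swap T] j by (intro top_edge[of c d a b]) (auto simp: swap_rect)
  thus ?thesis by (subst (asm) image_invol_mem) auto
qed

section \<open>The cell around a point with half-integral abscissa\<close>

lemma hgt_reflect:
  assumes "fst p < fst q" "hgt p q X = Y"
  shows "hgt p q (2 * X - x) = 2 * Y - hgt p q x"
proof -
  obtain \<alpha> \<beta> where h: "\<And>x. hgt p q x = \<alpha> + \<beta> * x" using aff_hgt[of p q] unfolding aff_def by blast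
  show ?thesis using assms(2) unfolding h by (auto simp: algebra_simps)
qed

text \<open>Point reflection in \<open>m/2\<close> preserves the line and the lattice. It would map
  the nearer end to a lattice point of the open edge unless both ends are equally far.\<close>

lemma half_point_is_midpoint:
  assumes E: "{v, w} \<in> edges B" and v: "fst v < fst w" "rx v < rx m / 2" "rx m / 2 < rx w" "hgt v w (rx m / 2) = ry m / 2"
  shows "fst v + fst w = fst m \<and> snd v + snd w = snd m"
proof -
  have r: "hgt v w (rx m - x) = ry m - hgt v w x" for x
    using hgt_reflect[OF v(1) v(4), of x] by simp
  have "\<not> fst m < fst v + fst w"
    using edge_hgt_lattice[OF E, of "(fst m - fst v, snd m - snd v)"] r[of "rx v"] v by auto
  moreover have "\<not> fst v + fst w < fst m"
    using edge_hgt_lattice[OF E, of "(fst m - fst w, snd m - snd w)"] r[of "rx w"] v by auto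
  ultimately have a: "fst v + fst w = fst m" by simp
  hence "rx m - rx v = rx w" by simp
  hence "hgt v w (rx w) = ry m - ry v" using r[of "rx v"] by simp
  hence "ry v + ry w = ry m" using v(1) by simp
  thus ?thesis using a by linarith
qed

text \<open>The known order may sit over an endpoint, so \<open>clique_order\<close> is applied
  backwards, from the interior column \<open>y\<close> to \<open>x\<close>.\<close>

lemma clique_order_from_end:
  assumes cl: "clique \<sigma>" and "{p, q} \<in> \<sigma>" "{a, b} \<in> \<sigma>"
    "rx p \<le> x" "x \<le> rx q" "rx a \<le> x" "x \<le> rx b" "hgt p q x < hgt a b x"
    "rx p < y" "y < rx q" "rx a < y" "y < rx b"
  shows "hgt p q y < hgt a b y"
proof -
  have "\<not> hgt a b y < hgt p q y"
    using clique_order[OF cl assms(3,2), of y x] assms by auto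
  moreover have "hgt p q y \<noteq> hgt a b y"
  proof (rule clique_hgt_ne[OF cl assms(2,3)])
    show "{p, q} \<noteq> {a, b}"
    proof
      assume "{p, q} = {a, b}"
      moreover have "fst p < fst q" "fst a < fst b" using assms by auto
      ultimately show False using assms(8) by (auto simp: doubleton_eq_iff)
    qed
  qed (use assms in auto)
  ultimately show ?thesis by simp
qed

text \<open>Here \<open>pq\<close> and \<open>uv\<close> are the edges next below and above the point \<open>m/2\<close>. Unless they span the same
  columns, one of them sees an unseparated vertex of the other; otherwise a diagonal of the cell could be added
  or the cell is a triangle with a vertical side of length 1.\<close>
lemma empty_cell:
  assumes T: "tri B \<sigma>" and B: "B = rect a b c d" and t: "{p, q} \<in> \<sigma>" "fst p < fst q" and s: "{u, v} \<in> \<sigma>" "fst u < fst v"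
    and m: "odd (fst m)" "rx p < rx m / 2" "rx m / 2 < rx q" "rx u < rx m / 2" "rx m / 2 < rx v"
       "hgt p q (rx m / 2) < ry m / 2" "ry m / 2 < hgt u v (rx m / 2)"
    and cons: "\<And>e f. {e, f} \<in> \<sigma> \<Longrightarrow> rx e < rx m / 2 \<Longrightarrow> rx m / 2 < rx f \<Longrightarrow>
       hgt e f (rx m / 2) \<le> hgt p q (rx m / 2) \<or> hgt u v (rx m / 2) \<le> hgt e f (rx m / 2)"
  shows False
proof -
  let ?z = "rx m / 2" let ?T = "hgt p q" let ?S = "hgt u v"
  have cl: "clique \<sigma>" and sub: "\<sigma> \<subseteq> edges B" using T unfolding tri_def by auto
  have tE: "{p, q} \<in> edges B" and sE: "{u, v} \<in> edges B" using t s sub by auto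
  have mem: "p \<in> B" "q \<in> B" "u \<in> B" "v \<in> B" using edges_ends[OF tE] edges_ends[OF sE] by auto
  have zne: "?z \<noteq> rx w" for w
  proof
    assume "?z = rx w"
    hence "rx m = real_of_int (2 * fst w)" by simp
    thus False using m(1) by (metis dvd_triv_left of_int_eq_iff)
  qed
  have TSz: "?T ?z < ?S ?z" using m by simp
  have TS: "?T x \<le> ?S x" if "rx p \<le> x" "x \<le> rx q" "rx u \<le> x" "x \<le> rx v" for x
    by (rule clique_order[OF cl t(1) s(1), of ?z]) (use that m TSz in auto)
  have TSs: "?T x < ?S x" if "rx p < x" "x < rx q" "rx u < x" "x < rx v" for x
    by (rule clique_order_strict[OF cl t(1) s(1), of ?z]) (use that m TSz in auto)
  have abv: "?T (rx w) < ry w" if "?T (rx w) \<le> ry w" "fst p < fst w" "fst w < fst q" for w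
    using edge_hgt_lattice[OF tE that(2,3)] that(1) by simp
  have blw: "ry w < ?S (rx w)" if "ry w \<le> ?S (rx w)" "fst u < fst w" "fst w < fst v" for w
    using edge_hgt_lattice[OF sE that(2,3)] that(1) by simp
  define L where "L = {w \<in> B. fst p < fst w \<and> fst w < fst q \<and> fst u < fst w \<and> fst w < fst v \<and> ?T (rx w) < ry w \<and> ry w < ?S (rx w)}"
  \<comment> \<open>By \<open>cons\<close> an edge inside the cell cannot span the column of
    \<open>m/2\<close>. Its end on the side of that column is therefore a lattice point of the cell,
    nearer to the column than \<open>x\<close>.\<close>
  have RC: "\<exists>w\<in>L. \<bar>rx w - ?z\<bar> < \<bar>x - ?z\<bar>"
    if e: "{e, f} \<in> \<sigma>" "rx e < x" "x < rx f" "rx p \<le> x" "x \<le> rx q" "rx u \<le> x" "x \<le> rx v"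
      "?T x < hgt e f x" "hgt e f x < ?S x" for e f x
  proof -
    have eB: "e \<in> B" "f \<in> B" using e(1) sub edges_ends by blast+
    have nz: "\<not> (rx e < ?z \<and> ?z < rx f)"
    proof
      assume h: "rx e < ?z \<and> ?z < rx f"
      have "?T ?z < hgt e f ?z"
        by (rule clique_order_from_end[OF cl t(1) e(1), of x]) (use e h m in auto)
      moreover have "hgt e f ?z < ?S ?z"
        by (rule clique_order_from_end[OF cl e(1) s(1), of x]) (use e h m in auto)
      ultimately show False using cons[OF e(1)] h by auto
    qed
    consider "?z < rx e" | "rx f < ?z" using nz zne[of e] zne[of f] by linarith
    thus ?thesis
    proof cases
      case 1
      have i: "fst p < fst e" "fst e < fst q" "fst u < fst e" "fst e < fst v" using 1 e m by auto
      have "?T (rx e) \<le> hgt e f (rx e)"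
      proof (rule ccontr)
        assume "\<not> ?thesis"
        hence h: "hgt e f (rx e) < ?T (rx e)" by simp
        obtain y where y: "min (rx e) x < y" "y < max (rx e) x" "hgt e f y - ?T y = 0"
          using aff_zero[OF aff_diff[OF aff_hgt[of e f] aff_hgt[of p q]], of "rx e" x] h e by auto
        have "?T y < hgt e f y"
          by (rule clique_order_from_end[OF cl t(1) e(1), of x]) (use e y i in auto)
        thus False using y by simp
      qed
      hence a: "?T (rx e) < ry e" using abv[of e] i by simp
      have "hgt e f (rx e) \<le> ?S (rx e)"
      proof (rule ccontr)
        assume "\<not> ?thesis"
        hence h: "?S (rx e) < hgt e f (rx e)" by simp
        obtain y where y: "min (rx e) x < y" "y < max (rx e) x" "?S y - hgt e f y = 0"
          using aff_zero[OF aff_diff[OF aff_hgt[of u v] aff_hgt[of e f]], of "rx e" x] h e by auto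
        have "hgt e f y < ?S y"
          by (rule clique_order_from_end[OF cl e(1) s(1), of x]) (use e y i in auto)
        thus False using y by simp
      qed
      hence b: "ry e < ?S (rx e)" using blw[of e] i by simp
      have "e \<in> L" unfolding L_def using eB i a b by simp
      moreover have "\<bar>rx e - ?z\<bar> < \<bar>x - ?z\<bar>" using 1 e by simp
      ultimately show ?thesis by blast
    next
      case 2
      have ef: "fst e < fst f" using e by simp
      have i: "fst p < fst f" "fst f < fst q" "fst u < fst f" "fst f < fst v" using 2 e m by auto
      have "?T (rx f) \<le> hgt e f (rx f)"
      proof (rule ccontr)
        assume "\<not> ?thesis"
        hence h: "hgt e f (rx f) < ?T (rx f)" by simp
        obtain y where y: "min (rx f) x < y" "y < max (rx f) x" "hgt e f y - ?T y = 0"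
          using aff_zero[OF aff_diff[OF aff_hgt[of e f] aff_hgt[of p q]], of "rx f" x] h e by auto
        have "?T y < hgt e f y"
          by (rule clique_order_from_end[OF cl t(1) e(1), of x]) (use e y i in auto)
        thus False using y by simp
      qed
      hence a: "?T (rx f) < ry f" using abv[of f] i ef by simp
      have "hgt e f (rx f) \<le> ?S (rx f)"
      proof (rule ccontr)
        assume "\<not> ?thesis"
        hence h: "?S (rx f) < hgt e f (rx f)" by simp
        obtain y where y: "min (rx f) x < y" "y < max (rx f) x" "?S y - hgt e f y = 0"
          using aff_zero[OF aff_diff[OF aff_hgt[of u v] aff_hgt[of e f]], of "rx f" x] h e by auto
        have "hgt e f y < ?S y"
          by (rule clique_order_from_end[OF cl e(1) s(1), of x]) (use e y i in auto)
        thus False using y by simp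
      qed
      hence b: "ry f < ?S (rx f)" using blw[of f] i ef by simp
      have "f \<in> L" unfolding L_def using eB i a b by simp
      moreover have "\<bar>rx f - ?z\<bar> < \<bar>x - ?z\<bar>" using 2 e by simp
      ultimately show ?thesis by blast
    qed
  qed
  have above: False if w: "w \<in> B" "fst p < fst w" "fst w < fst q" "?T (rx w) < ry w"
    and n: "\<And>e f. {e, f} \<in> \<sigma> \<Longrightarrow> fst e < fst w \<Longrightarrow> fst w < fst f \<Longrightarrow>
        \<not> (?T (rx w) < hgt e f (rx w) \<and> hgt e f (rx w) < ry w)" for w
  proof (rule face_above[OF T B t(1) w(1)])
    show "unsep \<sigma> p q w" unfolding unsep_def using w n by blast
    fix e f assume "{e, f} \<in> \<sigma>" "rx e < ?z" "?z < rx f"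
    thus "hgt e f ?z \<le> ?T ?z \<or> ry m / 2 < hgt e f ?z" using cons m by fastforce
  qed (use m in auto)
  have below: False if w: "w \<in> B" "fst u < fst w" "fst w < fst v" "ry w < ?S (rx w)"
    and n: "\<And>e f. {e, f} \<in> \<sigma> \<Longrightarrow> fst e < fst w \<Longrightarrow> fst w < fst f \<Longrightarrow>
        \<not> (ry w < hgt e f (rx w) \<and> hgt e f (rx w) < ?S (rx w))" for w
  proof (rule face_below[OF T B s(1) w n])
    fix e f assume "{e, f} \<in> \<sigma>" "rx e < ?z" "?z < rx f"
    thus "?S ?z \<le> hgt e f ?z \<or> hgt e f ?z < ry m / 2" using cons m by fastforce
  qed (use m in auto)
  \<comment> \<open>A point of \<open>L\<close> nearest to the column of \<open>m/2\<close> is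
    unseparated from \<open>pq\<close>, as a separating edge would yield a nearer one. This
    contradicts \<open>face_above\<close>.\<close>
  have Lempty: "L = {}"
  proof (rule ccontr)
    assume ne: "L \<noteq> {}"
    have fin: "finite L" unfolding L_def B by simp
    define w where "w = arg_min_on (\<lambda>w. \<bar>rx w - ?z\<bar>) L"
    have w: "w \<in> L" "\<not> (\<exists>y\<in>L. \<bar>rx y - ?z\<bar> < \<bar>rx w - ?z\<bar>)"
      using arg_min_if_finite[OF fin ne, of "\<lambda>w. \<bar>rx w - ?z\<bar>"] unfolding w_def by auto
    have w': "w \<in> B" "fst p < fst w" "fst w < fst q" "fst u < fst w" "fst w < fst v" "?T (rx w) < ry w" "ry w < ?S (rx w)"
      using w(1) unfolding L_def by auto
    show False
    proof (rule above[OF w'(1-3,6)])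
      fix e f assume e: "{e, f} \<in> \<sigma>" "fst e < fst w" "fst w < fst f"
      show "\<not> (?T (rx w) < hgt e f (rx w) \<and> hgt e f (rx w) < ry w)"
        using RC[OF e(1), of "rx w"] e w' w(2) by fastforce
    qed
  qed
  have RC': False if e: "{e, f} \<in> \<sigma>" "rx e < x" "x < rx f" "rx p \<le> x" "x \<le> rx q" "rx u \<le> x" "x \<le> rx v"
      "?T x < hgt e f x" "hgt e f x < ?S x" for e f x
    using RC[OF e] Lempty by blast
  \<comment> \<open>If one edge ends before the other, its end is an unseparated vertex seen from
    the longer edge.\<close>
  have qv: "fst q = fst v"
  proof (rule ccontr)
    assume "fst q \<noteq> fst v"
    then consider "fst v < fst q" | "fst q < fst v" by linarith
    thus False
    proof cases
      case 1
      have pv: "rx p < rx v" using m by linarith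
      have "?T (rx v) \<le> ?S (rx v)" by (rule TS) (use 1 pv s in auto)
      hence a: "?T (rx v) < ry v" using abv[of v] 1 pv s by simp
      show False
        by (rule above[OF mem(4) _ 1 a]) (use pv 1 s RC'[of _ _ "rx v"] in auto)
    next
      case 2
      have pv: "rx u < rx q" using m by linarith
      have "?T (rx q) \<le> ?S (rx q)" by (rule TS) (use 2 pv t in auto)
      hence a: "ry q < ?S (rx q)" using blw[of q] 2 pv t by simp
      show False
        by (rule below[OF mem(2) _ 2 a]) (use pv 2 t RC'[of _ _ "rx q"] in auto)
    qed
  qed
  have pu: "fst p = fst u"
  proof (rule ccontr)
    assume "fst p \<noteq> fst u"
    then consider "fst p < fst u" | "fst u < fst p" by linarith
    thus False
    proof cases
      case 1
      have uq: "rx u < rx q" using m by linarith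
      have "?T (rx u) \<le> ?S (rx u)" by (rule TS) (use 1 uq s in auto)
      hence a: "?T (rx u) < ry u" using abv[of u] 1 uq by simp
      show False
        by (rule above[OF mem(3) 1 _ a]) (use uq 1 s RC'[of _ _ "rx u"] in auto)
    next
      case 2
      have uq: "rx p < rx v" using m by linarith
      have "?T (rx p) \<le> ?S (rx p)" by (rule TS) (use 2 uq t in auto)
      hence a: "ry p < ?S (rx p)" using blw[of p] 2 uq by simp
      show False
        by (rule below[OF mem(1) 2 _ a]) (use uq 2 t RC'[of _ _ "rx p"] in auto)
    qed
  qed
  \<comment> \<open>With no lattice point and no edge inside the cell, a chord between its vertical
    sides crosses nothing. Maximality would make it an edge, which \<open>cons\<close>
    excludes.\<close>
  have nochord: False if g: "g1 \<in> B" "g2 \<in> B" "fst g1 = fst p" "fst g2 = fst q"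
      "\<And>x. rx p < x \<Longrightarrow> x < rx q \<Longrightarrow> ?T x < hgt g1 g2 x \<and> hgt g1 g2 x < ?S x" for g1 g2
  proof -
    have lt: "fst g1 < fst g2" using g t by simp
    have "{g1, g2} \<in> \<sigma>"
    proof (rule tri_mem[OF T])
      show "{g1, g2} \<in> edges B"
      proof (rule edgesI)
        fix w show "toR w \<notin> seg {g1, g2}"
        proof
          assume "toR w \<in> seg {g1, g2}"
          hence w: "rx g1 < rx w" "rx w < rx g2" "ry w = hgt g1 g2 (rx w)"
            unfolding toR_def seg_nonvert[OF lt] by auto
          have "real_of_int c \<le> ry w" "ry w \<le> real_of_int d"
            using hgt_rect[OF lt, of "rx w" a b c d] w g(1,2) unfolding B by auto
          moreover have "a \<le> fst w" "fst w \<le> b" using g(1,2) w unfolding B rect_def by (auto simp: mem_Times_iff)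
          ultimately have "w \<in> B" unfolding B rect_def by (simp add: mem_Times_iff)
          hence "w \<in> L" unfolding L_def using w g(5)[of "rx w"] g(3,4) pu qv by simp
          thus False using Lempty by blast
        qed
      qed (use g lt in auto)
      fix e assume e: "e \<in> \<sigma>" "e \<noteq> {g1, g2}"
      hence eE: "e \<in> edges B" using sub by blast
      show "seg {g1, g2} \<inter> seg e = {}"
      proof (rule ccontr)
        assume "seg {g1, g2} \<inter> seg e \<noteq> {}"
        then obtain x y where "(x, y) \<in> seg {g1, g2}" and xe: "(x, y) \<in> seg e" by auto
        hence xy: "rx g1 < x" "x < rx g2" "y = hgt g1 g2 x" unfolding seg_nonvert[OF lt] by auto
        have G: "?T x < hgt g1 g2 x" "hgt g1 g2 x < ?S x" using g(5)[of x] xy g(3,4) by auto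
        from eE show False
        proof (cases rule: edges_cases)
          case (1 e1 e2)
          have "rx e1 < x" "x < rx e2" "hgt e1 e2 x = hgt g1 g2 x" using xe xy unfolding 1(1) seg_nonvert[OF 1(4)] by auto
          thus False using RC'[of e1 e2 x] e(1) 1(1) G xy g(3,4) pu qv by auto
        next
          case (2 e1 e2)
          have x: "x = rx e1" "ry e1 < hgt g1 g2 x" "hgt g1 g2 x < ry e2"
            using xe xy unfolding 2(1) seg_vert[OF 2(4,5)] by auto
          have i: "fst p < fst e1" "fst e1 < fst q" using x xy g(3,4) by auto
          consider "?T (rx e1) < ry e1" | "?T (rx e1) = ry e1" | "ry e1 < ?T (rx e1)" by linarith
          thus False
          proof cases
            case 1
            hence "e1 \<in> L" unfolding L_def using 2 i G x pu qv by auto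
            thus False using Lempty by blast
          next
            case 2
            thus False using edge_hgt_lattice[OF tE i] by simp
          next
            case 3
            show False
              by (rule vert_cross[OF cl t(1), of e1 e2]) (use e(1) 2 3 i G x in auto)
          qed
        qed
      qed
    qed
    thus False using cons[of g1 g2] g(3,4) m g(5)[of ?z] by fastforce
  qed
  have notri: False if r: "r \<in> B" "cr p q (rx r) (ry r) > 0"
    "\<And>w. cr p q (rx w) (ry w) \<ge> 0 \<Longrightarrow> cr q r (rx w) (ry w) \<ge> 0 \<Longrightarrow> cr r p (rx w) (ry w) \<ge> 0 \<Longrightarrow> fst w = fst p \<or> fst w = fst q \<Longrightarrow> w \<in> {p, q, r}"
    "\<And>w. cr p q (rx w) (ry w) \<ge> 0 \<Longrightarrow> cr q r (rx w) (ry w) \<ge> 0 \<Longrightarrow> cr r p (rx w) (ry w) \<ge> 0 \<Longrightarrow> fst p < fst w \<Longrightarrow> fst w < fst q \<Longrightarrow> ry w \<le> ?S (rx w)"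
    "cr q r ?z (ry m / 2) > 0" "cr r p ?z (ry m / 2) > 0" "fst p \<le> fst r" "fst r \<le> fst q" for r
  proof (rule empty_triangle_no_half_point[of p q r m])
    fix w assume g: "cr p q (rx w) (ry w) \<ge> 0" "cr q r (rx w) (ry w) \<ge> 0" "cr r p (rx w) (ry w) \<ge> 0"
    show "w \<in> {p, q, r}"
    proof (cases "fst w = fst p \<or> fst w = fst q")
      case True
      thus ?thesis using r(3)[OF g] by blast
    next
      case False
      note tb = triangle_bounds[OF r(2) g]
      have i: "fst p < fst w" "fst w < fst q" using tb(1)[of rx "rx p"] tb(2)[of rx "rx q"] t r(7,8) False by auto
      have lo: "?T (rx w) < ry w" using abv[of w] i g(1) cr_nonneg[OF t(2)] by simp
      have hi: "ry w < ?S (rx w)" using blw[of w] i pu qv r(4)[OF g i] by simp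
      have bd: "a \<le> fst v \<and> fst v \<le> b \<and> c \<le> snd v \<and> snd v \<le> d" if "v \<in> B" for v
        using that unfolding B rect_def by (simp add: mem_Times_iff)
      have "real_of_int c \<le> ry w" by (rule tb(1)) (use bd[OF mem(1)] bd[OF mem(2)] bd[OF r(1)] in simp_all)
      moreover have "ry w \<le> real_of_int d" by (rule tb(2)) (use bd[OF mem(1)] bd[OF mem(2)] bd[OF r(1)] in simp_all)
      ultimately have "w \<in> B" using i bd[OF mem(1)] bd[OF mem(2)] unfolding B rect_def by (simp add: mem_Times_iff)
      hence "w \<in> L" unfolding L_def using i lo hi pu qv by simp
      thus ?thesis using Lempty by blast
    qed
  next
    show "cr p q ?z (ry m / 2) > 0" using m(6) cr_pos[OF t(2)] by simp
  qed (rule r(5,6))+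
  have pr: "rx p = rx u" "rx q = rx v" "rx p < rx q" by (simp only: pu, simp only: qv, simp only: of_int_less_iff t(2))
  have le: "snd p \<le> snd u" "snd q \<le> snd v"
  proof -
    have "?T (rx p) \<le> ?S (rx p)" by (rule TS) (use pr in linarith)+
    moreover have "?S (rx p) = ry u" using hgt_left[of u v] unfolding pu .
    ultimately show "snd p \<le> snd u" by simp
    have "?T (rx q) \<le> ?S (rx q)" by (rule TS) (use pr in linarith)+
    moreover have "?S (rx q) = ry v" using hgt_right[OF s(2)] unfolding qv .
    ultimately show "snd q \<le> snd v" using t by simp
  qed
  have chordpos: "f x < g x" if "aff f" "aff g" "f (rx p) \<le> g (rx p)" "f (rx q) \<le> g (rx q)" "f (rx p) < g (rx p) \<or> f (rx q) < g (rx q)"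
    "rx p < x" "x < rx q" for f g x
  proof -
    have af: "aff (\<lambda>x. g x - f x)" by (rule aff_diff[OF that(2,1)])
    have mn: "min (rx q) (rx p) = rx p" "max (rx q) (rx p) = rx q" "min (rx p) (rx q) = rx p" "max (rx p) (rx q) = rx q"
      using t(2) by auto
    have "g x - f x > 0"
      using that(5)
    proof
      assume fg: "f (rx p) < g (rx p)"
      show ?thesis by (rule aff_pos_between[OF af, of "rx q" "rx p"], unfold mn diff_gt_0_iff_gt diff_ge_0_iff_ge) (rule fg that(4,6,7))+
    next
      assume fg: "f (rx q) < g (rx q)"
      show ?thesis by (rule aff_pos_between[OF af, of "rx p" "rx q"], unfold mn diff_gt_0_iff_gt diff_ge_0_iff_ge) (rule fg that(3,6,7))+
    qed
    thus ?thesis by simp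
  qed
  have ends: "?S (rx p) = ry u" "?S (rx q) = ry v" "?T (rx p) = ry p" "?T (rx q) = ry q"
    using hgt_left[of u v, folded pu] hgt_right[OF s(2), folded qv] t by simp_all
  consider "snd p < snd u" "snd q < snd v" | "snd p = snd u" "snd q < snd v" | "snd p < snd u" "snd q = snd v"
    | "snd p = snd u" "snd q = snd v" using le by linarith
  thus False
  proof cases
    case 1
    have g: "hgt p v (rx p) = ry p" "hgt p v (rx q) = ry v" using t qv by simp_all
    show False
    proof (rule nochord[of p v])
      fix x assume x: "rx p < x" "x < rx q"
      show "?T x < hgt p v x \<and> hgt p v x < ?S x"
        by (rule conjI; rule chordpos[OF aff_hgt aff_hgt _ _ _ x]) (use 1 ends g in auto)
    qed (use mem qv in auto)
  next
    case 2
    have up: "u = p" using 2 pu by (auto simp: prod_eq_iff)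
    \<comment> \<open>The first lattice point above \<open>q\<close> on the vertical side: either it
      ends a chord inside the cell, or it is \<open>v\<close> and the cell is a triangle.\<close>
    define v1 where "v1 = (fst q, snd q + 1)"
    have v1B: "v1 \<in> B" using mem 2 unfolding v1_def B rect_def by (auto simp: mem_Times_iff)
    show False
    proof (cases "v1 = v")
      case False
      hence lt: "snd q + 1 < snd v" using 2 qv unfolding v1_def by (auto simp: prod_eq_iff)
      have g: "hgt p v1 (rx p) = ry p" "hgt p v1 (rx q) = ry q + 1" using t hgt_right[of p v1] unfolding v1_def by simp_all
      show False
      proof (rule nochord[of p v1])
        fix x assume x: "rx p < x" "x < rx q"
        show "?T x < hgt p v1 x \<and> hgt p v1 x < ?S x"
          by (rule conjI; rule chordpos[OF aff_hgt aff_hgt _ _ _ x]) (use lt ends g 2 in auto)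
      qed (use mem v1B in \<open>auto simp: v1_def\<close>)
    next
      case True
      have vy: "fst v = fst q" "snd v = snd q + 1" using True unfolding v1_def by auto
      have pv: "fst p < fst v" using vy t by simp
      have Sv: "?S = hgt p v" using up by simp
      have crqv: "cr q v x y = rx q - x" for x y unfolding cr_def using vy by simp
      show False
      proof (rule notri[of v])
        show "cr p q (rx v) (ry v) > 0" using cr_pos[OF t(2)] t vy by simp
        show "cr q v ?z (ry m / 2) > 0" unfolding crqv using m by simp
        show "cr v p ?z (ry m / 2) > 0" using cr_hgt[OF pv] pv m Sv by (simp add: cr_swap[of v p] mult_less_0_iff)
        fix w assume g: "cr p q (rx w) (ry w) \<ge> 0" "cr q v (rx w) (ry w) \<ge> 0" "cr v p (rx w) (ry w) \<ge> 0"
        have lo: "?T (rx w) \<le> ry w" using g(1) cr_nonneg[OF t(2)] by simp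
        show hi: "ry w \<le> ?S (rx w)" using g(3) cr_hgt[OF pv] pv Sv by (simp add: cr_swap[of v p] mult_le_0_iff)
        assume "fst w = fst p \<or> fst w = fst q"
        thus "w \<in> {p, q, v}"
        proof
          assume f: "fst w = fst p"
          have "snd w = snd p" using lo hi 2 unfolding f ends by simp
          thus ?thesis using f by (auto simp: prod_eq_iff)
        next
          assume f: "fst w = fst q"
          have "snd q \<le> snd w" "snd w \<le> snd v" using lo hi unfolding f ends by simp_all
          hence "snd w = snd q \<or> snd w = snd v" using vy by linarith
          thus ?thesis using f vy by (auto simp: prod_eq_iff)
        qed
      qed (use mem pv t vy in auto)
    qed
  next
    case 3
    have vq: "v = q" using 3 qv by (auto simp: prod_eq_iff)
    define v1 where "v1 = (fst p, snd p + 1)"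
    have v1B: "v1 \<in> B" using mem 3 unfolding v1_def B rect_def by (auto simp: mem_Times_iff)
    show False
    proof (cases "v1 = u")
      case False
      hence lt: "snd p + 1 < snd u" using 3 pu unfolding v1_def by (auto simp: prod_eq_iff)
      have g: "hgt v1 q (rx p) = ry p + 1" "hgt v1 q (rx q) = ry q" using t hgt_left[of v1 q] hgt_right[of v1 q] unfolding v1_def by simp_all
      show False
      proof (rule nochord[of v1 q])
        fix x assume x: "rx p < x" "x < rx q"
        show "?T x < hgt v1 q x \<and> hgt v1 q x < ?S x"
          by (rule conjI; rule chordpos[OF aff_hgt aff_hgt _ _ _ x]) (use lt ends g 3 in auto)
      qed (use mem v1B in \<open>auto simp: v1_def\<close>)
    next
      case True
      have vy: "fst u = fst p" "snd u = snd p + 1" using True unfolding v1_def by auto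
      have uq: "fst u < fst q" using vy t by simp
      have Sv: "?S = hgt u q" using vq by simp
      have crup: "cr u p x y = x - rx p" for x y unfolding cr_def using vy by simp
      show False
      proof (rule notri[of u])
        show "cr p q (rx u) (ry u) > 0" using cr_pos[OF t(2)] t vy by simp
        show "cr u p ?z (ry m / 2) > 0" unfolding crup using m by simp
        show "cr q u ?z (ry m / 2) > 0" using cr_hgt[OF uq] uq m Sv by (simp add: cr_swap[of q u] mult_less_0_iff)
        fix w assume g: "cr p q (rx w) (ry w) \<ge> 0" "cr q u (rx w) (ry w) \<ge> 0" "cr u p (rx w) (ry w) \<ge> 0"
        have lo: "?T (rx w) \<le> ry w" using g(1) cr_nonneg[OF t(2)] by simp
        show hi: "ry w \<le> ?S (rx w)" using g(2) cr_hgt[OF uq] uq Sv by (simp add: cr_swap[of q u] mult_le_0_iff)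
        assume "fst w = fst p \<or> fst w = fst q"
        thus "w \<in> {p, q, u}"
        proof
          assume f: "fst w = fst q"
          have "snd w = snd q" using lo hi 3 unfolding f ends by simp
          thus ?thesis using f by (auto simp: prod_eq_iff)
        next
          assume f: "fst w = fst p"
          have "snd p \<le> snd w" "snd w \<le> snd u" using lo hi unfolding f ends by simp_all
          hence "snd w = snd p \<or> snd w = snd u" using vy by linarith
          thus ?thesis using f vy by (auto simp: prod_eq_iff)
        qed
      qed (use mem uq t vy in auto)
    qed
  next
    case 4
    hence "u = p" "v = q" using pu qv by (auto simp: prod_eq_iff)
    thus False using TSz by simp
  qed
qed

section \<open>Doubled midpoints: each admissible one carries exactly one edge\<close>

definition mid :: "edge \<Rightarrow> point" where
  "mid e = (\<Sum>p\<in>e. fst p, \<Sum>p\<in>e. snd p)"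

lemma mid_pair: "p \<noteq> q \<Longrightarrow> mid {p, q} = (fst p + fst q, snd p + snd q)"
  by (simp add: mid_def)

text \<open>An edge through \<open>m/2\<close> has its midpoint there. If there is none,
  \<open>m/2\<close> lies strictly between the nearest edges below and above in its column, and
  \<open>empty_cell\<close> gives a contradiction. The unit edges of the bottom and top rows
  guarantee that both neighbours exist.\<close>

lemma half_column_covered:
  assumes T: "tri (rect a b c d) \<sigma>" and m: "odd (fst m)" "2 * a < fst m" "fst m < 2 * b" "2 * c < snd m" "snd m < 2 * d"
  shows "\<exists>e\<in>\<sigma>. mid e = m"
proof (rule ccontr)
  assume no: "\<not> ?thesis"
  let ?z = "rx m / 2"
  have cl: "clique \<sigma>" and sub: "\<sigma> \<subseteq> edges (rect a b c d)" using T unfolding tri_def by auto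
  have off: "hgt v w ?z \<noteq> ry m / 2" if e: "{v, w} \<in> \<sigma>" "rx v < ?z" "?z < rx w" for v w
  proof
    assume h: "hgt v w ?z = ry m / 2"
    have lt: "fst v < fst w" using e by simp
    have "{v, w} \<in> edges (rect a b c d)" using e sub by blast
    from half_point_is_midpoint[OF this lt e(2,3) h] have "mid {v, w} = m"
      using mid_pair[of v w] lt by (auto simp: prod_eq_iff)
    thus False using no e(1) by blast
  qed
  define j where "j = fst m div 2"
  have j: "fst m = 2 * j + 1" using m(1) unfolding j_def by simp
  hence zj: "real_of_int j < ?z" "?z < real_of_int (j + 1)" by auto
  have jab: "a \<le> j" "j + 1 \<le> b" "c \<le> d" using m j by auto
  have be: "{(j, c), (j + 1, c)} \<in> \<sigma>" "{(j, d), (j + 1, d)} \<in> \<sigma>"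
    using bottom_edge[OF T jab] top_edge[OF T jab] by auto
  define E where "E = {(v, w). {v, w} \<in> \<sigma> \<and> rx v < ?z \<and> ?z < rx w}"
  have "E \<subseteq> rect a b c d \<times> rect a b c d" using sub edges_ends unfolding E_def by blast
  hence finE: "finite E" by (rule finite_subset) simp
  define h where "h x = hgt (fst x) (snd x) ?z" for x :: "point \<times> point"
  define Lo where "Lo = {x \<in> E. h x < ry m / 2}"
  define Up where "Up = {x \<in> E. ry m / 2 < h x}"
  have "((j, c), (j + 1, c)) \<in> Lo" unfolding Lo_def E_def h_def using be zj m by (simp add: hgt_def)
  hence Lo: "finite Lo" "Lo \<noteq> {}" unfolding Lo_def using finE by auto
  have "((j, d), (j + 1, d)) \<in> Up" unfolding Up_def E_def h_def using be zj m by (simp add: hgt_def)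
  hence Up: "finite Up" "Up \<noteq> {}" unfolding Up_def using finE by auto
  define t where "t = arg_min_on (\<lambda>x. - h x) Lo"
  define s where "s = arg_min_on h Up"
  have t: "t \<in> Lo" "\<And>x. x \<in> Lo \<Longrightarrow> h x \<le> h t"
    using arg_min_if_finite[OF Lo, of "\<lambda>x. - h x"] unfolding t_def by (auto simp: not_less)
  have s: "s \<in> Up" "\<And>x. x \<in> Up \<Longrightarrow> h s \<le> h x"
    using arg_min_if_finite[OF Up, of h] unfolding s_def by (auto simp: not_less)
  obtain p q where tp: "t = (p, q)" by (cases t)
  obtain u v where sp: "s = (u, v)" by (cases s)
  have t': "{p, q} \<in> \<sigma>" "rx p < ?z" "?z < rx q" "hgt p q ?z < ry m / 2"
    using t(1) unfolding tp Lo_def E_def h_def by auto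
  have s': "{u, v} \<in> \<sigma>" "rx u < ?z" "?z < rx v" "ry m / 2 < hgt u v ?z"
    using s(1) unfolding sp Up_def E_def h_def by auto
  have cons: "hgt e f ?z \<le> hgt p q ?z \<or> hgt u v ?z \<le> hgt e f ?z" if e: "{e, f} \<in> \<sigma>" "rx e < ?z" "?z < rx f" for e f
  proof -
    have "(e, f) \<in> Lo \<or> (e, f) \<in> Up" using off[OF e] e unfolding Lo_def Up_def E_def h_def by auto
    thus ?thesis using t(2)[of "(e, f)"] s(2)[of "(e, f)"] unfolding tp sp h_def by auto
  qed
  show False
    by (rule empty_cell[OF T refl t'(1) _ s'(1) _ m(1) t'(2,3) s'(2,3) t'(4) s'(4) cons]) (use t' s' in auto)
qed

lemma horizontal_edge_unit:
  assumes E: "{p, q} \<in> edges B" "fst p < fst q" "snd p = snd q"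
  shows "fst q = fst p + 1"
proof (rule ccontr)
  assume "fst q \<noteq> fst p + 1"
  thus False using edge_hgt_lattice[OF E(1), of "(fst p + 1, snd p)"] E by (simp add: hgt_def)
qed

lemma odd_column_covered:
  assumes T: "tri (rect a b c d) \<sigma>" and e: "e \<in> edges (rect a b c d)" and odd: "odd (fst (mid e))"
  shows "\<exists>f\<in>\<sigma>. mid f = mid e"
  using e
proof (cases rule: edges_cases)
  case (1 p q)
  have mp: "mid e = (fst p + fst q, snd p + snd q)" using 1 mid_pair[of p q] by auto
  have r: "a \<le> fst p" "fst p \<le> b" "c \<le> snd p" "snd p \<le> d" "a \<le> fst q" "fst q \<le> b" "c \<le> snd q" "snd q \<le> d"
    using 1 by (auto simp: rect_def mem_Times_iff)
  have E: "{p, q} \<in> edges (rect a b c d)" using e 1 by simp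
  have x: "2 * a < fst (mid e)" "fst (mid e) < 2 * b" using odd r 1(4) unfolding mp by auto
  consider "2 * c < snd (mid e)" "snd (mid e) < 2 * d" | "snd p = c" "snd q = c" | "snd p = d" "snd q = d"
    using r unfolding mp by fastforce
  thus ?thesis
  proof cases
    case 1 thus ?thesis by (intro half_column_covered[OF T odd x])
  next
    case 2
    have u: "fst q = fst p + 1" using horizontal_edge_unit[OF E 1(4)] 2 by simp
    have "{(fst p, c), (fst p + 1, c)} \<in> \<sigma>" by (rule bottom_edge[OF T]) (use r u in auto)
    moreover have "{(fst p, c), (fst p + 1, c)} = e" using 1(1) 2 u by (metis prod.collapse)
    ultimately show ?thesis by blast
  next
    case 3
    have u: "fst q = fst p + 1" using horizontal_edge_unit[OF E 1(4)] 3 by simp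
    have "{(fst p, d), (fst p + 1, d)} \<in> \<sigma>" by (rule top_edge[OF T]) (use r u in auto)
    moreover have "{(fst p, d), (fst p + 1, d)} = e" using 1(1) 3 u by (metis prod.collapse)
    ultimately show ?thesis by blast
  qed
next
  case (2 p q)
  have "mid e = (fst p + fst q, snd p + snd q)" using 2 mid_pair[of p q] by auto
  thus ?thesis using odd 2 by simp
qed

lemma seg_midpoint:
  assumes "p \<noteq> q"
  shows "((rx p + rx q) / 2, (ry p + ry q) / 2) \<in> seg {p, q}"
  unfolding seg_param[OF assms] by (rule exI[of _ "1/2"]) (simp add: field_simps)

text \<open>The midpoint of an edge is not a lattice point, so some coordinate of the doubled
  midpoint is odd; exchanging the axes reduces to an odd abscissa.\<close>

theorem midpoint_covered:
  assumes T: "tri (rect a b c d) \<sigma>" and e: "e \<in> edges (rect a b c d)"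
  shows "\<exists>f\<in>\<sigma>. mid f = mid e"
proof (cases "odd (fst (mid e))")
  case True
  thus ?thesis using odd_column_covered[OF T e] by blast
next
  case False
  obtain p q where pq: "e = {p, q}" "p \<noteq> q" "seg {p, q} \<inter> range toR = {}" using e unfolding edges_def by blast
  have mp: "mid e = (fst p + fst q, snd p + snd q)" using pq mid_pair[of p q] by auto
  have odd: "odd (snd (mid e))"
  proof
    assume "even (snd (mid e))"
    then obtain i j where ij: "fst p + fst q = 2 * i" "snd p + snd q = 2 * j" using False unfolding mp fst_conv snd_conv by (metis evenE)
    have "toR (i, j) = ((rx p + rx q) / 2, (ry p + ry q) / 2)"
      using ij unfolding toR_def of_int_add[symmetric] by simp
    hence "toR (i, j) \<in> seg {p, q}" using seg_midpoint[OF pq(2)] by simp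
    thus False using pq(3) by blast
  qed
  have midswap: "mid (prod.swap ` {v, w}) = prod.swap (mid {v, w})" if "v \<noteq> w" for v w :: point
    using that mid_pair[of v w] mid_pair[of "prod.swap v" "prod.swap w"] by (auto simp: prod_eq_iff)
  have ms: "mid (prod.swap ` f) = prod.swap (mid f)" if "f \<in> edges B" for f B
    using that midswap unfolding edges_def by blast
  have "\<exists>f\<in>(`) prod.swap ` \<sigma>. mid f = mid (prod.swap ` e)"
  proof (rule odd_column_covered)
    show "tri (rect c d a b) ((`) prod.swap ` \<sigma>)" using amap_tri[OF amap_swap T] by (simp add: swap_rect)
    show "prod.swap ` e \<in> edges (rect c d a b)"
      using imageI[OF e, of "(`) prod.swap"] unfolding amap_edges[OF amap_swap, symmetric] swap_rect .
    show "odd (fst (mid (prod.swap ` e)))" using odd ms[OF e] by simp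
  qed
  then obtain f where f: "f \<in> \<sigma>" "mid (prod.swap ` f) = mid (prod.swap ` e)" by blast
  have "f \<in> edges (rect a b c d)" using f(1) T unfolding tri_def by blast
  hence "prod.swap (mid f) = prod.swap (mid e)" using f(2) ms e by metis
  hence "mid f = mid e" by (metis swap_swap)
  thus ?thesis using f by blast
qed

text \<open>Both open segments contain the common midpoint.\<close>

lemma mid_inj:
  assumes "clique \<sigma>" "\<sigma> \<subseteq> edges B" "e \<in> \<sigma>" "f \<in> \<sigma>" "mid e = mid f"
  shows "e = f"
proof (rule ccontr)
  assume ne: "e \<noteq> f"
  obtain p q where p: "e = {p, q}" "p \<noteq> q" using assms(2,3) unfolding edges_def by blast
  obtain v w where v: "f = {v, w}" "v \<noteq> w" using assms(2,4) unfolding edges_def by blast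
  have eq: "fst p + fst q = fst v + fst w" "snd p + snd q = snd v + snd w"
    using assms(5) unfolding p(1) v(1) mid_pair[OF p(2)] mid_pair[OF v(2)] by auto
  hence "rx p + rx q = rx v + rx w" "ry p + ry q = ry v + ry w" unfolding of_int_add[symmetric] by simp_all
  hence "((rx p + rx q) / 2, (ry p + ry q) / 2) \<in> seg e \<inter> seg f"
    using seg_midpoint[OF p(2)] seg_midpoint[OF v(2)] unfolding p(1) v(1) by simp
  moreover have "seg e \<inter> seg f = {}" using assms(1,3,4) ne unfolding clique_def by simp
  ultimately show False by blast
qed

section \<open>A renewal theorem\<close>

text \<open>For fixed \<open>d\<close> the index pairs belonging to different \<open>m\<close> are
  disjoint, and those with \<open>m \<le> M\<close> lie in a square.\<close>

lemma sum_convolution_le: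
  fixes a :: "nat \<Rightarrow> real"
  assumes "\<And>i. a i \<ge> 0"
  shows "(\<Sum>m\<le>M. \<Sum>(i, j) | i + d + j = m. a i * a j) \<le> (\<Sum>i\<le>M. a i)\<^sup>2"
proof -
  have fin: "finite {(i, j). i + d + j = m}" for m :: nat
    by (rule finite_subset[of _ "{..m} \<times> {..m}"]) auto
  have "(\<Sum>m\<le>M. \<Sum>(i, j) | i + d + j = m. a i * a j) = (\<Sum>(i, j)\<in>(\<Union>m\<le>M. {(i, j). i + d + j = m}). a i * a j)"
    by (rule sum.UNION_disjoint[symmetric]) (use fin in auto)
  also have "\<dots> \<le> (\<Sum>(i, j)\<in>{..M} \<times> {..M}. a i * a j)"
    by (rule sum_mono2) (use assms in auto)
  also have "\<dots> = (\<Sum>i\<le>M. a i)\<^sup>2"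
    by (simp add: power2_eq_square sum_product sum.cartesian_product)
  finally show ?thesis .
qed

text \<open>Probabilistically, a decomposition at the last renewal up to time \<open>n\<close>, the
  factor \<open>1 - (\<Sum>j\<le>i. u j)\<close> being the chance that the next gap exceeds
  \<open>i\<close>. As power series: the tail series times that of \<open>z\<close> is
  \<open>1 / (1 - w)\<close>.\<close>

lemma renewal_convolution:
  fixes u z :: "nat \<Rightarrow> real"
  assumes u0: "u 0 = 0" and z0: "z 0 = 1"
    and ren: "\<And>n. n \<ge> 1 \<Longrightarrow> z n = (\<Sum>j = 1..n. u j * z (n - j))"
  shows "(\<Sum>i\<le>n. (1 - (\<Sum>j\<le>i. u j)) * z (n - i)) = 1"
proof (induction n)
  case 0
  thus ?case using u0 z0 by simp
next
  case (Suc n)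
  let ?r = "\<lambda>i. 1 - (\<Sum>j\<le>i. u j)"
  have "(\<Sum>i\<le>Suc n. ?r i * z (Suc n - i)) = ?r 0 * z (Suc n) + (\<Sum>i\<le>n. ?r (Suc i) * z (n - i))"
    by (subst sum.atMost_Suc_shift) simp
  also have "\<dots> = z (Suc n) + (\<Sum>i\<le>n. ?r i * z (n - i)) - (\<Sum>i\<le>n. u (Suc i) * z (n - i))"
    using u0 by (simp add: algebra_simps sum.distrib sum_subtractf)
  also have "(\<Sum>i\<le>n. u (Suc i) * z (n - i)) = (\<Sum>j = 1..Suc n. u j * z (Suc n - j))"
    by (rule sum.reindex_bij_witness[of _ "\<lambda>j. j - 1" Suc]) auto
  also have "\<dots> = z (Suc n)" using ren[of "Suc n"] by simp
  finally show ?case using Suc.IH by simp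
qed

text \<open>Equality forces \<open>u n = Re (u n * w ^ n)\<close> for every \<open>n\<close>, and
  \<open>n = 1\<close> with \<open>u 1 > 0\<close> already gives \<open>w = 1\<close>. This is where
  aperiodicity enters.\<close>

lemma tail_series_nonzero:
  fixes u :: "nat \<Rightarrow> real" and w :: complex
  assumes u: "\<And>n. u n \<ge> 0" "u 1 > 0" "u sums 1" and w: "norm w \<le> 1" "w \<noteq> 1"
  shows "(\<Sum>n. of_real (u n) * w ^ n) \<noteq> 1"
proof
  assume eq: "(\<Sum>n. of_real (u n) * w ^ n) = 1"
  have su: "summable u" using u(3) by (rule sums_summable)
  have bd: "norm (of_real (u n) * w ^ n) \<le> u n" for n
    using u(1)[of n] w(1) by (simp add: norm_mult norm_power mult_left_le power_le_one)
  have sc: "summable (\<lambda>n. of_real (u n) * w ^ n)"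
    by (rule summable_comparison_test'[OF su]) (rule bd)
  have "(\<lambda>n. Re (of_real (u n) * w ^ n)) sums Re 1"
    using sums_Re[OF summable_sums[OF sc]] unfolding eq .
  hence "(\<lambda>n. u n - Re (of_real (u n) * w ^ n)) sums (1 - Re 1)"
    by (intro sums_diff u(3))
  hence d: "(\<lambda>n. u n - Re (of_real (u n) * w ^ n)) sums 0" by simp
  have nn: "u n - Re (of_real (u n) * w ^ n) \<ge> 0" for n
    using bd[of n] complex_Re_le_cmod[of "of_real (u n) * w ^ n"] by linarith
  have "u 1 - Re (of_real (u 1) * w ^ 1) = 0"
    using suminf_eq_zero_iff[OF sums_summable[OF d] nn] sums_unique[OF d] by auto
  hence "u 1 * (1 - Re w) = 0" by (simp add: algebra_simps)
  hence re: "Re w = 1" using u(2) by simp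
  have "(Re w)\<^sup>2 + (Im w)\<^sup>2 \<le> 1" using w(1) by (simp add: cmod_def)
  hence "Im w = 0" using re by simp
  thus False using re w(2) by (simp add: complex_eq_iff)
qed

text \<open>The tail series \<open>T\<close> satisfies \<open>(1 - w) T(w) = 1 - \<Sum> u n w\<^sup>n\<close>, so it has no zero in the closed unit disc
  and \<open>1/T\<close>, whose partial sums of coefficients are the \<open>z n\<close>, converges beyond 1.\<close>
lemma renewal_limit:
  fixes u z :: "nat \<Rightarrow> real"
  assumes u: "\<And>n. u n \<ge> 0" "u 0 = 0" "u 1 > 0" "u sums 1"
    and s0: "s0 > 1" "summable (\<lambda>n. u n * s0 ^ n)"
    and z0: "z 0 = 1" and ren: "\<And>n. n \<ge> 1 \<Longrightarrow> z n = (\<Sum>j = 1..n. u j * z (n - j))"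
  shows "\<exists>L>0. z \<longlonglongrightarrow> L"
proof -
  define r where "r n = 1 - (\<Sum>j\<le>n. u j)" for n
  have su: "summable u" using u(4) by (rule sums_summable)
  have r_nn: "r n \<ge> 0" for n
    using sum_le_suminf[OF su, of "{..n}"] u(1) sums_unique[OF u(4)] unfolding r_def by simp
  define M where "M = (\<Sum>n. u n * s0 ^ n)"
  \<comment> \<open>On the tail \<open>j > n\<close> the factor \<open>s0 ^ n\<close> is at most
    \<open>s0 ^ j\<close>, so the tails inherit the exponential decay of \<open>u\<close>.\<close>
  have r_bd: "r n * s0 ^ n \<le> M" for n
  proof -
    have s1: "summable (\<lambda>j. u (j + Suc n))" using su summable_iff_shift by blast
    have "r n = (\<Sum>j. u (j + Suc n))"
      using suminf_split_initial_segment[OF su, of "Suc n"] sums_unique[OF u(4)]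
      unfolding r_def by (simp add: lessThan_Suc_atMost)
    hence "r n * s0 ^ n = (\<Sum>j. u (j + Suc n) * s0 ^ n)"
      using suminf_mult2[OF s1] by simp
    also have "\<dots> \<le> (\<Sum>j. u (j + Suc n) * s0 ^ (j + Suc n))"
    proof (rule suminf_le)
      show "u (j + Suc n) * s0 ^ n \<le> u (j + Suc n) * s0 ^ (j + Suc n)" for j
        using s0 u(1) by (intro mult_left_mono power_increasing) auto
      show "summable (\<lambda>j. u (j + Suc n) * s0 ^ n)" using s1 by (rule summable_mult2)
      show "summable (\<lambda>j. u (j + Suc n) * s0 ^ (j + Suc n))" using s0(2) summable_iff_shift[of "\<lambda>n. u n * s0 ^ n"] by blast
    qed
    also have "\<dots> \<le> M"
      using suminf_split_initial_segment[OF s0(2), of "Suc n"] sum_nonneg[of "{..<Suc n}" "\<lambda>n. u n * s0 ^ n"] u(1) s0(1)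
      unfolding M_def by simp
    finally show ?thesis .
  qed
  define f where "f = Abs_fps (\<lambda>n. complex_of_real (r n))"
  have rad: "fps_conv_radius f \<ge> ereal s0"
    unfolding fps_conv_radius_def
  proof (rule conv_radius_geI_ex')
    fix t :: real assume t: "0 < t" "ereal t < ereal s0"
    have "summable (\<lambda>n. M * (t / s0) ^ n)" using t s0 by (intro summable_mult summable_geometric) auto
    thus "summable (\<lambda>n. fps_nth f n * of_real t ^ n)"
    proof (rule summable_comparison_test')
      fix n
      have "norm (fps_nth f n * of_real t ^ n) = r n * s0 ^ n * (t / s0) ^ n"
        using r_nn[of n] t s0 by (simp add: f_def norm_mult norm_power power_divide)
      also have "\<dots> \<le> M * (t / s0) ^ n" using r_bd t s0 by (intro mult_right_mono) auto
      finally show "norm (fps_nth f n * of_real t ^ n) \<le> M * (t / s0) ^ n" .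
    qed
  qed
  have inball: "ereal (norm w) < fps_conv_radius f" if "norm w < s0" for w :: complex
    using that rad by (meson ereal_less_eq(3) less_ereal.simps(1) less_le_trans)
  have ev: "(\<lambda>n. of_real (r n) * w ^ n) sums eval_fps f w" if "norm w < s0" for w
    using sums_eval_fps[OF inball[OF that]] unfolding f_def by simp
  have ev1: "(\<lambda>n. r n) sums Re (eval_fps f 1)"
    using sums_Re[OF ev[of 1]] s0 by simp
  have im1: "Im (eval_fps f 1) = 0"
    using sums_Im[OF ev[of 1]] s0 sums_unique2[of "\<lambda>n. 0 :: real" 0] by (simp add: sums_0)
  have pos1: "Re (eval_fps f 1) \<ge> 1"
  proof -
    have "sum r {..<1} \<le> suminf r" by (rule sum_le_suminf[OF sums_summable[OF ev1]]) (use r_nn in auto)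
    moreover have "r 0 = 1" unfolding r_def using u(2) by simp
    ultimately show ?thesis using sums_unique[OF ev1] by simp
  qed
  have nz: "eval_fps f w \<noteq> 0" if w: "norm w \<le> 1" for w
  proof (cases "w = 1")
    case True
    thus ?thesis using pos1 by auto
  next
    case False
    have ws: "norm w < s0" using w s0 by simp
    have "(\<lambda>n. of_real (u n) * w ^ n) sums (1 - (1 - w) * eval_fps f w)"
    proof -
      note e = ev[OF ws]
      have "(\<lambda>n. of_real (r n) * w ^ n * w) sums (eval_fps f w * w)" using e by (rule sums_mult2)
      hence "(\<lambda>n. of_real (r n) * w ^ Suc n) sums (eval_fps f w * w)" by (simp add: mult_ac)
      hence e1: "(\<lambda>n. if n = 0 then 0 else of_real (r (n - 1)) * w ^ n) sums (eval_fps f w * w)"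
        by (subst sums_Suc_iff[symmetric, where f = "\<lambda>n. if n = 0 then 0 else of_real (r (n - 1)) * w ^ n", simplified]) simp
      have e2: "(\<lambda>n. if n = 0 then 1 else 0) sums (1 :: complex)" using sums_single[of 0 "\<lambda>_. 1 :: complex"] by simp
      have "(\<lambda>n. (if n = 0 then 1 else 0) + (if n = 0 then 0 else of_real (r (n - 1)) * w ^ n) - of_real (r n) * w ^ n)
        sums (1 + eval_fps f w * w - eval_fps f w)" by (intro sums_diff sums_add e e1 e2)
      moreover have "(if n = 0 then 1 else 0) + (if n = 0 then 0 else of_real (r (n - 1)) * w ^ n) - of_real (r n) * w ^ n
         = of_real (u n) * w ^ n" for n
        using u(2) by (cases n) (auto simp: r_def algebra_simps)
      ultimately show ?thesis by (simp add: algebra_simps)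
    qed
    hence "(\<Sum>n. of_real (u n) * w ^ n) = 1 - (1 - w) * eval_fps f w" by (simp add: sums_unique[symmetric])
    thus ?thesis using tail_series_nonzero[OF u(1,3,4) w False] by auto
  qed
  \<comment> \<open>The zeros in a slightly larger closed disc form a compact set that avoids the
    unit disc; the modulus of the nearest zero serves as \<open>R\<close>.\<close>
  have "\<exists>R>1. \<forall>w. norm w < R \<longrightarrow> eval_fps f w \<noteq> 0"
  proof -
    define t where "t = (1 + s0) / 2"
    have t: "1 < t" "t < s0" using s0 unfolding t_def by auto
    define K where "K = {w \<in> cball 0 t. eval_fps f w = 0}"
    have sub: "cball (0 :: complex) t \<subseteq> eball 0 (fps_conv_radius f)"
    proof
      fix x :: complex assume "x \<in> cball 0 t"
      hence "norm x < s0" using t by (simp add: mem_cball_0)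
      from inball[OF this] show "x \<in> eball 0 (fps_conv_radius f)" by (simp add: eball_def dist_norm)
    qed
    have cont: "continuous_on (cball 0 t) (eval_fps f)"
      by (rule continuous_on_eval_fps[THEN continuous_on_subset, OF sub])
    have "closed K" unfolding K_def by (intro continuous_closed_preimage_constant cont) auto
    moreover have "bounded K" unfolding K_def by (rule bounded_subset[of "cball 0 t"]) auto
    ultimately have cK: "compact K" using compact_eq_bounded_closed by blast
    show ?thesis
    proof (cases "K = {}")
      case True
      show ?thesis by (rule exI[of _ t]) (use True t in \<open>auto simp: K_def\<close>)
    next
      case False
      have "continuous_on K norm" by (intro continuous_intros)
      then obtain w0 where w0: "w0 \<in> K" "\<And>w. w \<in> K \<Longrightarrow> norm w0 \<le> norm w"
        using continuous_attains_inf[OF cK False] by blast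
      have "norm w0 > 1" using nz[of w0] w0(1) unfolding K_def by force
      moreover have "eval_fps f w \<noteq> 0" if "norm w < norm w0" for w
      proof
        assume "eval_fps f w = 0"
        moreover have "norm w0 \<le> t" using w0(1) unfolding K_def by simp
        ultimately have "w \<in> K" unfolding K_def using that by simp
        thus False using w0(2)[of w] that by simp
      qed
      ultimately show ?thesis by blast
    qed
  qed
  then obtain R where R: "R > 1" "\<And>w. norm w < R \<Longrightarrow> eval_fps f w \<noteq> 0" by blast
  have f0: "fps_nth f 0 \<noteq> 0" unfolding f_def r_def using u(2) by simp
  define C where "C = inverse f"
  have radC: "fps_conv_radius C \<ge> min (ereal R) (fps_conv_radius f)"
    unfolding C_def
    by (rule fps_conv_radius_inverse) (use R f0 in \<open>auto simp: in_eball_iff\<close>)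
  moreover have "ereal 1 < min (ereal R) (fps_conv_radius f)"
    using R(1) inball[of 1] s0 by (simp add: one_ereal_def)
  ultimately have "ereal 1 < fps_conv_radius C" by (meson less_le_trans)
  hence radC1: "ereal (norm (1 :: complex)) < fps_conv_radius C" by simp
  have Csum: "fps_nth C sums eval_fps C 1" using sums_eval_fps[OF radC1] by simp
  have Cf: "C * f = 1" unfolding C_def using f0 by (rule inverse_mult_eq_1)
  define Zf where "Zf = Abs_fps (\<lambda>n. complex_of_real (z n))"
  have fZ: "f * Zf = Abs_fps (\<lambda>_. 1)"
  proof (rule fps_ext)
    fix n
    have "fps_nth (f * Zf) n = of_real (\<Sum>i\<le>n. r i * z (n - i))"
      by (simp add: f_def Zf_def fps_mult_nth atMost_atLeast0)
    also have "(\<Sum>i\<le>n. r i * z (n - i)) = 1" unfolding r_def by (rule renewal_convolution[OF u(2) z0 ren])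
    finally show "fps_nth (f * Zf) n = fps_nth (Abs_fps (\<lambda>_. 1)) n" by simp
  qed
  have zC: "complex_of_real (z n) = (\<Sum>i\<le>n. fps_nth C i)" for n
  proof -
    have "Zf = C * Abs_fps (\<lambda>_. 1)" unfolding fZ[symmetric] mult.assoc[symmetric] Cf by simp
    hence "fps_nth Zf n = (\<Sum>i\<le>n. fps_nth C i)" by (simp add: fps_mult_nth atMost_atLeast0)
    thus ?thesis unfolding Zf_def by simp
  qed
  have "(\<lambda>n. complex_of_real (z n)) \<longlonglongrightarrow> eval_fps C 1"
    using Csum unfolding zC sums_def_le .
  hence lim: "z \<longlonglongrightarrow> Re (eval_fps C 1)" using tendsto_Re by fastforce
  \<comment> \<open>The limit is the reciprocal of the sum of the tails, that is, of the mean gap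
    between renewals.\<close>
  have "eval_fps C 1 * eval_fps f 1 = eval_fps (C * f) 1"
    by (rule eval_fps_mult[symmetric]) (use radC1 inball[of 1] s0 in auto)
  hence "eval_fps C 1 * eval_fps f 1 = 1" unfolding Cf by simp
  hence "Re (eval_fps C 1) * Re (eval_fps f 1) = 1" using im1 by (simp add: complex_eq_iff)
  hence "Re (eval_fps C 1) > 0" using pos1 by (metis less_le_trans not_one_less_zero zero_less_mult_pos2 zero_less_one)
  thus ?thesis using lim by blast
qed

text \<open>With \<open>u m = f m \<rho>\<^sup>m\<close>, every truncation \<open>U\<close> of the generating function satisfies
  \<open>U s \<le> 1 + (s - 1) (c3 (U s)\<^sup>2 + c4)\<close>; for \<open>s\<close> near 1 the value 2 violates this, which traps \<open>U s\<close> below 2.\<close>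
theorem renewal_theorem:
  fixes f Z :: "nat \<Rightarrow> real"
  assumes f: "\<And>m. f m \<ge> 0" "f 0 = 0" "f 1 > 0" and growth: "\<And>m. f m \<le> A * g ^ m" "A > 0" "g > 0"
    and Z: "Z 0 = 1" "\<And>n. n \<ge> 1 \<Longrightarrow> Z n = (\<Sum>j = 1..n. f j * Z (n - j))"
    and c: "c1 \<ge> 0" "c2 \<ge> 0"
    and surg: "\<And>m. real m * f m \<le> c1 * (\<Sum>d\<le>D. \<Sum>(i, j) | i + d + j = m. f i * f j) + c2 * (f 1 / 2) ^ m"
  shows "\<exists>\<rho>>0. \<exists>L>0. (\<lambda>n. Z n * \<rho> ^ n) \<longlonglongrightarrow> L"
proof -
  define F where "F M s = (\<Sum>m\<le>M. f m * s ^ m)" for M :: nat and s :: real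
  define S where "S = {s. s \<ge> 0 \<and> (\<forall>M. F M s \<le> 1)}"
  have Sb: "s \<le> 1 / f 1" if "s \<in> S" for s
  proof -
    have "F 1 s \<le> 1" using that unfolding S_def by blast
    hence "f 1 * s \<le> 1" unfolding F_def using f(2) by simp
    thus ?thesis using f(3) by (simp add: field_simps)
  qed
  hence bdd: "bdd_above S" by (meson bdd_aboveI)
  \<comment> \<open>Chosen so that the dominating series, with terms \<open>A / (1 + A) ^ m\<close>
    for \<open>m \<ge> 1\<close>, sums to exactly 1.\<close>
  define sm where "sm = 1 / (g * (1 + A))"
  have sm_pos: "sm > 0" unfolding sm_def using growth by simp
  have smS: "sm \<in> S"
  proof -
    have q: "g * sm = 1 / (1 + A)" unfolding sm_def using growth(3) by simp
    have "F M sm \<le> 1" for M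
    proof -
      have "F M sm = (\<Sum>m\<in>{1..M}. f m * sm ^ m)" unfolding F_def
        by (rule sum.mono_neutral_right) (use f(2) in \<open>auto simp: not_le\<close>)
      also have "\<dots> \<le> (\<Sum>m\<in>{1..M}. A * (1 / (1 + A)) ^ m)"
      proof (rule sum_mono)
        fix m
        have "f m * sm ^ m \<le> A * g ^ m * sm ^ m" using growth(1)[of m] sm_pos by (intro mult_right_mono) auto
        thus "f m * sm ^ m \<le> A * (1 / (1 + A)) ^ m" unfolding q[symmetric] by (simp add: power_mult_distrib)
      qed
      also have "\<dots> = 1 - (1 / (1 + A)) ^ M"
      proof (induction M)
        case (Suc M)
        have "A * (1 / (1 + A)) = 1 - 1 / (1 + A)" using growth(2) by (simp add: divide_simps)
        moreover have "A * (1 / (1 + A)) ^ Suc M = A * (1 / (1 + A)) * (1 / (1 + A)) ^ M" by simp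
        ultimately have "A * (1 / (1 + A)) ^ Suc M = (1 - 1 / (1 + A)) * (1 / (1 + A)) ^ M" by (simp only:)
        also have "\<dots> = (1 / (1 + A)) ^ M - (1 / (1 + A)) ^ Suc M"
          by (simp only: left_diff_distrib mult_1_left power_Suc)
        finally have "A * (1 / (1 + A)) ^ Suc M = (1 / (1 + A)) ^ M - (1 / (1 + A)) ^ Suc M" .
        thus ?case using Suc.IH by simp
      qed simp
      also have "\<dots> \<le> 1" using growth(2) by simp
      finally show ?thesis .
    qed
    thus ?thesis unfolding S_def using sm_pos by simp
  qed
  \<comment> \<open>The critical point. That the full series takes the value 1 there, and not less,
    is only shown in \<open>eq1\<close>.\<close>
  define \<rho> where "\<rho> = Sup S"
  have \<rho>_pos: "\<rho> > 0" using cSup_upper[OF smS bdd] sm_pos unfolding \<rho>_def by simp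
  have cl: "closed {s. F M s \<le> 1}" for M
    unfolding F_def by (intro closed_Collect_le continuous_intros)
  have F\<rho>: "F M \<rho> \<le> 1" for M
  proof -
    have "\<rho> \<in> closure S" unfolding \<rho>_def using smS bdd by (intro closure_contains_Sup) auto
    also have "closure S \<subseteq> {s. F M s \<le> 1}" by (rule closure_minimal[OF _ cl]) (auto simp: S_def)
    finally show ?thesis by simp
  qed
  have "\<rho> \<in> S" unfolding S_def using F\<rho> \<rho>_pos by simp
  \<comment> \<open>Compares the rate of the error term with the critical point:
    \<open>f 1 / 2 * \<rho> \<le> 1 / 2\<close>, which leaves room for \<open>s\<close> up to
    \<open>3/2\<close>.\<close>
  hence f1\<rho>: "f 1 * \<rho> \<le> 1" using Sb[of \<rho>] f(3) by (simp add: field_simps)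
  define u where "u m = f m * \<rho> ^ m" for m
  have u_nn: "u m \<ge> 0" for m unfolding u_def using f(1) \<rho>_pos by simp
  define U where "U M s = (\<Sum>m\<le>M. u m * s ^ m)" for M :: nat and s :: real
  have UF: "U M s = F M (\<rho> * s)" for M s unfolding U_def F_def u_def by (simp add: power_mult_distrib mult_ac)
  have U1: "U M 1 \<le> 1" for M using F\<rho>[of M] by (simp add: UF)
  \<comment> \<open>Bounds \<open>x ^ d\<close> for the \<open>d \<le> D\<close> columns missing in
    the convolution when \<open>x \<le> 2 * \<rho>\<close>; adding 1 makes the base at least 1,
    hence the power monotone in the exponent.\<close>
  define X where "X = (1 + 2 * \<rho>) ^ D"
  define c3 where "c3 = c1 * (real D + 1) * X"
  \<comment> \<open>The geometric series with ratio \<open>3/4\<close> sums to 4; the ratio bounds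
    \<open>f 1 / 2 * x\<close> for \<open>s \<le> 3/2\<close>.\<close>
  define c4 where "c4 = 4 * c2"
  have X_pos: "X > 0" unfolding X_def using \<rho>_pos by simp
  have c3: "c3 \<ge> 0" unfolding c3_def using c X_pos by simp
  have key: "(\<Sum>m\<le>M. real m * (u m * s ^ m)) \<le> c3 * (U M s)\<^sup>2 + c4" if s: "1 \<le> s" "s \<le> 3/2" for M s
  proof -
    define x where "x = \<rho> * s"
    have x: "0 < x" "x \<le> 2 * \<rho>" unfolding x_def using \<rho>_pos s by auto
    define a where "a i = f i * x ^ i" for i
    have a_nn: "a i \<ge> 0" for i unfolding a_def using f(1) x by simp
    have ua: "u m * s ^ m = a m" for m unfolding u_def a_def x_def by (simp add: power_mult_distrib)
    have termb: "real m * a m \<le> c1 * X * (\<Sum>d\<le>D. \<Sum>(i, j) | i + d + j = m. a i * a j) + c2 * (3/4) ^ m" for m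
    proof -
      have "real m * a m = real m * f m * x ^ m" unfolding a_def by simp
      also have "\<dots> \<le> (c1 * (\<Sum>d\<le>D. \<Sum>(i, j) | i + d + j = m. f i * f j) + c2 * (f 1 / 2) ^ m) * x ^ m"
        using surg[of m] x by (intro mult_right_mono) auto
      also have "\<dots> = c1 * (\<Sum>d\<le>D. \<Sum>(i, j) | i + d + j = m. f i * f j * x ^ m) + c2 * (f 1 / 2 * x) ^ m"
      proof -
        have "(f 1 / 2) ^ m * x ^ m = (f 1 / 2 * x) ^ m" by (rule power_mult_distrib[symmetric])
        thus ?thesis by (simp only: distrib_right mult.assoc sum_distrib_right case_prod_unfold)
      qed
      also have "c2 * (f 1 / 2 * x) ^ m \<le> c2 * (3/4) ^ m"
      proof (intro mult_left_mono power_mono c)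
        have "f 1 * \<rho> * s \<le> 1 * (3/2)" using f1\<rho> s f(3) \<rho>_pos by (intro mult_mono) auto
        thus "f 1 / 2 * x \<le> 3/4" unfolding x_def by (simp add: mult_ac)
        show "0 \<le> f 1 / 2 * x" using f(3) x by simp
      qed
      also have "(\<Sum>d\<le>D. \<Sum>(i, j) | i + d + j = m. f i * f j * x ^ m) \<le> (\<Sum>d\<le>D. \<Sum>(i, j) | i + d + j = m. X * (a i * a j))"
      proof (intro sum_mono)
        fix d y assume d: "d \<in> {..D}" and y: "y \<in> {(i, j). i + d + j = m}"
        obtain i j where ij: "y = (i, j)" "m = i + d + j" using y by auto
        have "x ^ d \<le> (1 + 2 * \<rho>) ^ d" using x by (intro power_mono) auto
        also have "\<dots> \<le> X" unfolding X_def using d \<rho>_pos by (intro power_increasing) auto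
        finally have "x ^ d * (a i * a j) \<le> X * (a i * a j)" using a_nn by (intro mult_right_mono) auto
        moreover have "f i * f j * x ^ m = x ^ d * (a i * a j)" unfolding ij(2) a_def by (simp add: power_add)
        ultimately show "(case y of (i, j) \<Rightarrow> f i * f j * x ^ m) \<le> (case y of (i, j) \<Rightarrow> X * (a i * a j))"
          unfolding ij(1) by simp
      qed
      also have "\<dots> = X * (\<Sum>d\<le>D. \<Sum>(i, j) | i + d + j = m. a i * a j)"
        by (simp add: sum_distrib_left case_prod_unfold)
      finally show ?thesis using c(1) by (simp add: mult_left_mono mult.assoc)
    qed
    have "(\<Sum>m\<le>M. real m * (u m * s ^ m)) = (\<Sum>m\<le>M. real m * a m)" by (simp add: ua)
    also have "\<dots> \<le> (\<Sum>m\<le>M. c1 * X * (\<Sum>d\<le>D. \<Sum>(i, j) | i + d + j = m. a i * a j) + c2 * (3/4) ^ m)"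
      by (rule sum_mono) (rule termb)
    also have "\<dots> = c1 * X * (\<Sum>m\<le>M. \<Sum>d\<le>D. \<Sum>(i, j) | i + d + j = m. a i * a j) + c2 * (\<Sum>m\<le>M. (3/4) ^ m)"
      by (simp add: sum.distrib sum_distrib_left)
    finally have le: "(\<Sum>m\<le>M. real m * (u m * s ^ m)) \<le>
      c1 * X * (\<Sum>m\<le>M. \<Sum>d\<le>D. \<Sum>(i, j) | i + d + j = m. a i * a j) + c2 * (\<Sum>m\<le>M. (3/4) ^ m)" .
    have "(\<Sum>m\<le>M. \<Sum>d\<le>D. \<Sum>(i, j) | i + d + j = m. a i * a j) = (\<Sum>d\<le>D. \<Sum>m\<le>M. \<Sum>(i, j) | i + d + j = m. a i * a j)"
      by (rule sum.swap)
    also have "\<dots> \<le> (\<Sum>d\<le>D. (\<Sum>i\<le>M. a i)\<^sup>2)" by (intro sum_mono sum_convolution_le a_nn)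
    also have "\<dots> = (real D + 1) * (U M s)\<^sup>2" by (simp add: U_def ua)
    finally have le1: "c1 * X * (\<Sum>m\<le>M. \<Sum>d\<le>D. \<Sum>(i, j) | i + d + j = m. a i * a j) \<le> c1 * X * ((real D + 1) * (U M s)\<^sup>2)"
      using c X_pos by (intro mult_left_mono) auto
    have "(\<Sum>m\<le>M. (3/4 :: real) ^ m) \<le> (\<Sum>m. (3/4) ^ m)" by (intro sum_le_suminf summable_geometric) auto
    also have "\<dots> = 4" by (subst suminf_geometric) auto
    finally have le2: "c2 * (\<Sum>m\<le>M. (3/4) ^ m) \<le> c2 * 4" using c by (intro mult_left_mono) auto
    have "c3 * (U M s)\<^sup>2 + c4 = c1 * X * ((real D + 1) * (U M s)\<^sup>2) + c2 * 4"
      unfolding c3_def c4_def by (simp add: mult_ac)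
    thus ?thesis using le le1 le2 by linarith
  qed
  have incr: "U M s \<le> U M 1 + (s - 1) * (c3 * (U M s)\<^sup>2 + c4)" if s: "1 \<le> s" "s \<le> 3/2" for M s
  proof -
    have pw: "s ^ m - 1 \<le> (s - 1) * (real m * s ^ m)" for m
    proof (induction m)
      case (Suc m)
      have "s ^ Suc m - 1 = s * (s ^ m - 1) + (s - 1)" by (simp add: algebra_simps)
      also have "\<dots> \<le> s * ((s - 1) * (real m * s ^ m)) + (s - 1) * s ^ Suc m"
      proof (intro add_mono mult_left_mono Suc.IH)
        have "(s - 1) * 1 \<le> (s - 1) * s ^ Suc m" using s one_le_power[of s "Suc m"] by (intro mult_left_mono) auto
        thus "s - 1 \<le> (s - 1) * s ^ Suc m" by simp
      qed (use s in auto)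
      also have "\<dots> = (s - 1) * (real (Suc m) * s ^ Suc m)" by (simp add: algebra_simps)
      finally show ?case .
    qed simp
    have "U M s - U M 1 = (\<Sum>m\<le>M. u m * (s ^ m - 1))" unfolding U_def by (simp add: sum_subtractf algebra_simps)
    also have "\<dots> \<le> (\<Sum>m\<le>M. u m * ((s - 1) * (real m * s ^ m)))" by (intro sum_mono mult_left_mono pw u_nn)
    also have "\<dots> = (s - 1) * (\<Sum>m\<le>M. real m * (u m * s ^ m))" by (simp add: sum_distrib_left mult_ac)
    also have "\<dots> \<le> (s - 1) * (c3 * (U M s)\<^sup>2 + c4)" using s by (intro mult_left_mono key) auto
    finally show ?thesis by simp
  qed
  \<comment> \<open>The value of \<open>c3 * U^2 + c4\<close> at \<open>U = 2\<close>. As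
    \<open>\<epsilon> * K < 1\<close>, reaching 2 would require
    \<open>2 \<le> 1 + \<epsilon> * K < 2\<close>.\<close>
  define K where "K = 4 * c3 + c4"
  have K: "K \<ge> 0" unfolding K_def c4_def using c3 c by simp
  define \<epsilon> where "\<epsilon> = 1 / (2 + 2 * K)"
  have \<epsilon>: "\<epsilon> > 0" "\<epsilon> \<le> 1/2" "\<epsilon> * K < 1" unfolding \<epsilon>_def using K by (auto simp: field_simps)
  have U2: "U M s < 2" if s: "1 \<le> s" "s \<le> 1 + \<epsilon>" for M s
  proof (rule ccontr)
    assume "\<not> U M s < 2"
    moreover have "continuous_on {1..s} (U M)" unfolding U_def by (intro continuous_intros)
    ultimately obtain t where t: "1 \<le> t" "t \<le> s" "U M t = 2"
      using IVT'[of "U M" 1 2 s] U1[of M] s by auto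
    have "2 \<le> 1 + (t - 1) * K" using incr[of t M] t s \<epsilon> U1[of M] unfolding K_def by (simp add: algebra_simps)
    also have "(t - 1) * K \<le> \<epsilon> * K" using t s K by (intro mult_right_mono) auto
    finally show False using \<epsilon> by simp
  qed
  define s0 where "s0 = 1 + \<epsilon>"
  have sums0: "summable (\<lambda>m. u m * s0 ^ m)"
  proof (rule summableI_nonneg_bounded)
    show "u m * s0 ^ m \<ge> 0" for m using u_nn \<epsilon> unfolding s0_def by simp
    show "(\<Sum>i<n. u i * s0 ^ i) \<le> 2" for n
    proof -
      have "(\<Sum>i<n. u i * s0 ^ i) \<le> U n s0" unfolding U_def
        by (rule sum_mono2) (use u_nn \<epsilon> in \<open>auto simp: s0_def\<close>)
      thus ?thesis using U2[of s0 n] \<epsilon> unfolding s0_def by simp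
    qed
  qed
  have su: "summable u"
    by (rule summable_comparison_test'[OF sums0])
       (use u_nn \<epsilon> mult_left_mono[OF one_le_power[of s0] u_nn] in \<open>auto simp: s0_def\<close>)
  have part: "U M 1 \<le> suminf u" for M
    unfolding U_def using sum_le_suminf[OF su, of "{..M}"] u_nn by simp
  have le1: "suminf u \<le> 1"
  proof (rule suminf_le_const[OF su])
    fix n show "sum u {..<n} \<le> 1"
      using U1[of n] sum_mono2[of "{..n}" "{..<n}" u] u_nn unfolding U_def by force
  qed
  \<comment> \<open>Were the sum smaller, the increment bound would leave room to enlarge
    \<open>\<rho>\<close> by a factor \<open>1 + \<delta>\<close> inside \<open>S\<close>.\<close>
  have eq1: "suminf u = 1"
  proof (rule ccontr)
    assume "suminf u \<noteq> 1"
    hence lt: "suminf u < 1" using le1 by simp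
    define \<delta> where "\<delta> = min \<epsilon> ((1 - suminf u) / (K + 1))"
    have \<delta>: "\<delta> > 0" "\<delta> \<le> \<epsilon>" unfolding \<delta>_def using lt \<epsilon> K by auto
    have "\<delta> * (K + 1) \<le> (1 - suminf u) / (K + 1) * (K + 1)" unfolding \<delta>_def using K by (intro mult_right_mono) auto
    also have "\<dots> = 1 - suminf u" using K by simp
    finally have "\<delta> * K + \<delta> \<le> 1 - suminf u" by (simp only: distrib_left mult_1_right)
    hence \<delta>K: "\<delta> * K \<le> 1 - suminf u" using \<delta> by linarith
    have "F M (\<rho> * (1 + \<delta>)) \<le> 1" for M
    proof -
      have l2: "U M (1 + \<delta>) < 2" by (rule U2) (use \<delta> in auto)
      have "U M (1 + \<delta>) \<ge> 0" unfolding U_def using u_nn \<delta> by (intro sum_nonneg) auto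
      hence "(U M (1 + \<delta>))\<^sup>2 \<le> 2\<^sup>2" using l2 by (intro power_mono) auto
      hence "c3 * (U M (1 + \<delta>))\<^sup>2 + c4 \<le> K" unfolding K_def using c3 by (simp add: mult.commute mult_left_mono)
      hence "\<delta> * (c3 * (U M (1 + \<delta>))\<^sup>2 + c4) \<le> \<delta> * K" using \<delta> by (intro mult_left_mono) auto
      moreover have "U M (1 + \<delta>) \<le> U M 1 + \<delta> * (c3 * (U M (1 + \<delta>))\<^sup>2 + c4)" using incr[of "1 + \<delta>" M] \<delta> \<epsilon> by simp
      ultimately have "U M (1 + \<delta>) \<le> 1" using part[of M] \<delta>K by linarith
      thus ?thesis by (simp add: UF)
    qed
    hence "\<rho> * (1 + \<delta>) \<in> S" unfolding S_def using \<rho>_pos \<delta> by simp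
    hence "\<rho> * (1 + \<delta>) \<le> \<rho>" unfolding \<rho>_def by (rule cSup_upper[OF _ bdd])
    moreover have "\<rho> * \<delta> > 0" using \<rho>_pos \<delta> by simp
    ultimately show False by (simp add: distrib_left)
  qed
  have "\<exists>L>0. (\<lambda>n. Z n * \<rho> ^ n) \<longlonglongrightarrow> L"
  proof (rule renewal_limit[of u s0])
    show "u sums 1" using su eq1 by (simp add: sums_iff)
    show "u 0 = 0" "u 1 > 0" "s0 > 1" unfolding u_def s0_def using f \<rho>_pos \<epsilon> by auto
    fix n :: nat assume n: "n \<ge> 1"
    show "Z n * \<rho> ^ n = (\<Sum>j = 1..n. u j * (Z (n - j) * \<rho> ^ (n - j)))"
      unfolding Z(2)[OF n] sum_distrib_right
      by (rule sum.cong) (auto simp: u_def power_add[symmetric])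
  qed (use u_nn sums0 Z in auto)
  thus ?thesis using \<rho>_pos by blast
qed

section \<open>Column decomposition\<close>

lemma clique_extend:
  assumes fin: "finite B" and \<tau>: "\<tau> \<subseteq> edges B" "clique \<tau>"
  shows "\<exists>\<sigma>. \<tau> \<subseteq> \<sigma> \<and> tri B \<sigma>"
proof -
  define C where "C = {\<sigma>. \<tau> \<subseteq> \<sigma> \<and> \<sigma> \<subseteq> edges B \<and> clique \<sigma>}"
  have "C \<subseteq> Pow (edges B)" unfolding C_def by blast
  hence fC: "finite C" using fin by (meson finite_Pow_iff finite_edges finite_subset)
  have "\<tau> \<in> C" unfolding C_def using \<tau> by blast
  then obtain \<sigma> where s: "\<sigma> \<in> C" "\<And>\<rho>. \<rho> \<in> C \<Longrightarrow> \<sigma> \<subseteq> \<rho> \<Longrightarrow> \<rho> = \<sigma>"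
    using finite_has_maximal[OF fC] by blast
  have s': "\<tau> \<subseteq> \<sigma>" "\<sigma> \<subseteq> edges B" "clique \<sigma>" using s(1) unfolding C_def by auto
  have "\<exists>e'\<in>\<sigma>. seg e \<inter> seg e' \<noteq> {}" if e: "e \<in> edges B - \<sigma>" for e
  proof (rule ccontr)
    assume n: "\<not> ?thesis"
    have "clique (insert e \<sigma>)" using s'(3) n unfolding clique_def by (simp add: Int_commute)
    hence "insert e \<sigma> \<in> C" unfolding C_def using s' e by blast
    thus False using s(2)[of "insert e \<sigma>"] e by blast
  qed
  thus ?thesis unfolding tri_def using s' by blast
qed

lemma edges_mono: "B \<subseteq> B' \<Longrightarrow> edges B \<subseteq> edges B'"
  unfolding edges_def by blast

lemma edges_sub: "e \<in> edges B' \<Longrightarrow> e \<subseteq> B \<Longrightarrow> e \<in> edges B"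
  unfolding edges_def by blast

lemma edges_subset: "e \<in> edges B \<Longrightarrow> e \<subseteq> B"
  unfolding edges_def by blast

lemma len_pair: "p \<noteq> q \<Longrightarrow> len {p, q} = \<bar>fst p - fst q\<bar> + \<bar>snd p - snd q\<bar>"
  by (simp add: len_def abs_minus_commute)

lemma len_nonneg: "e \<in> edges B \<Longrightarrow> len e \<ge> 1"
  unfolding edges_def by (auto simp: len_pair prod_eq_iff)

section \<open>Full columns cut the strip into independent pieces\<close>

locale strip =
  fixes k :: nat and lam :: real
  assumes k: "k \<ge> 1" and lam: "0 < lam" "lam < 1"
begin

definition bx :: "int \<Rightarrow> int \<Rightarrow> point set" where "bx a b = rect a b 0 (int k)"

definition TR :: "int \<Rightarrow> int \<Rightarrow> edge set set" where "TR a b = {\<sigma>. tri (bx a b) \<sigma>}"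

definition V :: "int \<Rightarrow> edge set" where "V c = (\<lambda>j. {(c, j), (c, j + 1)}) ` {0..<int k}"

definition sub :: "int \<Rightarrow> int \<Rightarrow> edge set \<Rightarrow> edge set" where
  "sub a b \<sigma> = {e \<in> \<sigma>. e \<subseteq> bx a b}"

lemma mem_bx: "p \<in> bx a b \<longleftrightarrow> a \<le> fst p \<and> fst p \<le> b \<and> 0 \<le> snd p \<and> snd p \<le> int k"
  by (auto simp: bx_def rect_def mem_Times_iff)

lemma finite_bx [simp]: "finite (bx a b)" by (simp add: bx_def)

lemma bx_mono: "a \<le> a' \<Longrightarrow> b' \<le> b \<Longrightarrow> bx a' b' \<subseteq> bx a b"
  by (auto simp: mem_bx)

lemma V_edges: "a \<le> c \<Longrightarrow> c \<le> b \<Longrightarrow> V c \<subseteq> edges (bx a b)"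
proof
  fix e assume h: "a \<le> c" "c \<le> b" "e \<in> V c"
  then obtain j where j: "0 \<le> j" "j < int k" "e = {(c, j), (c, j + 1)}" unfolding V_def by auto
  show "e \<in> edges (bx a b)" unfolding j(3)
  proof (rule edgesI)
    fix w show "toR w \<notin> seg {(c, j), (c, j + 1)}"
    proof
      assume "toR w \<in> seg {(c, j), (c, j + 1)}"
      hence "real_of_int j < ry w" "ry w < real_of_int (j + 1)"
        unfolding toR_def using seg_vert[of "(c, j)" "(c, j + 1)" "rx w" "ry w"] by auto
      hence "j < snd w" "snd w < j + 1" by simp_all
      thus False by simp
    qed
  qed (use j h in \<open>auto simp: mem_bx\<close>)
qed

lemma column_edge:
  assumes "{p, q} \<in> edges (bx a b)" "fst p = fst q" "snd p < snd q"
  shows "{p, q} \<in> V (fst p)"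
proof -
  have "p \<in> bx a b" "q \<in> bx a b" using edges_ends[OF assms(1)] by auto
  hence r: "0 \<le> snd p" "snd q \<le> int k" by (auto simp: mem_bx)
  have "snd q = snd p + 1"
  proof (rule ccontr)
    assume "snd q \<noteq> snd p + 1"
    hence "toR (fst p, snd p + 1) \<in> seg {p, q}" unfolding toR_def
      by (subst seg_vert) (use assms in auto)
    thus False using edges_lattice[OF assms(1)] by blast
  qed
  hence "{p, q} = {(fst p, snd p), (fst p, snd p + 1)}" using assms by (metis prod.collapse)
  thus ?thesis unfolding V_def using r \<open>snd q = snd p + 1\<close> by (intro image_eqI[of _ _ "snd p"]) auto
qed

text \<open>An edge with an interior point on a boundary column is contained in that column. This is
  why two neighbouring pieces interact through \<open>V\<close> only.\<close>

lemma seg_in_strip: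
  assumes "e \<in> edges (bx a b)" "(x, y) \<in> seg e"
  shows "real_of_int a \<le> x" "x \<le> real_of_int b" "x = real_of_int a \<Longrightarrow> e \<in> V a" "x = real_of_int b \<Longrightarrow> e \<in> V b"
proof -
  have "real_of_int a \<le> x \<and> x \<le> real_of_int b \<and> (x = real_of_int a \<longrightarrow> e \<in> V a) \<and> (x = real_of_int b \<longrightarrow> e \<in> V b)"
    using assms(1)
  proof (cases rule: edges_cases)
    case (1 p q)
    have "rx p < x" "x < rx q" using assms(2) unfolding 1(1) seg_nonvert[OF 1(4)] by auto
    moreover have "real_of_int a \<le> rx p" "rx q \<le> real_of_int b" using 1 by (auto simp: mem_bx)
    ultimately show ?thesis by auto
  next
    case (2 p q)
    have x: "x = rx p" using assms(2) unfolding 2(1) seg_vert[OF 2(4,5)] by auto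
    have "e \<in> V (fst p)" using column_edge[of p q a b] assms(1) 2 by simp
    moreover have "a \<le> fst p" "fst p \<le> b" using 2 by (auto simp: mem_bx)
    ultimately show ?thesis using x by auto
  qed
  thus "real_of_int a \<le> x" "x \<le> real_of_int b" "x = real_of_int a \<Longrightarrow> e \<in> V a" "x = real_of_int b \<Longrightarrow> e \<in> V b"
    by blast+
qed

text \<open>The edge meets column \<open>c\<close> at a non-integral height, hence inside the unit
  edge that starts at its floor.\<close>

lemma cross_column:
  assumes "{p, q} \<in> edges (bx a b)" "fst p < c" "c < fst q"
  shows "\<exists>e\<in>V c. seg {p, q} \<inter> seg e \<noteq> {}"
proof -
  have lt: "fst p < fst q" using assms by simp
  have mem: "p \<in> bx a b" "q \<in> bx a b" using edges_ends[OF assms(1)] by auto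
  define y where "y = hgt p q (real_of_int c)"
  have y: "0 \<le> y" "y \<le> real_of_int (int k)"
    using hgt_rect[OF lt, of "real_of_int c" a b 0 "int k"] assms mem unfolding y_def bx_def by auto
  have ny: "y \<noteq> real_of_int j" for j
    using edge_hgt_lattice[OF assms(1), of "(c, j)"] assms unfolding y_def by simp
  define j where "j = \<lfloor>y\<rfloor>"
  have j: "real_of_int j < y" "y < real_of_int (j + 1)" unfolding j_def using ny[of "\<lfloor>y\<rfloor>"] by linarith+
  have "0 \<le> j" unfolding j_def using y by simp
  moreover have "j < int k" using j y by linarith
  ultimately have "{(c, j), (c, j + 1)} \<in> V c" unfolding V_def by auto
  moreover have "(real_of_int c, y) \<in> seg {(c, j), (c, j + 1)}" by (subst seg_vert) (use j in auto)
  moreover have "(real_of_int c, y) \<in> seg {p, q}" by (subst seg_nonvert[OF lt]) (use assms y_def in auto)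
  ultimately show ?thesis by blast
qed

lemma edge_side:
  assumes "e \<in> edges (bx a b)" "\<And>d. d \<in> V c \<Longrightarrow> d \<noteq> e \<Longrightarrow> seg e \<inter> seg d = {}" "a \<le> c" "c \<le> b"
  shows "e \<in> edges (bx a c) \<or> e \<in> edges (bx c b)"
  using assms(1)
proof (cases rule: edges_cases)
  case (1 p q)
  have "\<not> (fst p < c \<and> c < fst q)"
  proof
    assume h: "fst p < c \<and> c < fst q"
    then obtain d where d: "d \<in> V c" "seg {p, q} \<inter> seg d \<noteq> {}" using cross_column[of p q a b c] assms 1 by auto
    have "d \<noteq> e"
    proof
      assume "d = e"
      then obtain j where "{p, q} = {(c, j), (c, j + 1)}" using d 1 unfolding V_def by auto
      thus False using h by (auto simp: doubleton_eq_iff)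
    qed
    thus False using assms(2)[OF d(1)] d(2) 1 by simp
  qed
  hence "e \<subseteq> bx a c \<or> e \<subseteq> bx c b" using 1 by (auto simp: mem_bx)
  thus ?thesis using edges_sub[OF assms(1)] by blast
next
  case (2 p q)
  hence "e \<subseteq> bx a c \<or> e \<subseteq> bx c b" by (auto simp: mem_bx)
  thus ?thesis using edges_sub[OF assms(1)] by blast
qed

lemma TR_D: "\<sigma> \<in> TR a b \<Longrightarrow> \<sigma> \<subseteq> edges (bx a b) \<and> clique \<sigma>"
  unfolding TR_def tri_def by blast

lemma finite_TR [simp]: "finite (TR a b)"
proof (rule finite_subset)
  show "TR a b \<subseteq> Pow (edges (bx a b))" using TR_D by blast
qed simp

lemma finite_mem_TR: "\<sigma> \<in> TR a b \<Longrightarrow> finite \<sigma>"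
  using TR_D by (meson finite_bx finite_edges finite_subset)

lemma V_left: "\<sigma> \<in> TR a b \<Longrightarrow> a \<le> b \<Longrightarrow> V a \<subseteq> \<sigma>"
  unfolding TR_def V_def bx_def using left_edge by auto

lemma V_right: "\<sigma> \<in> TR a b \<Longrightarrow> a \<le> b \<Longrightarrow> V b \<subseteq> \<sigma>"
  unfolding TR_def V_def bx_def using right_edge by auto

lemma TR_nonempty: "TR a b \<noteq> {}"
  using clique_extend[of "bx a b" "{}"] unfolding TR_def clique_def by auto

lemma V_sub: "a \<le> c \<Longrightarrow> c \<le> b \<Longrightarrow> e \<in> V c \<Longrightarrow> e \<subseteq> bx a b"
  using V_edges edges_subset by blast

lemma V_subset_sub: "a \<le> c \<Longrightarrow> c \<le> b \<Longrightarrow> V c \<subseteq> sub a b \<sigma> \<longleftrightarrow> V c \<subseteq> \<sigma>"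
  unfolding sub_def using V_sub by blast

lemma edges_both: "e \<in> edges (bx a c) \<Longrightarrow> e \<in> edges (bx c b) \<Longrightarrow> e \<in> V c"
proof -
  assume h: "e \<in> edges (bx a c)" "e \<in> edges (bx c b)"
  from h(1) show "e \<in> V c"
  proof (cases rule: edges_cases)
    case (1 p q)
    hence "p \<in> bx c b" using edges_subset[OF h(2)] by simp
    thus ?thesis using 1 by (auto simp: mem_bx)
  next
    case (2 p q)
    hence "p \<in> bx c b" using edges_subset[OF h(2)] by simp
    hence "fst p = c" using 2 by (auto simp: mem_bx)
    thus ?thesis using column_edge[of p q a c] h 2 by simp
  qed
qed

text \<open>No edge crosses a column that is present, so each lies on one side. Maximality passes to
  the halves: an obstruction from the other half would meet the candidate on the column, which puts
  both into \<open>V c\<close>.\<close>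

lemma split_TR:
  assumes s: "\<sigma> \<in> TR a b" and ac: "a \<le> c" "c \<le> b" and V: "V c \<subseteq> \<sigma>"
  shows "sub a c \<sigma> \<in> TR a c" "sub c b \<sigma> \<in> TR c b" "\<sigma> = sub a c \<sigma> \<union> sub c b \<sigma>" "sub a c \<sigma> \<inter> sub c b \<sigma> = V c"
proof -
  have sE: "\<sigma> \<subseteq> edges (bx a b)" and cl: "clique \<sigma>" using TR_D[OF s] by auto
  have side: "e \<in> edges (bx a c) \<or> e \<in> edges (bx c b)" if "e \<in> \<sigma>" for e
    by (rule edge_side) (use that sE cl V ac in \<open>auto simp: clique_def\<close>)
  have mx: "\<And>e. e \<in> edges (bx a b) \<Longrightarrow> e \<notin> \<sigma> \<Longrightarrow> \<exists>e'\<in>\<sigma>. seg e \<inter> seg e' \<noteq> {}"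
    using s unfolding TR_def tri_def by blast
  have m1: "edges (bx a c) \<subseteq> edges (bx a b)" "edges (bx c b) \<subseteq> edges (bx a b)" using ac by (intro edges_mono bx_mono order_refl; simp)+
  have e1: "e \<in> sub a c \<sigma> \<longleftrightarrow> e \<in> \<sigma> \<and> e \<in> edges (bx a c)" for e
    unfolding sub_def using edges_sub edges_subset sE by blast
  have e2: "e \<in> sub c b \<sigma> \<longleftrightarrow> e \<in> \<sigma> \<and> e \<in> edges (bx c b)" for e
    unfolding sub_def using edges_sub edges_subset sE by blast
  have inV: "e \<in> V c \<and> e' \<in> V c" if "e \<in> edges (bx a c)" "e' \<in> edges (bx c b)" "seg e \<inter> seg e' \<noteq> {}" for e e'
  proof -
    obtain x y where "(x, y) \<in> seg e" "(x, y) \<in> seg e'" using \<open>seg e \<inter> seg e' \<noteq> {}\<close> by auto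
    thus ?thesis using seg_in_strip[OF that(1)] seg_in_strip[OF that(2)] by (meson order_antisym)
  qed
  show "sub a c \<sigma> \<in> TR a c" unfolding TR_def tri_def mem_Collect_eq
  proof (intro conjI ballI)
    fix e assume e: "e \<in> edges (bx a c) - sub a c \<sigma>"
    hence "e \<notin> \<sigma>" using e1 by blast
    then obtain e' where e': "e' \<in> \<sigma>" "seg e \<inter> seg e' \<noteq> {}" using mx e m1 by blast
    have "e' \<in> edges (bx a c)" using side[OF e'(1)] inV[of e e'] e e'(2) V \<open>e \<notin> \<sigma>\<close> by blast
    thus "\<exists>e'\<in>sub a c \<sigma>. seg e \<inter> seg e' \<noteq> {}" using e' e1 by blast
  qed (use e1 cl in \<open>auto simp: clique_def\<close>)
  show "sub c b \<sigma> \<in> TR c b" unfolding TR_def tri_def mem_Collect_eq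
  proof (intro conjI ballI)
    fix e assume e: "e \<in> edges (bx c b) - sub c b \<sigma>"
    hence "e \<notin> \<sigma>" using e2 by blast
    then obtain e' where e': "e' \<in> \<sigma>" "seg e \<inter> seg e' \<noteq> {}" using mx e m1 by blast
    have "seg e' \<inter> seg e \<noteq> {}" using e'(2) by (simp add: Int_commute)
    hence "e' \<in> edges (bx c b)" using side[OF e'(1)] inV[of e' e] e V \<open>e \<notin> \<sigma>\<close> by blast
    thus "\<exists>e'\<in>sub c b \<sigma>. seg e \<inter> seg e' \<noteq> {}" using e' e2 by blast
  qed (use e2 cl in \<open>auto simp: clique_def\<close>)
  show "\<sigma> = sub a c \<sigma> \<union> sub c b \<sigma>" using e1 e2 side by blast
  show "sub a c \<sigma> \<inter> sub c b \<sigma> = V c"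
  proof
    show "V c \<subseteq> sub a c \<sigma> \<inter> sub c b \<sigma>" using V V_sub[of a c c] V_sub[of c c b] ac unfolding sub_def by blast
    show "sub a c \<sigma> \<inter> sub c b \<sigma> \<subseteq> V c" using e1 e2 edges_both by blast
  qed
qed

text \<open>The halves agree on the common column because boundary columns are always present
  (\<open>V_left\<close>, \<open>V_right\<close>).\<close>

lemma glue_TR:
  assumes s1: "\<sigma>1 \<in> TR a c" and s2: "\<sigma>2 \<in> TR c b" and ac: "a \<le> c" "c \<le> b"
  shows "\<sigma>1 \<union> \<sigma>2 \<in> TR a b" "V c \<subseteq> \<sigma>1 \<union> \<sigma>2" "sub a c (\<sigma>1 \<union> \<sigma>2) = \<sigma>1" "sub c b (\<sigma>1 \<union> \<sigma>2) = \<sigma>2"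
proof -
  have E: "\<sigma>1 \<subseteq> edges (bx a c)" "\<sigma>2 \<subseteq> edges (bx c b)" and cl: "clique \<sigma>1" "clique \<sigma>2" using TR_D s1 s2 by auto
  have V1: "V c \<subseteq> \<sigma>1" "V c \<subseteq> \<sigma>2" using V_right[OF s1 ac(1)] V_left[OF s2 ac(2)] by auto
  have m1: "edges (bx a c) \<subseteq> edges (bx a b)" "edges (bx c b) \<subseteq> edges (bx a b)" using ac by (intro edges_mono bx_mono order_refl; simp)+
  have inV: "e \<in> V c \<and> e' \<in> V c" if "e \<in> edges (bx a c)" "e' \<in> edges (bx c b)" "seg e \<inter> seg e' \<noteq> {}" for e e'
  proof -
    obtain x y where "(x, y) \<in> seg e" "(x, y) \<in> seg e'" using \<open>seg e \<inter> seg e' \<noteq> {}\<close> by auto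
    thus ?thesis using seg_in_strip[OF that(1)] seg_in_strip[OF that(2)] by (meson order_antisym)
  qed
  have c12: "seg e \<inter> seg e' = {}" if "e \<in> \<sigma>1" "e' \<in> \<sigma>2" "e \<noteq> e'" for e e'
  proof (rule ccontr)
    assume n: "seg e \<inter> seg e' \<noteq> {}"
    hence "e \<in> V c \<and> e' \<in> V c" using inV[of e e'] that E by blast
    hence "e \<in> \<sigma>1" "e' \<in> \<sigma>1" using V1 by auto
    thus False using cl(1) n that(3) unfolding clique_def by blast
  qed
  show "V c \<subseteq> \<sigma>1 \<union> \<sigma>2" using V1 by blast
  show "sub a c (\<sigma>1 \<union> \<sigma>2) = \<sigma>1"
    unfolding sub_def using E V1 edges_subset edges_sub edges_both by blast
  show "sub c b (\<sigma>1 \<union> \<sigma>2) = \<sigma>2"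
    unfolding sub_def using E V1 edges_subset edges_sub edges_both by blast
  show "\<sigma>1 \<union> \<sigma>2 \<in> TR a b" unfolding TR_def tri_def mem_Collect_eq
  proof (intro conjI ballI)
    show "\<sigma>1 \<union> \<sigma>2 \<subseteq> edges (bx a b)" using E m1 by blast
    show "clique (\<sigma>1 \<union> \<sigma>2)" unfolding clique_def
    proof (intro ballI impI)
      fix e e' assume h: "e \<in> \<sigma>1 \<union> \<sigma>2" "e' \<in> \<sigma>1 \<union> \<sigma>2" "e \<noteq> e'"
      show "seg e \<inter> seg e' = {}"
      proof (cases "e \<in> \<sigma>1")
        case True
        thus ?thesis using h c12[of e e'] cl(1) unfolding clique_def by (metis UnE)
      next
        case False
        hence "e \<in> \<sigma>2" using h by blast
        thus ?thesis using h c12[of e' e] cl(2) unfolding clique_def by (metis UnE Int_commute)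
      qed
    qed
    fix e assume e: "e \<in> edges (bx a b) - (\<sigma>1 \<union> \<sigma>2)"
    show "\<exists>e'\<in>\<sigma>1 \<union> \<sigma>2. seg e \<inter> seg e' \<noteq> {}"
    proof (rule ccontr)
      assume n: "\<not> ?thesis"
      hence "e \<in> edges (bx a c) \<or> e \<in> edges (bx c b)"
        using V1 e ac by (intro edge_side) auto
      moreover have "\<And>e. e \<in> edges (bx a c) \<Longrightarrow> e \<notin> \<sigma>1 \<Longrightarrow> \<exists>e'\<in>\<sigma>1. seg e \<inter> seg e' \<noteq> {}"
        "\<And>e. e \<in> edges (bx c b) \<Longrightarrow> e \<notin> \<sigma>2 \<Longrightarrow> \<exists>e'\<in>\<sigma>2. seg e \<inter> seg e' \<noteq> {}"
        using s1 s2 unfolding TR_def tri_def by blast+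
      ultimately show False using n e by blast
    qed
  qed
qed

lemma split_sum:
  fixes g h :: "edge set \<Rightarrow> real"
  assumes ac: "a \<le> c" "c \<le> b"
  shows "(\<Sum>\<sigma> | \<sigma> \<in> TR a b \<and> V c \<subseteq> \<sigma>. g (sub a c \<sigma>) * h (sub c b \<sigma>)) = sum g (TR a c) * sum h (TR c b)"
proof -
  have "sum g (TR a c) * sum h (TR c b) = (\<Sum>(\<sigma>1, \<sigma>2)\<in>TR a c \<times> TR c b. g \<sigma>1 * h \<sigma>2)"
    by (simp add: sum_product sum.cartesian_product)
  also have "\<dots> = (\<Sum>\<sigma> | \<sigma> \<in> TR a b \<and> V c \<subseteq> \<sigma>. g (sub a c \<sigma>) * h (sub c b \<sigma>))"
  proof (rule sum.reindex_bij_witness[of _ "\<lambda>\<sigma>. (sub a c \<sigma>, sub c b \<sigma>)" "\<lambda>x. fst x \<union> snd x"])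
    fix x assume "x \<in> TR a c \<times> TR c b"
    hence x: "fst x \<in> TR a c" "snd x \<in> TR c b" by auto
    note gl = glue_TR[OF x ac]
    show "(sub a c (fst x \<union> snd x), sub c b (fst x \<union> snd x)) = x" using gl by (simp add: prod_eq_iff)
    show "fst x \<union> snd x \<in> {\<sigma>. \<sigma> \<in> TR a b \<and> V c \<subseteq> \<sigma>}" using gl(1,2) by blast
    show "g (sub a c (fst x \<union> snd x)) * h (sub c b (fst x \<union> snd x)) = (case x of (\<sigma>1, \<sigma>2) \<Rightarrow> g \<sigma>1 * h \<sigma>2)"
      using gl(3,4) by (simp add: case_prod_unfold)
  next
    fix \<sigma> assume "\<sigma> \<in> {\<sigma>. \<sigma> \<in> TR a b \<and> V c \<subseteq> \<sigma>}"
    hence s: "\<sigma> \<in> TR a b" "V c \<subseteq> \<sigma>" by auto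
    note sp = split_TR[OF s(1) ac s(2)]
    show "fst (sub a c \<sigma>, sub c b \<sigma>) \<union> snd (sub a c \<sigma>, sub c b \<sigma>) = \<sigma>" using sp(3) by simp
    show "(sub a c \<sigma>, sub c b \<sigma>) \<in> TR a c \<times> TR c b" using sp(1,2) by simp
  qed
  finally show ?thesis by simp
qed

section \<open>Multiplicative weights and the renewal equation\<close>

definition hW :: "edge set \<Rightarrow> real" where
  "hW \<sigma> = lam powr (real_of_int (weight \<sigma>) - real k)"

lemma hW_pos: "hW \<sigma> > 0" unfolding hW_def using lam by simp

lemma weight_V: "weight (V c) = int k"
proof -
  have inj: "inj_on (\<lambda>j. {(c, j), (c, j + 1)}) {0..<int k}"
    by (rule inj_onI) (auto simp: doubleton_eq_iff)
  show ?thesis unfolding weight_def V_def by (subst sum.reindex[OF inj]) (simp add: len_pair)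
qed

text \<open>The common column is counted in both halves. Its total length is \<open>k\<close>, and
  the \<open>k\<close> subtracted in the exponent of \<open>hW\<close> compensates exactly.\<close>

lemma hW_split:
  assumes s: "\<sigma> \<in> TR a b" and ac: "a \<le> c" "c \<le> b" and V: "V c \<subseteq> \<sigma>"
  shows "hW \<sigma> = hW (sub a c \<sigma>) * hW (sub c b \<sigma>)"
proof -
  note sp = split_TR[OF assms]
  have f: "finite (sub a c \<sigma>)" "finite (sub c b \<sigma>)" using finite_mem_TR sp(1,2) by auto
  have "weight (sub a c \<sigma> \<union> sub c b \<sigma>) + weight (sub a c \<sigma> \<inter> sub c b \<sigma>) = weight (sub a c \<sigma>) + weight (sub c b \<sigma>)"
    unfolding weight_def using sum.union_inter[OF f] .
  hence "weight \<sigma> + int k = weight (sub a c \<sigma>) + weight (sub c b \<sigma>)"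
    unfolding sp(3)[symmetric] sp(4) weight_V .
  hence "real_of_int (weight \<sigma>) + real k = real_of_int (weight (sub a c \<sigma>)) + real_of_int (weight (sub c b \<sigma>))"
    by (metis of_int_add of_int_of_nat_eq)
  hence "real_of_int (weight \<sigma>) - real k = (real_of_int (weight (sub a c \<sigma>)) - real k) + (real_of_int (weight (sub c b \<sigma>)) - real k)"
    by simp
  thus ?thesis unfolding hW_def by (simp only: powr_add)
qed

lemma split_sum_hW:
  fixes g h :: "edge set \<Rightarrow> real"
  assumes ac: "a \<le> c" "c \<le> b"
  shows "(\<Sum>\<sigma> | \<sigma> \<in> TR a b \<and> V c \<subseteq> \<sigma>. g (sub a c \<sigma>) * h (sub c b \<sigma>) * hW \<sigma>) =
    (\<Sum>\<sigma>\<in>TR a c. g \<sigma> * hW \<sigma>) * (\<Sum>\<sigma>\<in>TR c b. h \<sigma> * hW \<sigma>)"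
  unfolding split_sum[OF ac, symmetric]
  by (rule sum.cong) (use hW_split[OF _ ac] in auto)

definition shs :: "int \<Rightarrow> edge set \<Rightarrow> edge set" where "shs t \<sigma> = (`) (shiftx t) ` \<sigma>"

lemma shiftx_shiftx [simp]: "shiftx s (shiftx t p) = shiftx (s + t) p" by (simp add: shiftx_def)
lemma shiftx_0 [simp]: "shiftx 0 p = p" by (simp add: shiftx_def)

lemma shs_shs [simp]: "shs s (shs t \<sigma>) = shs (s + t) \<sigma>" by (simp add: shs_def image_image)
lemma shs_0 [simp]: "shs 0 \<sigma> = \<sigma>" by (simp add: shs_def)

lemma shs_TR: "\<sigma> \<in> TR a b \<Longrightarrow> shs t \<sigma> \<in> TR (a + t) (b + t)"
  unfolding TR_def bx_def mem_Collect_eq shs_def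
  using amap_tri[OF amap_shiftx, of "rect a b 0 (int k)" \<sigma> t] by (simp add: shiftx_rect)

lemma shs_V: "shs t (V c) = V (c + t)"
  by (simp add: shs_def V_def image_image shiftx_def)

lemma shs_subset: "shs t \<sigma> \<subseteq> shs t \<tau> \<longleftrightarrow> \<sigma> \<subseteq> \<tau>"
proof
  assume "shs t \<sigma> \<subseteq> shs t \<tau>"
  hence "shs (-t) (shs t \<sigma>) \<subseteq> shs (-t) (shs t \<tau>)" unfolding shs_def by (rule image_mono)
  thus "\<sigma> \<subseteq> \<tau>" by simp
qed (simp add: shs_def image_mono)

lemma V_shs: "V c \<subseteq> shs t \<sigma> \<longleftrightarrow> V (c - t) \<subseteq> \<sigma>"
  using shs_subset[of t "V (c - t)" \<sigma>] by (simp add: shs_V)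

lemma hW_shs: "\<sigma> \<in> TR a b \<Longrightarrow> hW (shs t \<sigma>) = hW \<sigma>"
proof -
  assume s: "\<sigma> \<in> TR a b"
  have inj: "inj_on ((`) (shiftx t)) \<sigma>"
    by (rule inj_on_inverseI[of _ "(`) (shiftx (-t))"]) (simp add: image_image)
  have "len (shiftx t ` e) = len e" if "e \<in> \<sigma>" for e
  proof -
    have "e \<in> edges (bx a b)" using TR_D[OF s] that by blast
    then obtain p q where "e = {p, q}" "p \<noteq> q" unfolding edges_def by blast
    thus ?thesis by (simp add: len_pair shiftx_def prod_eq_iff)
  qed
  hence "weight (shs t \<sigma>) = weight \<sigma>"
    unfolding weight_def shs_def by (simp add: sum.reindex[OF inj])
  thus ?thesis unfolding hW_def by simp
qed

lemma shift_sum: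
  fixes g :: "edge set \<Rightarrow> real"
  shows "(\<Sum>\<sigma>\<in>TR (a + t) (b + t). g \<sigma> * hW \<sigma>) = (\<Sum>\<sigma>\<in>TR a b. g (shs t \<sigma>) * hW \<sigma>)"
proof -
  have m: "shs (- t) \<sigma> \<in> TR a b" if "\<sigma> \<in> TR (a + t) (b + t)" for \<sigma>
    using shs_TR[OF that, of "-t"] by simp
  show ?thesis
    by (rule sum.reindex_bij_witness[of _ "shs t" "shs (-t)"])
       (use shs_TR[of _ a b t] m hW_shs[of _ "a + t" "b + t" "-t"] in auto)
qed

definition irr :: "int \<Rightarrow> int \<Rightarrow> edge set \<Rightarrow> bool" where
  "irr a b \<sigma> \<longleftrightarrow> (\<forall>c. a < c \<and> c < b \<longrightarrow> \<not> V c \<subseteq> \<sigma>)"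

definition Zs :: "nat \<Rightarrow> real" where "Zs m = (\<Sum>\<sigma>\<in>TR 0 (int m). hW \<sigma>)"

text \<open>Width 0 is set to 0 by hand: such a strip has no interior column and would otherwise
  count as irreducible.\<close>

definition fs :: "nat \<Rightarrow> real" where
  "fs m = (if m = 0 then 0 else (\<Sum>\<sigma>\<in>TR 0 (int m). of_bool (irr 0 (int m) \<sigma>) * hW \<sigma>))"

lemma Z_shift: "a \<le> b \<Longrightarrow> (\<Sum>\<sigma>\<in>TR a b. hW \<sigma>) = Zs (nat (b - a))"
  using shift_sum[where g = "\<lambda>_. 1" and a = 0 and b = "b - a" and t = a] unfolding Zs_def by simp

lemma irr_shs: "irr (a + t) (b + t) (shs t \<sigma>) \<longleftrightarrow> irr a b \<sigma>"
proof -
  have "(\<forall>c. a + t < c \<and> c < b + t \<longrightarrow> \<not> V (c - t) \<subseteq> \<sigma>) \<longleftrightarrow> (\<forall>c. a < c \<and> c < b \<longrightarrow> \<not> V c \<subseteq> \<sigma>)"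
    by (metis add_diff_cancel_right' add_less_cancel_right diff_add_cancel)
  thus ?thesis unfolding irr_def V_shs .
qed

lemma f_shift: "a < b \<Longrightarrow> (\<Sum>\<sigma>\<in>TR a b. of_bool (irr a b \<sigma>) * hW \<sigma>) = fs (nat (b - a))"
  using shift_sum[where g = "\<lambda>\<sigma>. of_bool (irr a b \<sigma>)" and a = 0 and b = "b - a" and t = a]
    irr_shs[of 0 a "b - a"] unfolding fs_def by simp

lemma fs_nonneg: "fs m \<ge> 0"
  unfolding fs_def using hW_pos by (auto intro!: sum_nonneg simp: less_imp_le)

lemma Zs_pos: "Zs m > 0"
  unfolding Zs_def using hW_pos TR_nonempty by (intro sum_pos) auto

lemma fs_le_Zs: "fs m \<le> Zs m"
proof -
  have "fs m \<le> (\<Sum>\<sigma>\<in>TR 0 (int m). hW \<sigma>)"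
  proof (cases "m = 0")
    case True
    thus ?thesis unfolding fs_def using hW_pos by (simp add: sum_nonneg less_imp_le)
  next
    case False
    have "of_bool (irr 0 (int m) \<sigma>) * hW \<sigma> \<le> hW \<sigma>" for \<sigma> using hW_pos[of \<sigma>] by simp
    thus ?thesis unfolding fs_def using False by (simp only: if_False) (rule sum_mono)
  qed
  thus ?thesis unfolding Zs_def .
qed

lemma fs_1: "fs 1 > 0"
proof -
  have "irr 0 (int 1) \<sigma>" for \<sigma> unfolding irr_def by auto
  hence "fs 1 = Zs 1" unfolding fs_def Zs_def by simp
  thus ?thesis using Zs_pos by simp
qed

lemma Zs_0: "Zs 0 = 1"
proof -
  have "\<sigma> = V 0" if s: "\<sigma> \<in> TR 0 0" for \<sigma>
    using V_left[OF s] TR_D[OF s] edges_both[of _ 0 0 0] by blast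
  moreover obtain \<sigma> where "\<sigma> \<in> TR 0 0" using TR_nonempty by blast
  ultimately have "TR 0 0 = {V 0}" by blast
  thus ?thesis unfolding Zs_def hW_def using weight_V lam by simp
qed

text \<open>Cut at the first column present to the right of 0; one exists because the right boundary
  column always is. The piece before it is irreducible and the rest is free.\<close>

lemma renewal:
  assumes "m \<ge> 1"
  shows "Zs m = (\<Sum>j = 1..m. fs j * Zs (m - j))"
proof -
  define A where "A c = {\<sigma> \<in> TR 0 (int m). V (int c) \<subseteq> \<sigma> \<and> irr 0 (int c) (sub 0 (int c) \<sigma>)}" for c :: nat
  have irs: "irr 0 (int c) (sub 0 (int c) \<sigma>) \<longleftrightarrow> (\<forall>d. 0 < d \<and> d < int c \<longrightarrow> \<not> V d \<subseteq> \<sigma>)" for c :: nat and \<sigma>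
    unfolding irr_def using V_subset_sub by (metis less_imp_le)
  have un: "TR 0 (int m) = (\<Union>c\<in>{1..m}. A c)"
  proof
    show "TR 0 (int m) \<subseteq> (\<Union>c\<in>{1..m}. A c)"
    proof
      fix \<sigma> assume s: "\<sigma> \<in> TR 0 (int m)"
      define c where "c = (LEAST c. c \<ge> 1 \<and> V (int c) \<subseteq> \<sigma>)"
      have ex: "m \<ge> 1 \<and> V (int m) \<subseteq> \<sigma>" using V_right[OF s] assms by simp
      have c: "c \<ge> 1 \<and> V (int c) \<subseteq> \<sigma>" unfolding c_def by (rule LeastI[of _ m]) (rule ex)
      have cm: "c \<le> m" unfolding c_def by (rule Least_le) (rule ex)
      have "\<not> V d \<subseteq> \<sigma>" if d: "0 < d" "d < int c" for d
      proof
        assume "V d \<subseteq> \<sigma>"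
        hence "nat d \<ge> 1 \<and> V (int (nat d)) \<subseteq> \<sigma>" using d by simp
        hence "c \<le> nat d" unfolding c_def by (rule Least_le)
        thus False using d by linarith
      qed
      hence "\<sigma> \<in> A c" unfolding A_def irs using s c by blast
      thus "\<sigma> \<in> (\<Union>c\<in>{1..m}. A c)" using c cm by auto
    qed
    show "(\<Union>c\<in>{1..m}. A c) \<subseteq> TR 0 (int m)" unfolding A_def by blast
  qed
  have disj: "A c \<inter> A d = {}" if "c \<in> {1..m}" "d \<in> {1..m}" "c \<noteq> d" for c d
  proof -
    have "c < d \<or> d < c" using that by auto
    thus ?thesis using that unfolding A_def irs by (auto simp: Suc_le_eq)
  qed
  have "Zs m = (\<Sum>c = 1..m. \<Sum>\<sigma>\<in>A c. hW \<sigma>)"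
    unfolding Zs_def by (subst un, rule sum.UNION_disjoint) (use disj in \<open>auto simp: A_def\<close>)
  also have "\<dots> = (\<Sum>c = 1..m. fs c * Zs (m - c))"
  proof (rule sum.cong[OF refl])
    fix c assume c: "c \<in> {1..m}"
    have "(\<Sum>\<sigma>\<in>A c. hW \<sigma>) = (\<Sum>\<sigma> | \<sigma> \<in> TR 0 (int m) \<and> V (int c) \<subseteq> \<sigma>. of_bool (irr 0 (int c) (sub 0 (int c) \<sigma>)) * 1 * hW \<sigma>)"
      unfolding A_def by (rule sum.mono_neutral_cong_left) auto
    also have "\<dots> = fs c * (\<Sum>\<sigma>\<in>TR (int c) (int m). hW \<sigma>)"
      using split_sum_hW[of 0 "int c" "int m" "\<lambda>\<sigma>. of_bool (irr 0 (int c) \<sigma>)" "\<lambda>_. 1"] c unfolding fs_def by auto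
    also have "(\<Sum>\<sigma>\<in>TR (int c) (int m). hW \<sigma>) = Zs (m - c)"
      using Z_shift[of "int c" "int m"] c by (simp add: nat_diff_distrib)
    finally show "(\<Sum>\<sigma>\<in>A c. hW \<sigma>) = fs c * Zs (m - c)" .
  qed
  finally show ?thesis .
qed

end

section \<open>Energy estimates\<close>

lemma sum_power_dist_le:
  fixes \<mu> :: real
  assumes \<mu>: "0 < \<mu>" "\<mu> < 1" and fin: "finite X"
  shows "(\<Sum>x\<in>X. \<mu> ^ nat \<bar>p - x\<bar>) \<le> 2 / (1 - \<mu>)"
proof -
  have geo: "(\<Sum>x\<in>Y. \<mu> ^ nat \<bar>p - x\<bar>) \<le> 1 / (1 - \<mu>)" if "finite Y" "inj_on (\<lambda>x. nat \<bar>p - x\<bar>) Y" for Y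
  proof -
    have "(\<Sum>x\<in>Y. \<mu> ^ nat \<bar>p - x\<bar>) = (\<Sum>n\<in>(\<lambda>x. nat \<bar>p - x\<bar>) ` Y. \<mu> ^ n)"
      by (simp add: sum.reindex[OF that(2)])
    also have "\<dots> \<le> (\<Sum>n. \<mu> ^ n)" using \<mu> that by (intro sum_le_suminf summable_geometric) auto
    also have "\<dots> = 1 / (1 - \<mu>)" using \<mu> by (intro suminf_geometric) auto
    finally show ?thesis .
  qed
  have "(\<Sum>x\<in>X. \<mu> ^ nat \<bar>p - x\<bar>) = (\<Sum>x\<in>X \<inter> {..p}. \<mu> ^ nat \<bar>p - x\<bar>) + (\<Sum>x\<in>X - {..p}. \<mu> ^ nat \<bar>p - x\<bar>)"
    by (rule sum.Int_Diff[OF fin])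
  also have "\<dots> \<le> 1 / (1 - \<mu>) + 1 / (1 - \<mu>)"
    by (intro add_mono geo) (use fin in \<open>auto simp: inj_on_def\<close>)
  finally show ?thesis by simp
qed

context strip
begin

text \<open>The length of an edge dominates its horizontal extent, so for a fixed endpoint the sum
  over the other is a two-sided geometric series. What matters is that the bound is linear in the
  width.\<close>

lemma sum_edge_powers_le:
  fixes \<mu> :: real
  assumes \<mu>: "0 < \<mu>" "\<mu> < 1" and ab: "a \<le> b"
  shows "(\<Sum>e\<in>edges (bx a b). \<mu> ^ nat (len e)) \<le> (real k + 1)\<^sup>2 * (2 / (1 - \<mu>)) * (real_of_int (b - a) + 1)"
proof -
  let ?B = "bx a b"
  have "edges ?B \<subseteq> (\<lambda>(p, q). {p, q}) ` {(p, q). p \<in> ?B \<and> q \<in> ?B \<and> p \<noteq> q}"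
    unfolding edges_def by auto
  moreover have fin: "finite {(p, q). p \<in> ?B \<and> q \<in> ?B \<and> p \<noteq> q}"
    by (rule finite_subset[of _ "?B \<times> ?B"]) auto
  ultimately have "(\<Sum>e\<in>edges ?B. \<mu> ^ nat (len e)) \<le> (\<Sum>e\<in>(\<lambda>(p, q). {p, q}) ` {(p, q). p \<in> ?B \<and> q \<in> ?B \<and> p \<noteq> q}. \<mu> ^ nat (len e))"
    using \<mu> by (intro sum_mono2) auto
  also have "\<dots> \<le> (\<Sum>(p, q) | p \<in> ?B \<and> q \<in> ?B \<and> p \<noteq> q. \<mu> ^ nat (len {p, q}))"
    using \<mu> fin by (intro order_trans[OF sum_image_le]) (auto simp: case_prod_unfold)
  also have "\<dots> \<le> (\<Sum>(p, q) | p \<in> ?B \<and> q \<in> ?B \<and> p \<noteq> q. \<mu> ^ nat \<bar>fst p - fst q\<bar>)"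
    using \<mu> by (intro sum_mono) (auto simp: len_pair intro!: power_decreasing)
  also have "\<dots> \<le> (\<Sum>(p, q)\<in>?B \<times> ?B. \<mu> ^ nat \<bar>fst p - fst q\<bar>)"
    using \<mu> by (intro sum_mono2) auto
  also have "\<dots> = (\<Sum>p\<in>?B. \<Sum>q\<in>?B. \<mu> ^ nat \<bar>fst p - fst q\<bar>)" by (simp add: sum.cartesian_product)
  also have "\<dots> \<le> (\<Sum>p\<in>?B. (real k + 1) * (2 / (1 - \<mu>)))"
  proof (rule sum_mono)
    fix p
    have "(\<Sum>q\<in>?B. \<mu> ^ nat \<bar>fst p - fst q\<bar>) = (\<Sum>x\<in>{a..b}. \<Sum>y\<in>{0..int k}. \<mu> ^ nat \<bar>fst p - x\<bar>)"
      unfolding bx_def rect_def by (simp only: sum.cartesian_product case_prod_unfold)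
    also have "\<dots> = (real k + 1) * (\<Sum>x\<in>{a..b}. \<mu> ^ nat \<bar>fst p - x\<bar>)" by (simp add: sum_distrib_left add.commute)
    also have "\<dots> \<le> (real k + 1) * (2 / (1 - \<mu>))"
      by (intro mult_left_mono sum_power_dist_le \<mu>) auto
    finally show "(\<Sum>q\<in>?B. \<mu> ^ nat \<bar>fst p - fst q\<bar>) \<le> (real k + 1) * (2 / (1 - \<mu>))" .
  qed
  also have "\<dots> = real (card ?B) * ((real k + 1) * (2 / (1 - \<mu>)))" by simp
  also have "real (card ?B) = (real_of_int (b - a) + 1) * (real k + 1)"
    unfolding bx_def rect_def using ab by (simp add: card_cartesian_product algebra_simps)
  finally show ?thesis by (simp add: power2_eq_square mult_ac)
qed

lemma weight_nonneg: "\<sigma> \<in> TR a b \<Longrightarrow> weight \<sigma> \<ge> 0"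
  unfolding weight_def using TR_D len_nonneg by (intro sum_nonneg) fastforce

lemma power_weight:
  assumes "\<sigma> \<in> TR a b"
  shows "\<mu> ^ nat (weight \<sigma>) = (\<Prod>e\<in>\<sigma>. (\<mu> :: real) ^ nat (len e))"
proof -
  have nn: "len e \<ge> 0" if "e \<in> \<sigma>" for e using TR_D[OF assms] len_nonneg that by fastforce
  have "nat (weight \<sigma>) = (\<Sum>e\<in>\<sigma>. nat (len e))"
  proof -
    have "int (\<Sum>e\<in>\<sigma>. nat (len e)) = (\<Sum>e\<in>\<sigma>. len e)"
      unfolding of_nat_sum by (rule sum.cong) (use nn in auto)
    thus ?thesis unfolding weight_def by linarith
  qed
  thus ?thesis by (simp add: power_sum)
qed

lemma hW_alt: "\<sigma> \<in> TR a b \<Longrightarrow> hW \<sigma> = lam ^ nat (weight \<sigma>) / lam ^ k"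
proof -
  assume s: "\<sigma> \<in> TR a b"
  obtain n where n: "weight \<sigma> = int n" using weight_nonneg[OF s] by (rule nonneg_int_cases)
  have "hW \<sigma> = lam powr real n / lam powr real k"
    unfolding hW_def n of_int_of_nat_eq by (rule powr_diff)
  thus ?thesis unfolding n nat_int using lam by (simp only: powr_realpow)
qed

text \<open>When disjointness is forgotten, the sum over all edge sets is a product of factors
  \<open>1 + \<mu> ^ nat (len e)\<close>; \<open>1 + x \<le> exp x\<close> turns it into the
  exponential of a sum that is linear in the width.\<close>

lemma entropy_bound:
  fixes \<mu> :: real
  assumes \<mu>: "0 < \<mu>" "\<mu> < 1"
  shows "\<exists>c>0. \<forall>m. (\<Sum>\<sigma>\<in>TR 0 (int m). \<mu> ^ nat (weight \<sigma>)) \<le> exp c * exp c ^ m"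
proof (intro exI conjI allI)
  define c where "c = (real k + 1)\<^sup>2 * (2 / (1 - \<mu>))"
  show "c > 0" unfolding c_def using \<mu> by simp
  fix m
  let ?E = "edges (bx 0 (int m))"
  have "(\<Sum>\<sigma>\<in>TR 0 (int m). \<mu> ^ nat (weight \<sigma>)) = (\<Sum>\<sigma>\<in>TR 0 (int m). \<Prod>e\<in>\<sigma>. \<mu> ^ nat (len e))"
    by (rule sum.cong) (auto simp: power_weight)
  also have "\<dots> \<le> (\<Sum>\<sigma>\<in>Pow ?E. \<Prod>e\<in>\<sigma>. \<mu> ^ nat (len e))"
    using \<mu> TR_D by (intro sum_mono2 prod_nonneg) auto
  also have "\<dots> = (\<Prod>e\<in>?E. \<mu> ^ nat (len e) + 1)"
    using prod_add[of ?E "\<lambda>e. \<mu> ^ nat (len e)" "\<lambda>_. 1"] by simp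
  also have "\<dots> \<le> (\<Prod>e\<in>?E. exp (\<mu> ^ nat (len e)))"
  proof (rule prod_mono)
    fix e
    show "0 \<le> \<mu> ^ nat (len e) + 1 \<and> \<mu> ^ nat (len e) + 1 \<le> exp (\<mu> ^ nat (len e))"
      using exp_ge_add_one_self[of "\<mu> ^ nat (len e)"] \<mu> by (simp add: add.commute)
  qed
  also have "\<dots> = exp (\<Sum>e\<in>?E. \<mu> ^ nat (len e))" by (simp add: exp_sum)
  also have "\<dots> \<le> exp (c * (real m + 1))"
    using sum_edge_powers_le[OF \<mu>, of 0 "int m"] unfolding c_def by simp
  also have "\<dots> = exp c * exp c ^ m" by (simp add: exp_of_nat_mult[symmetric] exp_add[symmetric] algebra_simps)
  finally show "(\<Sum>\<sigma>\<in>TR 0 (int m). \<mu> ^ nat (weight \<sigma>)) \<le> exp c * exp c ^ m" .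
qed

lemma Zs_growth: "\<exists>A>0. \<exists>g>0. \<forall>m. Zs m \<le> A * g ^ m"
proof -
  obtain c where c: "c > 0" "\<And>m. (\<Sum>\<sigma>\<in>TR 0 (int m). lam ^ nat (weight \<sigma>)) \<le> exp c * exp c ^ m"
    using entropy_bound[OF lam] by blast
  have "Zs m \<le> exp c / lam ^ k * exp c ^ m" for m
  proof -
    have "Zs m = (\<Sum>\<sigma>\<in>TR 0 (int m). lam ^ nat (weight \<sigma>)) / lam ^ k"
      unfolding Zs_def sum_divide_distrib by (rule sum.cong) (auto simp: hW_alt)
    also have "\<dots> \<le> (exp c * exp c ^ m) / lam ^ k" using c(2) lam by (intro divide_right_mono) auto
    finally show ?thesis by simp
  qed
  thus ?thesis using lam by (intro exI[of _ "exp c / lam ^ k"] exI[of _ "exp c"] conjI) auto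
qed

text \<open>Write \<open>lam = \<mu> * \<mu>\<close>. One power of \<open>\<mu>\<close> is summed by
  \<open>entropy_bound\<close>, the other is at most \<open>\<mu> ^ (C * m)\<close>, and
  \<open>C\<close> is taken so large that it beats the entropy at rate \<theta>.\<close>

lemma large_energy:
  fixes \<theta> :: real
  assumes \<theta>: "\<theta> > 0"
  shows "\<exists>A>0. \<exists>C :: nat. \<forall>m. (\<Sum>\<sigma> | \<sigma> \<in> TR 0 (int m) \<and> weight \<sigma> > int (C * m). hW \<sigma>) \<le> A * \<theta> ^ m"
proof -
  define \<mu> where "\<mu> = sqrt lam"
  have \<mu>: "0 < \<mu>" "\<mu> < 1" and \<mu>2: "\<mu> * \<mu> = lam" unfolding \<mu>_def using lam by auto
  obtain c where c: "c > 0" "\<And>m. (\<Sum>\<sigma>\<in>TR 0 (int m). \<mu> ^ nat (weight \<sigma>)) \<le> exp c * exp c ^ m"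
    using entropy_bound[OF \<mu>] by blast
  obtain C where C: "\<mu> ^ C < \<theta> / exp c" using real_arch_pow_inv[of "\<theta> / exp c" \<mu>] \<theta> \<mu> by auto
  hence C': "\<mu> ^ C * exp c \<le> \<theta>" by (simp add: field_simps)
  have "(\<Sum>\<sigma> | \<sigma> \<in> TR 0 (int m) \<and> weight \<sigma> > int (C * m). hW \<sigma>) \<le> exp c / lam ^ k * \<theta> ^ m" for m
  proof -
    have "(\<Sum>\<sigma> | \<sigma> \<in> TR 0 (int m) \<and> weight \<sigma> > int (C * m). hW \<sigma>)
      \<le> (\<Sum>\<sigma> | \<sigma> \<in> TR 0 (int m) \<and> weight \<sigma> > int (C * m). \<mu> ^ (C * m) / lam ^ k * \<mu> ^ nat (weight \<sigma>))"
    proof (rule sum_mono)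
      fix \<sigma> assume "\<sigma> \<in> {\<sigma>. \<sigma> \<in> TR 0 (int m) \<and> weight \<sigma> > int (C * m)}"
      hence s: "\<sigma> \<in> TR 0 (int m)" and "weight \<sigma> > int (C * m)" by blast+
      hence w: "nat (weight \<sigma>) \<ge> C * m" by linarith
      have "hW \<sigma> = \<mu> ^ nat (weight \<sigma>) * \<mu> ^ nat (weight \<sigma>) / lam ^ k"
      proof -
        have "lam ^ n = \<mu> ^ n * \<mu> ^ n" for n using \<mu>2 power_mult_distrib by metis
        thus ?thesis unfolding hW_alt[OF s] by simp
      qed
      also have "\<dots> \<le> \<mu> ^ (C * m) * \<mu> ^ nat (weight \<sigma>) / lam ^ k"
        using \<mu> w lam by (intro divide_right_mono mult_right_mono power_decreasing) auto
      finally show "hW \<sigma> \<le> \<mu> ^ (C * m) / lam ^ k * \<mu> ^ nat (weight \<sigma>)" by simp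
    qed
    also have "\<dots> \<le> (\<Sum>\<sigma>\<in>TR 0 (int m). \<mu> ^ (C * m) / lam ^ k * \<mu> ^ nat (weight \<sigma>))"
      using \<mu> lam by (intro sum_mono2) auto
    also have "\<dots> = \<mu> ^ (C * m) / lam ^ k * (\<Sum>\<sigma>\<in>TR 0 (int m). \<mu> ^ nat (weight \<sigma>))" by (simp add: sum_distrib_left)
    also have "\<dots> \<le> \<mu> ^ (C * m) / lam ^ k * (exp c * exp c ^ m)" using c(2) \<mu> lam by (intro mult_left_mono) auto
    also have "\<dots> = exp c / lam ^ k * (\<mu> ^ C * exp c) ^ m" by (simp add: power_mult power_mult_distrib)
    also have "\<dots> \<le> exp c / lam ^ k * \<theta> ^ m" using C' \<mu> lam by (intro mult_left_mono power_mono) auto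
    finally show ?thesis .
  qed
  thus ?thesis using lam by (intro exI[of _ "exp c / lam ^ k"] exI[of _ C] conjI) auto
qed

text \<open>The midpoint of \<open>f\<close> lies half a row from \<open>p\<close>, on the side
  towards which \<open>pq\<close> leaves, and by the bound on \<open>t\<close> the edge
  \<open>pq\<close> has not yet reached that height there. The height difference of \<open>f\<close>
  is odd, so \<open>f\<close> does reach the row of \<open>p\<close>. If \<open>f\<close> were
  shorter than \<open>2 * t + 1\<close> it would do so strictly right of \<open>p\<close>, on the
  other side of \<open>pq\<close>, and would cross \<open>pq\<close>.\<close>

lemma edge_near_long_edge:
  assumes s: "\<sigma> \<in> TR a b" and e: "{p, q} \<in> \<sigma>" "fst p < fst q"
    and dy: "snd q = snd p + s * d" "s * s = 1" "d > 0"
    and t: "t \<ge> 0" "d * (2 * t + 1) < fst q - fst p"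
    and f: "f \<in> \<sigma>" "mid f = (2 * (fst p + t) + 1, 2 * snd p + s)"
  shows "2 * t + 1 \<le> len f"
proof (rule ccontr)
  assume short: "\<not> ?thesis"
  have cl: "clique \<sigma>" and E: "\<sigma> \<subseteq> edges (bx a b)" using TR_D[OF s] by auto
  have s1: "s = 1 \<or> s = -1" using dy(2) by (metis zmult_eq_1_iff)
  obtain g0 h0 where gh0: "f = {g0, h0}" "g0 \<noteq> h0" using f(1) E unfolding edges_def by blast
  have sum0: "fst g0 + fst h0 = 2 * (fst p + t) + 1" "snd g0 + snd h0 = 2 * snd p + s"
    using f(2) unfolding gh0(1) mid_pair[OF gh0(2)] by auto
  \<comment> \<open>The ends are named so that, seen in direction \<open>s\<close>, \<open>g\<close>
    lies in the row of \<open>p\<close> or behind it.\<close>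
  obtain g h where gh: "f = {g, h}" "g \<noteq> h" "fst g + fst h = 2 * (fst p + t) + 1" "snd g + snd h = 2 * snd p + s"
      and lo: "s * (snd g - snd p) \<le> 0"
  proof (cases "s * (snd g0 - snd p) \<le> 0")
    case True
    thus thesis using that[of g0 h0] gh0 sum0 by blast
  next
    case False
    hence "s * (snd h0 - snd p) \<le> 0" using s1 sum0 by auto
    thus thesis using that[of h0 g0] gh0 sum0 by (simp add: insert_commute add.commute)
  qed
  define H where "H = s * (snd h - snd g)"
  have H: "H \<ge> 1" unfolding H_def using s1 lo gh(4) by auto
  have dx: "\<bar>fst h - fst g\<bar> < 2 * t + 1" using short gh(2) unfolding gh(1) by (simp add: len_pair)
  define L where "L = real_of_int (fst q - fst p)"
  define T where "T = real_of_int (2 * t + 1)"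
  define S where "S = real_of_int s"
  define G where "G = real_of_int (fst h - fst g)"
  define D where "D = real_of_int d"
  define HH where "HH = real_of_int H"
  have SS: "S * S = 1" unfolding S_def using s1 by auto
  have r: "L > 0" "D > 0" "T > 0" "D * T < L" "\<bar>G\<bar> < T" "HH \<ge> 1"
    unfolding L_def D_def T_def G_def HH_def of_int_mult[symmetric] of_int_abs[symmetric] of_int_less_iff of_int_0_less_iff of_int_1_le_iff
    using e(2) dy(3) t dx H by auto
  have hy: "ry h - ry g = S * HH"
  proof -
    have "snd h - snd g = s * H" unfolding H_def using s1 by auto
    thus ?thesis unfolding S_def HH_def by (metis of_int_diff of_int_mult)
  qed
  have mx: "rx g + rx h = 2 * rx p + T"
  proof -
    have "real_of_int (fst g + fst h) = real_of_int (2 * (fst p + t) + 1)" using gh(3) by simp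
    thus ?thesis unfolding T_def by simp
  qed
  have my: "ry g + ry h = 2 * ry p + S"
  proof -
    have "real_of_int (snd g + snd h) = real_of_int (2 * snd p + s)" using gh(4) by simp
    thus ?thesis unfolding S_def by simp
  qed
  text \<open>Along the half of \<open>f\<close> that points towards the row of \<open>p\<close>, parametrised by \<open>\<tau> \<in> [0, 1/HH]\<close>,
    the side of \<open>e\<close> changes.\<close>
  define X where "X \<tau> = rx p + T / 2 - \<tau> * G / 2" for \<tau>
  define Y where "Y \<tau> = ry p + S / 2 - \<tau> * (S * HH) / 2" for \<tau>
  define F where "F \<tau> = L * (S * (Y \<tau> - ry p)) - D * (X \<tau> - rx p)" for \<tau>
  have SY: "S * (Y \<tau> - ry p) = 1 / 2 - \<tau> * HH / 2" for \<tau>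
  proof -
    have "S * (Y \<tau> - ry p) = (S * S) / 2 - \<tau> * (S * S) * HH / 2" unfolding Y_def by (simp add: algebra_simps)
    thus ?thesis unfolding SS by simp
  qed
  have Flin: "F \<tau> = (L / 2 - D * T / 2) + (D * G / 2 - L * HH / 2) * \<tau>" for \<tau>
    unfolding F_def SY unfolding X_def by (simp add: algebra_simps)
  have affF: "aff F" unfolding aff_def using Flin by blast
  have F0: "F 0 > 0" unfolding Flin using r by simp
  have F1: "F (1 / HH) < 0"
  proof -
    have "F (1 / HH) = D * (G / HH - T) / 2" unfolding Flin using r by (simp add: field_simps)
    moreover have "G / HH < T"
    proof -
      have "G < T * 1" using r by simp
      also have "T * 1 \<le> T * HH" using r by (intro mult_left_mono) auto
      finally show ?thesis using r by (simp add: pos_divide_less_eq)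
    qed
    moreover have "D * (G / HH - T) < 0" using r \<open>G / HH < T\<close> by (simp add: mult_less_0_iff)
    ultimately show ?thesis by (metis divide_neg_pos zero_less_numeral)
  qed
  obtain \<tau> where \<tau>: "min (1 / HH) 0 < \<tau>" "\<tau> < max (1 / HH) 0" "F \<tau> = 0"
    using aff_zero[OF affF F1 F0] by blast
  have \<tau>': "0 < \<tau>" "\<tau> < 1 / HH" using \<tau> r by (auto simp: min_def max_def split: if_splits)
  have \<tau>1: "\<tau> < 1" using \<tau>' r by (smt (verit) divide_le_eq_1)
  have \<tau>H: "\<tau> * HH < 1" using \<tau>' r by (simp add: pos_less_divide_eq)
  have "(X \<tau>, Y \<tau>) \<in> seg {g, h}"
    unfolding seg_param[OF gh(2)]
  proof (intro exI conjI)
    show "0 < (1 - \<tau>) / 2" "(1 - \<tau>) / 2 < 1" using \<tau>' \<tau>1 by auto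
    have "(1 - (1 - \<tau>) / 2) * rx g + (1 - \<tau>) / 2 * rx h = (rx g + rx h) / 2 - \<tau> * (rx h - rx g) / 2"
      by (simp add: field_simps)
    thus "X \<tau> = (1 - (1 - \<tau>) / 2) * rx g + (1 - \<tau>) / 2 * rx h" unfolding X_def mx G_def by simp
    have "(1 - (1 - \<tau>) / 2) * ry g + (1 - \<tau>) / 2 * ry h = (ry g + ry h) / 2 - \<tau> * (ry h - ry g) / 2"
      by (simp add: field_simps)
    thus "Y \<tau> = (1 - (1 - \<tau>) / 2) * ry g + (1 - \<tau>) / 2 * ry h" unfolding Y_def my hy by simp
  qed
  moreover have "(X \<tau>, Y \<tau>) \<in> seg {p, q}"
  proof -
    define v where "v = 1 / 2 - \<tau> * HH / 2"
    have "\<tau> * HH > 0" using \<tau>' r by simp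
    hence v: "0 < v" "v < 1" unfolding v_def using \<tau>H by linarith+
    have SYv: "S * (Y \<tau> - ry p) = v" unfolding SY v_def by simp
    hence Xe: "X \<tau> - rx p = L * v / D" using \<tau>(3) r unfolding F_def by (simp add: field_simps)
    have Yv: "Y \<tau> - ry p = S * v"
    proof -
      have "S * (S * (Y \<tau> - ry p)) = S * v" using SYv by simp
      thus ?thesis unfolding mult.assoc[symmetric] SS by simp
    qed
    have D1: "D \<ge> 1" unfolding D_def using dy(3) by simp
    have qx: "rx q - rx p = L" unfolding L_def by simp
    have qy: "ry q - ry p = S * D" unfolding S_def D_def using dy(1) by simp
    show ?thesis unfolding seg_nonvert[OF e(2)]
    proof (intro conjI)
      show "rx p < X \<tau>" using Xe r v by (smt (verit) divide_pos_pos mult_pos_pos)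
      have "L * v / D < L"
      proof -
        have "L * v < L * 1" using r v by (intro mult_strict_left_mono) auto
        also have "\<dots> \<le> L * D" using r D1 by (intro mult_left_mono) auto
        finally show ?thesis using r by (simp add: pos_divide_less_eq)
      qed
      thus "X \<tau> < rx q" using Xe qx by linarith
      have "S * D * (L * v / D) / L = S * v" using r by simp
      thus "Y \<tau> = hgt p q (X \<tau>)" unfolding hgt_def qx qy Xe using Yv by linarith
    qed
  qed
  \<comment> \<open>Equal edges have equal midpoints, which forces \<open>d = 1\<close> and extent
    \<open>2 * t + 1\<close>, against the bound on \<open>t\<close>.\<close>
  moreover have "{p, q} \<noteq> {g, h}"
  proof
    assume "{p, q} = {g, h}"
    hence "fst p + fst q = fst g + fst h" "snd p + snd q = snd g + snd h" by (auto simp: doubleton_eq_iff)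
    hence "fst q - fst p = 2 * t + 1" "s * d = s" using gh(3,4) dy(1) by auto
    thus False using t(2) s1 by auto
  qed
  hence "seg {p, q} \<inter> seg {g, h} = {}" using cl e(1) f(1) gh(1) unfolding clique_def by simp
  ultimately show False by (metis disjoint_iff)
qed

lemma vertical_step:
  assumes "{p, q} \<in> edges B" "fst p < fst q" "fst q - fst p \<ge> 2"
  shows "snd p \<noteq> snd q"
  using horizontal_edge_unit[OF assms(1,2)] assms(3) by auto

definition long_cross :: "edge set \<Rightarrow> int \<Rightarrow> int \<Rightarrow> bool" where
  "long_cross \<sigma> K a \<longleftrightarrow> (\<exists>p q. {p, q} \<in> \<sigma> \<and> fst p < a \<and> a < fst q \<and> fst q - fst p > K)"

text \<open>The distance to \<open>c\<close> is compared with the length of \<open>f\<close> itself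
  and not with the extent of \<open>pq\<close>. An edge \<open>f\<close> is then counted by only
  about \<open>k * len f\<close> columns, as the double counting in \<open>bad_columns\<close>
  requires.\<close>

lemma long_edge_neighbours:
  assumes s: "\<sigma> \<in> TR a b" and e: "{p, q} \<in> \<sigma>" "fst p < c" "c < fst q" and L: "fst q - fst p \<ge> 8 * int k"
  shows "fst q - fst p \<le> 16 * int k * int (card {f \<in> \<sigma>. \<bar>2 * c - fst (mid f)\<bar> \<le> 8 * int k * len f})"
proof -
  define L where "L = fst q - fst p"
  have pq: "fst p < fst q" using e by simp
  have cl: "clique \<sigma>" and E: "\<sigma> \<subseteq> edges (bx a b)" using TR_D[OF s] by auto
  have mem: "p \<in> bx a b" "q \<in> bx a b" using edges_ends[of p q "bx a b"] e E by auto
  have k1: "int k \<ge> 1" using k by simp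
  have "snd p \<noteq> snd q" using vertical_step[of p q "bx a b"] e E pq assms(5) k1 by auto
  define sg where "sg = sgn (snd q - snd p)"
  define d where "d = \<bar>snd q - snd p\<bar>"
  have dy: "snd q = snd p + sg * d" "sg * sg = 1" "d > 0"
    unfolding sg_def d_def using \<open>snd p \<noteq> snd q\<close> by (auto simp: sgn_mult_abs)
  have dk: "d \<le> int k" unfolding d_def using mem by (auto simp: mem_bx)
  define M where "M = L div (8 * d)"
  have d8: "8 * d > 0" using dy(3) by simp
  have "8 * d \<le> L" using dk L unfolding L_def by simp
  hence "(8 * d) div (8 * d) \<le> M" unfolding M_def using d8 by (intro zdiv_mono1)
  moreover have "(8 * d) div (8 * d) = 1" using d8 by (intro div_self) simp
  ultimately have M1: "M \<ge> 1" by linarith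
  have Mb: "8 * d * M \<le> L" "L < 8 * d * (M + 1)"
  proof -
    have "L = 8 * d * M + L mod (8 * d)" unfolding M_def by (rule mult_div_mod_eq[symmetric])
    moreover have "0 \<le> L mod (8 * d)" "L mod (8 * d) < 8 * d" using d8 by auto
    ultimately show "8 * d * M \<le> L" "L < 8 * d * (M + 1)" unfolding distrib_left by linarith+
  qed
  \<comment> \<open>\<open>L\<close> is about \<open>8 * d * M\<close>. Values of \<open>t\<close>
    between \<open>2 * M\<close> and \<open>3 * M\<close> are small enough for
    \<open>d * (2 * t + 1) < L\<close> and large enough that \<open>len f\<close> exceeds
    \<open>L / (4 * d)\<close>.\<close>
  define T where "T = {2 * M..<3 * M}"
  have ex: "\<exists>f\<in>\<sigma>. mid f = (2 * (fst p + t) + 1, 2 * snd p + sg)" if t: "t \<in> T" for t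
  proof (rule half_column_covered[of a b 0 "int k"])
    show "tri (rect a b 0 (int k)) \<sigma>" using s unfolding TR_def bx_def by simp
    have t': "0 \<le> t" "t < 3 * M" using t M1 unfolding T_def by auto
    have "3 * M \<le> 8 * d * M" using dy(3) M1 by (intro mult_right_mono) auto
    hence tL: "t < L" using t' Mb by linarith
    have r: "a \<le> fst p" "fst q \<le> b" "0 \<le> snd p" "snd p \<le> int k" "0 \<le> snd q" "snd q \<le> int k"
      using mem by (auto simp: mem_bx)
    show "odd (fst (2 * (fst p + t) + 1, 2 * snd p + sg))" by simp
    show "2 * a < fst (2 * (fst p + t) + 1, 2 * snd p + sg)" using r t' by simp
    show "fst (2 * (fst p + t) + 1, 2 * snd p + sg) < 2 * b" using r tL unfolding L_def by simp
    have "sg = 1 \<and> snd p < snd q \<or> sg = -1 \<and> snd q < snd p"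
      unfolding sg_def using \<open>snd p \<noteq> snd q\<close> by (auto simp: sgn_if)
    thus "2 * 0 < snd (2 * (fst p + t) + 1, 2 * snd p + sg)" "snd (2 * (fst p + t) + 1, 2 * snd p + sg) < 2 * int k"
      using r by auto
  qed
  then obtain F where F: "\<And>t. t \<in> T \<Longrightarrow> F t \<in> \<sigma> \<and> mid (F t) = (2 * (fst p + t) + 1, 2 * snd p + sg)" by metis
  have inj: "inj_on F T"
  proof (rule inj_onI)
    fix t t' assume h: "t \<in> T" "t' \<in> T" "F t = F t'"
    have "(2 * (fst p + t) + 1, 2 * snd p + sg) = (2 * (fst p + t') + 1, 2 * snd p + sg)"
      using F[OF h(1)] F[OF h(2)] unfolding h(3) by metis
    thus "t = t'" by simp
  qed
  have sub: "F ` T \<subseteq> {f \<in> \<sigma>. \<bar>2 * c - fst (mid f)\<bar> \<le> 8 * int k * len f}"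
  proof
    fix f assume "f \<in> F ` T"
    then obtain t where t: "t \<in> T" "f = F t" by blast
    have f: "f \<in> \<sigma>" "mid f = (2 * (fst p + t) + 1, 2 * snd p + sg)" using F[OF t(1)] t(2) by auto
    have t': "2 * M \<le> t" "t \<le> 3 * M - 1" using t(1) unfolding T_def by auto
    have "d * (2 * t + 1) \<le> d * (6 * M - 1)" using t' dy(3) by (intro mult_left_mono) auto
    also have "\<dots> < d * (8 * M)" using M1 dy(3) by (intro mult_strict_left_mono) auto
    also have "\<dots> \<le> L" using Mb by (simp add: mult_ac)
    finally have up: "d * (2 * t + 1) < L" .
    have len: "2 * t + 1 \<le> len f"
      by (rule edge_near_long_edge[OF s e(1) pq dy _ _ f]) (use t' M1 up in \<open>auto simp: L_def\<close>)
    have "L < 8 * d * (M + 1)" by (rule Mb)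
    also have "\<dots> \<le> 4 * d * (2 * t + 1)"
    proof -
      have "2 * (M + 1) \<le> 2 * t + 1" using t' M1 by simp
      hence "4 * d * (2 * (M + 1)) \<le> 4 * d * (2 * t + 1)" using dy(3) by (intro mult_left_mono) auto
      thus ?thesis by (simp add: mult_ac)
    qed
    also have "\<dots> \<le> 4 * int k * len f" using dk dy(3) len t' M1 by (intro mult_mono) auto
    finally have Lf: "L < 4 * int k * len f" .
    have "0 \<le> d * (2 * t)" using dy(3) t' M1 by simp
    have "1 * (2 * t + 1) \<le> d * (2 * t + 1)" using dy(3) t' M1 by (intro mult_right_mono) auto
    hence "2 * t + 1 < L" using up by simp
    hence "\<bar>2 * c - fst (mid f)\<bar> \<le> 2 * L" using e(2,3) t' M1 unfolding f(2) L_def by auto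
    thus "f \<in> {f \<in> \<sigma>. \<bar>2 * c - fst (mid f)\<bar> \<le> 8 * int k * len f}" using f(1) Lf by simp
  qed
  have "card T \<le> card {f \<in> \<sigma>. \<bar>2 * c - fst (mid f)\<bar> \<le> 8 * int k * len f}"
    using card_mono[OF _ sub] card_image[OF inj] finite_mem_TR[OF s] by simp
  moreover have "int (card T) = M" unfolding T_def using M1 by simp
  ultimately have MC: "M \<le> int (card {f \<in> \<sigma>. \<bar>2 * c - fst (mid f)\<bar> \<le> 8 * int k * len f})" by linarith
  have "L \<le> 8 * d * (M + 1)" using Mb by simp
  also have "\<dots> \<le> 8 * d * (2 * M)" using dy(3) M1 by (intro mult_left_mono) auto
  also have "\<dots> = d * (16 * M)" by simp
  also have "\<dots> \<le> int k * (16 * int (card {f \<in> \<sigma>. \<bar>2 * c - fst (mid f)\<bar> \<le> 8 * int k * len f}))"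
    using dk dy(3) MC M1 by (intro mult_mono) auto
  finally show ?thesis unfolding L_def by simp
qed

lemma card_even_near: "int (card {a \<in> A. \<bar>2 * a - y\<bar> \<le> R}) \<le> R + 1" if "R \<ge> 0" for A :: "int set"
proof -
  \<comment> \<open>The ceiling of \<open>(y - R) / 2\<close>.\<close>
  define lo where "lo = - ((R - y) div 2)"
  have sub: "{a \<in> A. \<bar>2 * a - y\<bar> \<le> R} \<subseteq> {lo..lo + R}"
  proof
    fix x assume "x \<in> {a \<in> A. \<bar>2 * a - y\<bar> \<le> R}"
    hence "- R \<le> 2 * x - y" "2 * x - y \<le> R" by auto
    thus "x \<in> {lo..lo + R}" unfolding lo_def by auto
  qed
  have "card {a \<in> A. \<bar>2 * a - y\<bar> \<le> R} \<le> card {lo..lo + R}" by (rule card_mono[OF _ sub]) simp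
  thus ?thesis using that by simp
qed

text \<open>Double counting of pairs of a bad column and an edge near it. A bad column has at least
  \<open>K / (16 * k)\<close> such edges, and an edge is near at most
  \<open>8 * k * len f + 1 \<le> 9 * k * len f\<close> columns; \<open>144 = 16 * 9\<close>.\<close>

lemma bad_columns:
  assumes s: "\<sigma> \<in> TR 0 (int m)" and K: "K \<ge> 8 * int k"
  shows "K * int (card {a \<in> {0<..<int m}. long_cross \<sigma> K a}) \<le> 144 * (int k)\<^sup>2 * weight \<sigma>"
proof -
  let ?A = "{a \<in> {0<..<int m}. long_cross \<sigma> K a}"
  let ?R = "\<lambda>a f. \<bar>2 * a - fst (mid f)\<bar> \<le> 8 * int k * len f"
  have finA: "finite ?A" by (rule finite_subset[of _ "{0<..<int m}"]) auto
  have fin: "finite \<sigma>" by (rule finite_mem_TR[OF s])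
  have k1: "int k \<ge> 1" using k by simp
  have cnt: "int (card {x \<in> X. P x}) = (\<Sum>x\<in>X. of_bool (P x))" if "finite X" for X :: "'c set" and P
  proof -
    have "(\<Sum>x\<in>X. of_bool (P x)) = (\<Sum>x\<in>{x \<in> X. P x}. 1 :: int)"
      by (rule sum.mono_neutral_cong_right) (use that in auto)
    thus ?thesis by simp
  qed
  have "K * int (card ?A) = (\<Sum>a\<in>?A. K)" by simp
  also have "\<dots> \<le> (\<Sum>a\<in>?A. 16 * int k * int (card {f \<in> \<sigma>. ?R a f}))"
  proof (rule sum_mono)
    fix a assume "a \<in> ?A"
    then obtain p q where "{p, q} \<in> \<sigma>" "fst p < a" "a < fst q" "fst q - fst p > K" unfolding long_cross_def by blast
    thus "K \<le> 16 * int k * int (card {f \<in> \<sigma>. ?R a f})"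
      using long_edge_neighbours[OF s, of p q a] K by simp
  qed
  also have "\<dots> = 16 * int k * (\<Sum>a\<in>?A. \<Sum>f\<in>\<sigma>. of_bool (?R a f))"
    unfolding cnt[OF fin] by (rule sum_distrib_left[symmetric])
  also have "(\<Sum>a\<in>?A. \<Sum>f\<in>\<sigma>. of_bool (?R a f)) = (\<Sum>f\<in>\<sigma>. \<Sum>a\<in>?A. of_bool (?R a f) :: int)"
    by (rule sum.swap)
  also have "\<dots> \<le> (\<Sum>f\<in>\<sigma>. 9 * int k * len f)"
  proof (rule sum_mono)
    fix f assume "f \<in> \<sigma>"
    hence l: "len f \<ge> 1" using TR_D[OF s] len_nonneg by blast
    have kl: "1 * 1 \<le> int k * len f" using k1 l by (intro mult_mono) auto
    have "(\<Sum>a\<in>?A. of_bool (?R a f) :: int) = int (card {a \<in> ?A. ?R a f})"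
      by (rule cnt[OF finA, symmetric])
    also have "\<dots> \<le> 8 * int k * len f + 1" by (rule card_even_near) (use kl in linarith)
    also have "\<dots> \<le> 9 * int k * len f" using kl by linarith
    finally show "(\<Sum>a\<in>?A. of_bool (?R a f) :: int) \<le> 9 * int k * len f" .
  qed
  also have "16 * int k * (\<Sum>f\<in>\<sigma>. 9 * int k * len f) = 144 * (int k)\<^sup>2 * weight \<sigma>"
    unfolding weight_def sum_distrib_left[symmetric] by (simp add: power2_eq_square)
  finally show ?thesis by (simp add: mult_left_mono)
qed

end

section \<open>Column surgery\<close>

lemma sum_UN_le:
  fixes h :: "'a \<Rightarrow> real"
  assumes "finite Q" "\<And>x. finite (J x)" "\<And>y. h y \<ge> 0"
  shows "sum h (\<Union>x\<in>Q. J x) \<le> (\<Sum>x\<in>Q. sum h (J x))"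
  using assms(1)
proof induction
  case (insert x Q)
  have "sum h (J x \<union> (\<Union>x\<in>Q. J x)) = sum h (J x) + sum h (\<Union>x\<in>Q. J x) - sum h (J x \<inter> (\<Union>x\<in>Q. J x))"
    by (rule sum_Un) (use insert.hyps assms(2) in auto)
  also have "\<dots> \<le> sum h (J x) + sum h (\<Union>x\<in>Q. J x)" using assms(3) by (simp add: sum_nonneg)
  finally show ?case using insert by simp
qed simp

context strip
begin

definition crossers :: "edge set \<Rightarrow> int \<Rightarrow> edge set" where
  "crossers \<sigma> a = {e \<in> \<sigma>. \<exists>p q. e = {p, q} \<and> fst p < a \<and> a < fst q}"

lemma non_crosser_side:
  assumes s: "\<sigma> \<in> TR x y" and e: "e \<in> \<sigma>" "e \<notin> crossers \<sigma> a"
  shows "e \<in> edges (bx x a) \<or> e \<in> edges (bx a y)"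
proof -
  have E: "e \<in> edges (bx x y)" using TR_D[OF s] e by blast
  hence "e \<subseteq> bx x a \<or> e \<subseteq> bx a y"
  proof (cases rule: edges_cases)
    case (1 p q)
    have "\<not> (fst p < a \<and> a < fst q)" using e 1(1) unfolding crossers_def by blast
    thus ?thesis using 1 by (auto simp: mem_bx)
  next
    case (2 p q)
    thus ?thesis by (auto simp: mem_bx)
  qed
  thus ?thesis using edges_sub[OF E] by blast
qed

text \<open>Read off from a triangulation of the degenerate strip \<open>bx a a\<close>, which
  contains the column.\<close>

lemma clique_V: "clique (V a)"
proof -
  obtain \<sigma> where s: "\<sigma> \<in> TR a a" using TR_nonempty by blast
  hence "V a \<subseteq> \<sigma>" "clique \<sigma>" using V_left TR_D by auto
  thus ?thesis unfolding clique_def by blast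
qed

text \<open>Removing the edges across a column and forcing the column only changes edges near it: a new
  edge shares its midpoint with a removed one.\<close>
lemma column_surgery:
  assumes s: "\<sigma> \<in> TR 0 (int m)" and a: "0 < a" "a < int m" and good: "\<not> long_cross \<sigma> K a"
  defines "E \<equiv> edges (bx (a - K) (a + K))"
  shows "\<exists>\<sigma>'\<in>TR 0 (int m). V a \<subseteq> \<sigma>' \<and> \<sigma>' - E = \<sigma> - E"
proof -
  have cl: "clique \<sigma>" and sE: "\<sigma> \<subseteq> edges (bx 0 (int m))" using TR_D[OF s] by auto
  define \<tau> where "\<tau> = (\<sigma> - crossers \<sigma> a) \<union> V a"
  have VE: "V a \<subseteq> edges (bx 0 (int m))" using V_edges[of 0 a "int m"] a by simp
  have sep: "seg e \<inter> seg v = {}" if e: "e \<in> \<sigma> - crossers \<sigma> a" "v \<in> V a" "e \<noteq> v" for e v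
  proof (rule ccontr)
    assume "seg e \<inter> seg v \<noteq> {}"
    then obtain x y where xy: "(x, y) \<in> seg e" "(x, y) \<in> seg v" by auto
    have "v \<in> edges (bx a a)" using V_edges[of a a a] e(2) by auto
    hence "x = real_of_int a" using seg_in_strip(1,2)[OF _ xy(2), of a a] by simp
    hence "e \<in> V a" using non_crosser_side[OF s, of e a] e(1) seg_in_strip(3,4)[OF _ xy(1)] by blast
    thus False using clique_V e(2,3) \<open>seg e \<inter> seg v \<noteq> {}\<close> unfolding clique_def by blast
  qed
  have ct: "clique \<tau>" unfolding clique_def
  proof (intro ballI impI)
    fix e e' assume h: "e \<in> \<tau>" "e' \<in> \<tau>" "e \<noteq> e'"
    consider "e \<in> \<sigma> - crossers \<sigma> a" "e' \<in> \<sigma> - crossers \<sigma> a" | "e \<in> \<sigma> - crossers \<sigma> a" "e' \<in> V a"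
      | "e \<in> V a" "e' \<in> \<sigma> - crossers \<sigma> a" | "e \<in> V a" "e' \<in> V a" using h unfolding \<tau>_def by blast
    thus "seg e \<inter> seg e' = {}"
    proof cases
      case 1 thus ?thesis using cl h(3) unfolding clique_def by simp
    next
      case 2 thus ?thesis using sep h(3) by blast
    next
      case 3
      hence "seg e' \<inter> seg e = {}" using sep[of e' e] h(3) by simp
      thus ?thesis by (simp add: Int_commute)
    next
      case 4 thus ?thesis using clique_V h(3) unfolding clique_def by simp
    qed
  qed
  have "\<tau> \<subseteq> edges (bx 0 (int m))" unfolding \<tau>_def using sE VE by blast
  then obtain \<sigma>' where s': "\<tau> \<subseteq> \<sigma>'" "\<sigma>' \<in> TR 0 (int m)"
    using clique_extend[OF finite_bx _ ct] unfolding TR_def by blast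
  have cl': "clique \<sigma>'" and sE': "\<sigma>' \<subseteq> edges (bx 0 (int m))" using TR_D[OF s'(2)] by auto
  have short: "fst q - fst p \<le> K" if "{p, q} \<in> \<sigma>" "fst p < a" "a < fst q" for p q
    using good that unfolding long_cross_def by (meson not_less)
  have DE: "crossers \<sigma> a \<subseteq> E"
  proof
    fix e assume "e \<in> crossers \<sigma> a"
    then obtain p q where e: "e \<in> \<sigma>" "e = {p, q}" "fst p < a" "a < fst q" unfolding crossers_def by blast
    have eE: "e \<in> edges (bx 0 (int m))" using e(1) sE by blast
    have "e \<subseteq> bx (a - K) (a + K)"
      using edges_subset[OF eE] e(2-4) short[of p q] e(1) by (auto simp: mem_bx)
    thus "e \<in> E" unfolding E_def using edges_sub[OF eE] by blast
  qed
  \<comment> \<open>The shared midpoint is within \<open>K / 2\<close> of column \<open>a\<close>.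
    The new edge cannot cross that column, so it lies on one side of it, and then both ends are
    within \<open>K\<close> of it.\<close>
  have new: "e \<in> E" if e: "e \<in> \<sigma>'" "e \<notin> \<sigma>" for e
  proof -
    have eE: "e \<in> edges (bx 0 (int m))" using e sE' by blast
    obtain d where d: "d \<in> \<sigma>" "mid d = mid e"
      using midpoint_covered[of 0 "int m" 0 "int k" \<sigma> e] s eE unfolding TR_def bx_def by blast
    have "d \<notin> \<sigma>'" using mid_inj[OF cl' sE' _ e(1) d(2)] d(1) e(2) by blast
    hence "d \<in> crossers \<sigma> a" using d(1) s'(1) unfolding \<tau>_def by blast
    then obtain p q where pq: "d = {p, q}" "fst p < a" "a < fst q" unfolding crossers_def by blast
    have md: "fst (mid e) = fst p + fst q" using d(2) mid_pair[of p q] pq by (metis fst_conv less_trans order_less_irrefl)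
    have K: "fst q - fst p \<le> K" using short[of p q] d(1) pq by simp
    have near: "2 * a - K < fst (mid e)" "fst (mid e) < 2 * a + K" using md K pq by auto
    obtain u v where uv: "e = {u, v}" "u \<noteq> v" "u \<in> bx 0 (int m)" "v \<in> bx 0 (int m)" using eE unfolding edges_def by blast
    have muv: "fst (mid e) = fst u + fst v" using mid_pair[OF uv(2)] uv(1) by simp
    have "e \<notin> crossers \<sigma>' a"
    proof
      assume "e \<in> crossers \<sigma>' a"
      then obtain p q where e': "e = {p, q}" "fst p < a" "a < fst q" unfolding crossers_def by blast
      have "{p, q} \<in> edges (bx 0 (int m))" using eE e'(1) by simp
      then obtain w where w: "w \<in> V a" "seg e \<inter> seg w \<noteq> {}" using cross_column[of p q 0 "int m" a] e' by blast
      have "w \<in> \<sigma>'" using s'(1) w(1) unfolding \<tau>_def by blast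
      moreover have "e \<noteq> w"
      proof
        assume "e = w"
        then obtain j where "{p, q} = {(a, j), (a, j + 1)}" using w(1) e'(1) unfolding V_def by auto
        thus False using e' by (auto simp: doubleton_eq_iff)
      qed
      ultimately show False using cl' e(1) w(2) unfolding clique_def by blast
    qed
    hence "e \<in> edges (bx 0 a) \<or> e \<in> edges (bx a (int m))" by (rule non_crosser_side[OF s'(2) e(1)])
    hence "e \<subseteq> bx 0 a \<or> e \<subseteq> bx a (int m)" using edges_subset by blast
    hence "e \<subseteq> bx (a - K) (a + K)" using near muv uv by (auto simp: mem_bx)
    thus ?thesis unfolding E_def using edges_sub[OF eE] by blast
  qed
  have "\<sigma>' - E = \<sigma> - E"
  proof
    show "\<sigma>' - E \<subseteq> \<sigma> - E" using new by blast
    show "\<sigma> - E \<subseteq> \<sigma>' - E" using DE s'(1) unfolding \<tau>_def by blast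
  qed
  moreover have "V a \<subseteq> \<sigma>'" using s'(1) unfolding \<tau>_def by blast
  ultimately show ?thesis using s'(2) by blast
qed

text \<open>Crude counting of subsets of the point set: all that matters is that the bounds depend
  on \<open>K\<close> and \<open>k\<close> only.\<close>

lemma local_edges_bounds:
  assumes "K \<ge> 0"
  defines "N \<equiv> 2 ^ (nat (2 * K + 1) * (k + 1))"
  shows "card (edges (bx (a - K) (a + K))) \<le> N" "S \<subseteq> edges (bx (a - K) (a + K)) \<Longrightarrow> weight S \<le> int N * (2 * K + int k)"
proof -
  let ?B = "bx (a - K) (a + K)"
  have cB: "card ?B = nat (2 * K + 1) * (k + 1)" unfolding bx_def rect_def by (simp add: card_cartesian_product nat_add_distrib)
  have "edges ?B \<subseteq> Pow ?B" using edges_subset by blast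
  hence "card (edges ?B) \<le> card (Pow ?B)" by (intro card_mono) auto
  thus c: "card (edges ?B) \<le> N" unfolding N_def by (simp add: card_Pow cB)
  assume S: "S \<subseteq> edges ?B"
  have l: "len e \<le> 2 * K + int k" if "e \<in> S" for e
  proof -
    have "e \<in> edges ?B" using that S by blast
    then obtain p q where pq: "e = {p, q}" "p \<noteq> q" "p \<in> ?B" "q \<in> ?B" unfolding edges_def by blast
    thus ?thesis by (auto simp: len_pair mem_bx)
  qed
  have "weight S \<le> of_nat (card S) * (2 * K + int k)" unfolding weight_def by (rule sum_bounded_above) (rule l)
  also have "\<dots> \<le> int N * (2 * K + int k)"
  proof (rule mult_right_mono)
    have "card S \<le> card (edges ?B)" using S by (intro card_mono) auto
    thus "int (card S) \<le> int N" using c by simp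
  qed (use assms in auto)
  finally show "weight S \<le> int N * (2 * K + int k)" .
qed

text \<open>Outside \<open>E\<close> the lengths agree, and the edges lost inside \<open>E\<close>
  have nonnegative length. Only the new edges can raise the energy, by at most
  \<open>w\<close>.\<close>

lemma local_change_hW:
  assumes s: "\<sigma> \<in> TR 0 (int m)" "\<sigma>' \<in> TR 0 (int m)" and E: "\<sigma>' - E = \<sigma> - E" and w: "weight (\<sigma>' \<inter> E) \<le> w"
  shows "hW \<sigma> \<le> lam powr (- real_of_int w) * hW \<sigma>'"
proof -
  have fin: "finite \<sigma>" "finite \<sigma>'" using finite_mem_TR s by auto
  have sp: "weight \<rho> = weight (\<rho> \<inter> E) + weight (\<rho> - E)" if "finite \<rho>" for \<rho>
    unfolding weight_def by (rule sum.Int_Diff[OF that])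
  have "weight (\<sigma> \<inter> E) \<ge> 0" unfolding weight_def using TR_D[OF s(1)] len_nonneg by (intro sum_nonneg) fastforce
  hence "weight \<sigma>' - w \<le> weight \<sigma>" using sp[OF fin(1)] sp[OF fin(2)] E w by simp
  hence "real_of_int (weight \<sigma>' - w) \<le> real_of_int (weight \<sigma>)" by (simp only: of_int_le_iff)
  hence "real_of_int (weight \<sigma>') - real_of_int w \<le> real_of_int (weight \<sigma>)" by simp
  hence "hW \<sigma> \<le> lam powr (- real_of_int w + (real_of_int (weight \<sigma>') - real k))"
    unfolding hW_def using lam by (intro powr_mono') auto
  thus ?thesis unfolding hW_def powr_add .
qed

text \<open>The first factor counts the configurations on the edges near the column and bounds the
  fibres of the surgery map; the second is the energy cost of the edges put there.\<close>

definition cK :: "int \<Rightarrow> real" where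
  "cK K = 2 ^ (2 ^ (nat (2 * K + 1) * (k + 1))) * lam powr (- real_of_int (2 ^ (nat (2 * K + 1) * (k + 1)) * (2 * K + int k)))"

lemma cK_pos: "cK K > 0" unfolding cK_def using lam by simp

text \<open>The map only forgets the restriction to \<open>E\<close>, so its fibres are bounded. An
  interior column present in the image was absent from the irreducible preimage; it contains a
  changed edge and hence lies within \<open>K\<close> of \<open>a\<close>.\<close>

lemma surgery_sum:
  assumes a: "0 < a" "a < int m" and K: "K \<ge> 0"
  shows "(\<Sum>\<sigma> | \<sigma> \<in> TR 0 (int m) \<and> irr 0 (int m) \<sigma> \<and> \<not> long_cross \<sigma> K a. hW \<sigma>)
    \<le> cK K * (\<Sum>\<sigma> | \<sigma> \<in> TR 0 (int m) \<and> V a \<subseteq> \<sigma> \<and> (\<forall>c. 0 < c \<and> c < int m \<and> V c \<subseteq> \<sigma> \<longrightarrow> \<bar>c - a\<bar> \<le> K). hW \<sigma>)"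
    (is "sum hW ?S \<le> _ * sum hW ?I")
proof -
  define E where "E = edges (bx (a - K) (a + K))"
  define N :: nat where "N = 2 ^ (nat (2 * K + 1) * (k + 1))"
  define w where "w = int N * (2 * K + int k)"
  have cE: "card E \<le> N" unfolding E_def N_def by (rule local_edges_bounds(1)[OF K])
  have wE: "weight S \<le> w" if "S \<subseteq> E" for S
    using that unfolding E_def N_def w_def by (rule local_edges_bounds(2)[OF K])
  have finE: "finite E" unfolding E_def by simp
  have finS: "finite ?S" by (rule finite_subset[OF _ finite_TR]) auto
  have finI: "finite ?I" by (rule finite_subset[OF _ finite_TR]) auto
  define \<phi> where "\<phi> \<sigma> = (SOME \<sigma>'. \<sigma>' \<in> TR 0 (int m) \<and> V a \<subseteq> \<sigma>' \<and> \<sigma>' - E = \<sigma> - E)" for \<sigma>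
  have \<phi>: "\<phi> \<sigma> \<in> TR 0 (int m) \<and> V a \<subseteq> \<phi> \<sigma> \<and> \<phi> \<sigma> - E = \<sigma> - E" if "\<sigma> \<in> ?S" for \<sigma>
  proof -
    have s: "\<sigma> \<in> TR 0 (int m)" "\<not> long_cross \<sigma> K a" using that by blast+
    have "\<exists>\<sigma>'. \<sigma>' \<in> TR 0 (int m) \<and> V a \<subseteq> \<sigma>' \<and> \<sigma>' - E = \<sigma> - E"
      using column_surgery[OF s(1) a s(2)] unfolding E_def by (rule bexE) blast
    thus ?thesis unfolding \<phi>_def by (rule someI_ex)
  qed
  have inI: "\<phi> \<sigma> \<in> ?I" if s: "\<sigma> \<in> ?S" for \<sigma>
  proof -
    have "\<bar>c - a\<bar> \<le> K" if c: "0 < c" "c < int m" "V c \<subseteq> \<phi> \<sigma>" for c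
    proof -
      have "\<not> V c \<subseteq> \<sigma>" using s c unfolding irr_def by blast
      then obtain e where e: "e \<in> V c" "e \<notin> \<sigma>" by blast
      hence "e \<in> E" using \<phi>[OF s] c(3) by blast
      hence "e \<subseteq> bx (a - K) (a + K)" unfolding E_def by (rule edges_subset)
      moreover obtain j where "e = {(c, j), (c, j + 1)}" using e(1) unfolding V_def by blast
      ultimately show ?thesis by (auto simp: mem_bx)
    qed
    thus ?thesis using \<phi>[OF s] by blast
  qed
  have fib: "card {\<sigma> \<in> ?S. \<phi> \<sigma> = y} \<le> 2 ^ N" for y
  proof -
    have "inj_on (\<lambda>\<sigma>. \<sigma> \<inter> E) {\<sigma> \<in> ?S. \<phi> \<sigma> = y}"
    proof (rule inj_onI)
      fix \<sigma> \<rho> assume h: "\<sigma> \<in> {\<sigma> \<in> ?S. \<phi> \<sigma> = y}" "\<rho> \<in> {\<sigma> \<in> ?S. \<phi> \<sigma> = y}" "\<sigma> \<inter> E = \<rho> \<inter> E"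
      have "\<sigma> - E = \<rho> - E" using \<phi>[of \<sigma>] \<phi>[of \<rho>] h(1,2) by auto
      thus "\<sigma> = \<rho>" using h(3) by blast
    qed
    hence "card {\<sigma> \<in> ?S. \<phi> \<sigma> = y} \<le> card (Pow E)"
      by (rule card_inj_on_le) (use finE in auto)
    also have "\<dots> \<le> 2 ^ N" unfolding card_Pow[OF finE] using cE by (intro power_increasing) auto
    finally show ?thesis .
  qed
  define r where "r = lam powr (- real_of_int w)"
  have r0: "r \<ge> 0" unfolding r_def by simp
  have "sum hW ?S \<le> (\<Sum>\<sigma>\<in>?S. r * hW (\<phi> \<sigma>))"
  proof (rule sum_mono)
    fix \<sigma> assume s: "\<sigma> \<in> ?S"
    show "hW \<sigma> \<le> r * hW (\<phi> \<sigma>)" unfolding r_def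
      by (rule local_change_hW[of _ m _ E]) (use s \<phi>[OF s] wE in auto)
  qed
  also have "\<dots> = (\<Sum>y\<in>\<phi> ` ?S. \<Sum>\<sigma> | \<sigma> \<in> ?S \<and> \<phi> \<sigma> = y. r * hW (\<phi> \<sigma>))"
    by (rule sum.image_gen[OF finS])
  also have "\<dots> = (\<Sum>y\<in>\<phi> ` ?S. real (card {\<sigma> \<in> ?S. \<phi> \<sigma> = y}) * (r * hW y))"
    by (rule sum.cong[OF refl]) simp
  also have "\<dots> \<le> (\<Sum>y\<in>\<phi> ` ?S. 2 ^ N * (r * hW y))"
  proof (rule sum_mono)
    fix y
    have "real (card {\<sigma> \<in> ?S. \<phi> \<sigma> = y}) \<le> real (2 ^ N)" using fib[of y] by (simp only: of_nat_le_iff)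
    hence "real (card {\<sigma> \<in> ?S. \<phi> \<sigma> = y}) \<le> 2 ^ N" by simp
    thus "real (card {\<sigma> \<in> ?S. \<phi> \<sigma> = y}) * (r * hW y) \<le> 2 ^ N * (r * hW y)"
      using r0 hW_pos[of y] by (intro mult_right_mono) auto
  qed
  also have "\<dots> \<le> (\<Sum>y\<in>?I. 2 ^ N * (r * hW y))"
    by (rule sum_mono2[OF finI]) (use inI r0 hW_pos in \<open>auto simp: less_imp_le\<close>)
  also have "\<dots> = 2 ^ N * r * sum hW ?I" by (simp add: sum_distrib_left mult.assoc)
  also have "2 ^ N * r = cK K" unfolding cK_def r_def w_def N_def by simp
  finally show ?thesis .
qed

section \<open>From a forced column to a convolution of \<open>fs\<close>\<close>

lemma two_column_sum:
  assumes b: "0 < b" "b \<le> b'" "b' < m"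
  shows "(\<Sum>\<sigma> | \<sigma> \<in> TR 0 (int m) \<and> V (int b) \<subseteq> \<sigma> \<and> V (int b') \<subseteq> \<sigma> \<and>
      irr 0 (int b) (sub 0 (int b) \<sigma>) \<and> irr (int b') (int m) (sub (int b') (int m) \<sigma>). hW \<sigma>)
    = fs b * (Zs (b' - b) * fs (m - b'))"
proof -
  let ?h = "\<lambda>\<sigma>. of_bool (V (int b') \<subseteq> \<sigma> \<and> irr (int b') (int m) (sub (int b') (int m) \<sigma>)) :: real"
  have ss: "sub (int b') (int m) (sub (int b) (int m) \<sigma>) = sub (int b') (int m) \<sigma>" for \<sigma>
    unfolding sub_def using bx_mono[of "int b" "int b'" "int m" "int m"] b by auto
  have "(\<Sum>\<sigma> | \<sigma> \<in> TR 0 (int m) \<and> V (int b) \<subseteq> \<sigma> \<and> V (int b') \<subseteq> \<sigma> \<and>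
      irr 0 (int b) (sub 0 (int b) \<sigma>) \<and> irr (int b') (int m) (sub (int b') (int m) \<sigma>). hW \<sigma>)
    = (\<Sum>\<sigma> | \<sigma> \<in> TR 0 (int m) \<and> V (int b) \<subseteq> \<sigma>. of_bool (irr 0 (int b) (sub 0 (int b) \<sigma>)) * ?h (sub (int b) (int m) \<sigma>) * hW \<sigma>)"
    by (rule sum.mono_neutral_cong_left) (use b in \<open>auto simp: ss V_subset_sub intro: finite_subset[OF _ finite_TR]\<close>)
  also have "\<dots> = fs b * (\<Sum>\<sigma>\<in>TR (int b) (int m). ?h \<sigma> * hW \<sigma>)"
    using split_sum_hW[of 0 "int b" "int m" "\<lambda>\<sigma>. of_bool (irr 0 (int b) \<sigma>)" ?h] b unfolding fs_def by simp
  also have "(\<Sum>\<sigma>\<in>TR (int b) (int m). ?h \<sigma> * hW \<sigma>) =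
    (\<Sum>\<sigma> | \<sigma> \<in> TR (int b) (int m) \<and> V (int b') \<subseteq> \<sigma>. 1 * of_bool (irr (int b') (int m) (sub (int b') (int m) \<sigma>)) * hW \<sigma>)"
    by (rule sum.mono_neutral_cong_right) auto
  also have "\<dots> = (\<Sum>\<sigma>\<in>TR (int b) (int b'). hW \<sigma>) * (\<Sum>\<sigma>\<in>TR (int b') (int m). of_bool (irr (int b') (int m) \<sigma>) * hW \<sigma>)"
    using split_sum_hW[of "int b" "int b'" "int m" "\<lambda>_. 1" "\<lambda>\<sigma>. of_bool (irr (int b') (int m) \<sigma>)"] b by simp
  also have "\<dots> = Zs (b' - b) * fs (m - b')"
    using Z_shift[of "int b" "int b'"] f_shift[of "int b'" "int m"] b by (simp add: nat_diff_distrib)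
  finally show ?thesis .
qed

text \<open>\<open>b\<close> and \<open>b'\<close> are the first and the last interior column
  present. Both lie within \<open>K\<close> of \<open>a\<close>, so the block between them has width
  at most \<open>2 * K\<close>. A union bound over the pairs suffices.\<close>

lemma near_column_sum:
  assumes a: "0 < a" "a < m"
  shows "(\<Sum>\<sigma> | \<sigma> \<in> TR 0 (int m) \<and> V (int a) \<subseteq> \<sigma> \<and> (\<forall>c. 0 < c \<and> c < int m \<and> V c \<subseteq> \<sigma> \<longrightarrow> \<bar>c - int a\<bar> \<le> int K). hW \<sigma>)
    \<le> (\<Sum>(b, b') | 0 < b \<and> b \<le> a \<and> a \<le> b' \<and> b' < m \<and> b' \<le> b + 2 * K. fs b * (Zs (b' - b) * fs (m - b')))"
    (is "sum hW ?I \<le> sum ?G ?Q")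
proof -
  define J where "J x = {\<sigma>. \<sigma> \<in> TR 0 (int m) \<and> V (int (fst x)) \<subseteq> \<sigma> \<and> V (int (snd x)) \<subseteq> \<sigma> \<and>
      irr 0 (int (fst x)) (sub 0 (int (fst x)) \<sigma>) \<and> irr (int (snd x)) (int m) (sub (int (snd x)) (int m) \<sigma>)}" for x :: "nat \<times> nat"
  have finQ: "finite ?Q" by (rule finite_subset[of _ "{..m} \<times> {..m}"]) auto
  have finJ: "finite (J x)" for x unfolding J_def by (rule finite_subset[OF _ finite_TR]) auto
  have "?I \<subseteq> (\<Union>x\<in>?Q. J x)"
  proof
    fix \<sigma> assume s: "\<sigma> \<in> ?I"
    define C where "C = {c. 0 < c \<and> c < m \<and> V (int c) \<subseteq> \<sigma>}"
    have finC: "finite C" unfolding C_def by simp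
    have aC: "a \<in> C" unfolding C_def using s a by simp
    define b where "b = Min C"
    define b' where "b' = Max C"
    have bC: "b \<in> C" "b' \<in> C" unfolding b_def b'_def using finC aC by (auto intro: Min_in Max_in)
    have ba: "b \<le> a" "a \<le> b'" unfolding b_def b'_def using finC aC by auto
    have nK: "int b \<ge> int a - int K" "int b' \<le> int a + int K"
    proof -
      have "\<bar>int c - int a\<bar> \<le> int K" if "c \<in> C" for c using s that unfolding C_def by auto
      from this[OF bC(1)] this[OF bC(2)] show "int b \<ge> int a - int K" "int b' \<le> int a + int K" by linarith+
    qed
    have C_int: "nat c \<in> C" if "0 < c" "c < int m" "V c \<subseteq> \<sigma>" for c using that unfolding C_def by auto
    have "irr 0 (int b) (sub 0 (int b) \<sigma>)" unfolding irr_def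
    proof (intro allI impI notI)
      fix c assume c: "0 < c \<and> c < int b" "V c \<subseteq> sub 0 (int b) \<sigma>"
      have "V c \<subseteq> \<sigma>" using c(2) unfolding sub_def by blast
      hence "nat c \<in> C" using C_int c bC(1) unfolding C_def by auto
      hence "b \<le> nat c" unfolding b_def using finC by simp
      thus False using c(1) by linarith
    qed
    moreover have "irr (int b') (int m) (sub (int b') (int m) \<sigma>)" unfolding irr_def
    proof (intro allI impI notI)
      fix c assume c: "int b' < c \<and> c < int m" "V c \<subseteq> sub (int b') (int m) \<sigma>"
      have "V c \<subseteq> \<sigma>" using c(2) unfolding sub_def by blast
      hence "nat c \<in> C" using C_int c bC(2) unfolding C_def by auto
      hence "nat c \<le> b'" unfolding b'_def using finC by simp
      thus False using c(1) by linarith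
    qed
    ultimately have "\<sigma> \<in> J (b, b')" unfolding J_def using s bC unfolding C_def by simp
    moreover have "(b, b') \<in> ?Q" using bC ba nK unfolding C_def by auto
    ultimately show "\<sigma> \<in> (\<Union>x\<in>?Q. J x)" by blast
  qed
  hence "sum hW ?I \<le> sum hW (\<Union>x\<in>?Q. J x)"
    using finQ finJ hW_pos by (intro sum_mono2) (auto simp: less_imp_le)
  also have "\<dots> \<le> (\<Sum>x\<in>?Q. sum hW (J x))"
    using finQ finJ hW_pos by (intro sum_UN_le) (auto simp: less_imp_le)
  also have "\<dots> = sum ?G ?Q"
  proof (rule sum.cong[OF refl])
    fix x assume x: "x \<in> ?Q"
    obtain b b' where bb: "x = (b, b')" by (cases x)
    show "sum hW (J x) = ?G x"
      using two_column_sum[of b b' m] x unfolding bb J_def by simp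
  qed
  finally show ?thesis .
qed

text \<open>Since \<open>576 = 4 * 144\<close>, at most \<open>m / 4\<close> columns are bad. Of the
  \<open>m - 1\<close> interior columns at least \<open>m / 4\<close> remain as soon as
  \<open>m \<ge> 2\<close>.\<close>

lemma good_columns:
  assumes s: "\<sigma> \<in> TR 0 (int m)" and w: "weight \<sigma> \<le> int (C * m)" and m: "m \<ge> 2"
    and K: "K \<ge> 8 * k" "K \<ge> 576 * k\<^sup>2 * C" "K \<ge> 1"
  shows "real m \<le> 4 * real (card {a \<in> {0<..<m}. \<not> long_cross \<sigma> (int K) (int a)})"
proof -
  let ?bad = "{a \<in> {0<..<m}. long_cross \<sigma> (int K) (int a)}"
  let ?good = "{a \<in> {0<..<m}. \<not> long_cross \<sigma> (int K) (int a)}"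
  have im: "int ` ?bad = {a \<in> {0<..<int m}. long_cross \<sigma> (int K) a}"
  proof (intro set_eqI iffI)
    fix a assume "a \<in> {a \<in> {0<..<int m}. long_cross \<sigma> (int K) a}"
    thus "a \<in> int ` ?bad" by (intro image_eqI[of _ _ "nat a"]) auto
  qed auto
  have cb: "card {a \<in> {0<..<int m}. long_cross \<sigma> (int K) a} = card ?bad"
    unfolding im[symmetric] by (rule card_image) simp
  have "int K * int (card ?bad) \<le> 144 * (int k)\<^sup>2 * weight \<sigma>"
    using bad_columns[OF s, of "int K"] K(1) unfolding cb by simp
  also have "\<dots> \<le> 144 * (int k)\<^sup>2 * int (C * m)" using w by (intro mult_left_mono) auto
  finally have "4 * (int K * int (card ?bad)) \<le> 4 * (144 * (int k)\<^sup>2 * int (C * m))" by linarith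
  also have "\<dots> = int (576 * k\<^sup>2 * C) * int m" by (simp add: mult_ac)
  also have "\<dots> \<le> int K * int m" using K(2) by (intro mult_right_mono) (simp_all only: of_nat_le_iff of_nat_0_le_iff)
  finally have "int K * (4 * int (card ?bad)) \<le> int K * int m" by simp
  hence b: "4 * card ?bad \<le> m" using K(3) by (simp add: mult_le_cancel_left)
  have "{0<..<m} = ?bad \<union> ?good" by auto
  hence "card {0<..<m} \<le> card ?bad + card ?good" by (metis card_Un_le)
  hence "m - 1 \<le> card ?bad + card ?good" by simp
  hence "m \<le> 4 * card ?good" using b m by linarith
  thus ?thesis by simp
qed

text \<open>A pair \<open>(b, b')\<close> occurs once for each \<open>a\<close> between
  \<open>b\<close> and \<open>b'\<close>, at most \<open>D + 1\<close> times. The rest is the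
  substitution \<open>d = b' - b\<close>, \<open>i = b\<close>, \<open>j = m - b'\<close>.\<close>

lemma pair_sum_le:
  fixes F :: "nat \<Rightarrow> real" and Z :: "nat \<Rightarrow> real"
  assumes F: "\<And>i. F i \<ge> 0" and Z: "\<And>d. Z d \<ge> 0" "\<And>d. d \<le> D \<Longrightarrow> Z d \<le> M"
  shows "(\<Sum>a\<in>{0<..<m}. \<Sum>(b, b') | 0 < b \<and> b \<le> a \<and> a \<le> b' \<and> b' < m \<and> b' \<le> b + D. F b * (Z (b' - b) * F (m - b')))
    \<le> (real D + 1) * M * (\<Sum>d\<le>D. \<Sum>(i, j) | i + d + j = m. F i * F j)"
proof -
  define Q where "Q = {(b, b'). 0 < b \<and> b \<le> b' \<and> b' < m \<and> b' \<le> b + D}"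
  define G where "G x = F (fst x) * (Z (snd x - fst x) * F (m - snd x))" for x :: "nat \<times> nat"
  have G0: "G x \<ge> 0" for x unfolding G_def using F Z by simp
  have finQ: "finite Q" unfolding Q_def by (rule finite_subset[of _ "{..m} \<times> {..m}"]) auto
  have M: "M \<ge> 0" using Z(1)[of 0] Z(2)[of 0] by simp
  have "(\<Sum>a\<in>{0<..<m}. \<Sum>(b, b') | 0 < b \<and> b \<le> a \<and> a \<le> b' \<and> b' < m \<and> b' \<le> b + D. F b * (Z (b' - b) * F (m - b')))
    = (\<Sum>a\<in>{0<..<m}. \<Sum>x\<in>Q. of_bool (fst x \<le> a \<and> a \<le> snd x) * G x)"
  proof (rule sum.cong[OF refl])
    fix a
    show "(\<Sum>(b, b') | 0 < b \<and> b \<le> a \<and> a \<le> b' \<and> b' < m \<and> b' \<le> b + D. F b * (Z (b' - b) * F (m - b')))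
      = (\<Sum>x\<in>Q. of_bool (fst x \<le> a \<and> a \<le> snd x) * G x)"
      by (rule sum.mono_neutral_cong_left[OF finQ]) (auto simp: Q_def G_def)
  qed
  also have "\<dots> = (\<Sum>x\<in>Q. \<Sum>a\<in>{0<..<m}. of_bool (fst x \<le> a \<and> a \<le> snd x) * G x)" by (rule sum.swap)
  also have "\<dots> \<le> (\<Sum>x\<in>Q. (real D + 1) * G x)"
  proof (rule sum_mono)
    fix x assume x: "x \<in> Q"
    have "(\<Sum>a\<in>{0<..<m}. of_bool (fst x \<le> a \<and> a \<le> snd x) * G x) \<le> (\<Sum>a\<in>{fst x..snd x}. G x)"
      by (rule order_trans[OF sum_mono2[of "{0<..<m} \<union> {fst x..snd x}"] eq_refl[OF sum.mono_neutral_cong_right]])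
         (use G0 in auto)
    also have "\<dots> = real (Suc (snd x) - fst x) * G x" by simp
    also have "\<dots> \<le> (real D + 1) * G x" using x G0 unfolding Q_def by (intro mult_right_mono) auto
    finally show "(\<Sum>a\<in>{0<..<m}. of_bool (fst x \<le> a \<and> a \<le> snd x) * G x) \<le> (real D + 1) * G x" .
  qed
  also have "\<dots> = (real D + 1) * sum G Q" by (simp add: sum_distrib_left)
  also have "sum G Q \<le> M * (\<Sum>d\<le>D. \<Sum>(i, j) | i + d + j = m. F i * F j)"
  proof -
    let ?S = "SIGMA d:{..D}. {(i, j). i + d + j = m}"
    have fs: "finite {(i, j). i + d + j = m}" for d
      by (rule finite_subset[of _ "{..m} \<times> {..m}"]) auto
    have inj: "inj_on (\<lambda>x. (snd x - fst x, (fst x, m - snd x))) Q"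
      by (rule inj_onI) (auto simp: Q_def)
    have "sum G Q \<le> (\<Sum>x\<in>Q. M * (F (fst x) * F (m - snd x)))"
    proof (rule sum_mono)
      fix x assume "x \<in> Q"
      hence "Z (snd x - fst x) \<le> M" unfolding Q_def by (intro Z(2)) auto
      hence "F (fst x) * (Z (snd x - fst x) * F (m - snd x)) \<le> F (fst x) * (M * F (m - snd x))"
        using F by (intro mult_left_mono mult_right_mono) auto
      thus "G x \<le> M * (F (fst x) * F (m - snd x))" unfolding G_def by (simp add: mult_ac)
    qed
    also have "\<dots> = (\<Sum>y\<in>(\<lambda>x. (snd x - fst x, (fst x, m - snd x))) ` Q. M * (F (fst (snd y)) * F (snd (snd y))))"
      by (simp add: sum.reindex[OF inj])
    also have "\<dots> \<le> (\<Sum>y\<in>?S. M * (F (fst (snd y)) * F (snd (snd y))))"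
      by (rule sum_mono2) (use fs F M in \<open>auto simp: Q_def\<close>)
    also have "\<dots> = M * (\<Sum>y\<in>?S. F (fst (snd y)) * F (snd (snd y)))" by (simp add: sum_distrib_left)
    also have "(\<Sum>y\<in>?S. F (fst (snd y)) * F (snd (snd y))) = (\<Sum>d\<le>D. \<Sum>(i, j) | i + d + j = m. F i * F j)"
      using sum.Sigma[of "{..D}" "\<lambda>d. {(i, j). i + d + j = m}" "\<lambda>d x. F (fst x) * F (snd x)"] fs
      by (simp add: case_prod_unfold)
    finally show ?thesis .
  qed
  finally show ?thesis by (simp add: mult_left_mono mult.assoc)
qed

lemma surgery_inequality:
  "\<exists>c1\<ge>0. \<exists>c2\<ge>0. \<exists>D. \<forall>m. real m * fs m \<le> c1 * (\<Sum>d\<le>D. \<Sum>(i, j) | i + d + j = m. fs i * fs j) + c2 * (fs 1 / 2) ^ m"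
proof -
  \<comment> \<open>A quarter instead of a half leaves a factor \<open>2 ^ m\<close> to absorb the
    factor \<open>m\<close>.\<close>
  have th: "fs 1 / 4 > 0" using fs_1 by simp
  obtain A C where A: "A > 0" and
    AC: "\<And>m. (\<Sum>\<sigma> | \<sigma> \<in> TR 0 (int m) \<and> weight \<sigma> > int (C * m). hW \<sigma>) \<le> A * (fs 1 / 4) ^ m"
    using large_energy[OF th] by blast
  define K where "K = 8 * k + 576 * k\<^sup>2 * C + 1"
  define M where "M = Max (Zs ` {..2 * K})"
  have M: "Zs d \<le> M" if "d \<le> 2 * K" for d unfolding M_def using that by (intro Max_ge) auto
  have M0: "M \<ge> 0" using M[of 0] Zs_pos[of 0] by simp
  define c1 where "c1 = 4 * cK (int K) * ((real (2 * K) + 1) * M)"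
  \<comment> \<open>The summand 2 settles width 1, which has no interior column.\<close>
  define c2 where "c2 = A + 2"
  have c1: "c1 \<ge> 0" unfolding c1_def using cK_pos[of "int K"] M0 by simp
  have "real m * fs m \<le> c1 * (\<Sum>d\<le>2 * K. \<Sum>(i, j) | i + d + j = m. fs i * fs j) + c2 * (fs 1 / 2) ^ m" (is "_ \<le> c1 * ?R + _") for m
  proof -
    have R0: "?R \<ge> 0" by (intro sum_nonneg) (auto simp: fs_nonneg)
    consider "m = 0" | "m = 1" | "m \<ge> 2" by linarith
    thus ?thesis
    proof cases
      case 1
      thus ?thesis using c1 R0 A unfolding c2_def by simp
    next
      case 2
      have "fs 1 \<le> c2 * (fs 1 / 2)" using A fs_1 unfolding c2_def by (simp add: distrib_right)
      thus ?thesis using c1 R0 2 by (simp add: add_increasing)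
    next
      case 3
      define S where "S = {\<sigma>. \<sigma> \<in> TR 0 (int m) \<and> irr 0 (int m) \<sigma>}"
      define Lo where "Lo = {\<sigma> \<in> S. weight \<sigma> \<le> int (C * m)}"
      define Hi where "Hi = {\<sigma>. \<sigma> \<in> TR 0 (int m) \<and> weight \<sigma> > int (C * m)}"
      have fin: "finite S" "finite Lo" "finite Hi" unfolding S_def Lo_def Hi_def by (auto intro: finite_subset[OF _ finite_TR])
      have "fs m = sum hW S" unfolding fs_def S_def using 3
        by (simp, intro sum.mono_neutral_cong_right) auto
      also have "\<dots> \<le> sum hW (Lo \<union> Hi)"
        by (rule sum_mono2) (use fin hW_pos in \<open>auto simp: S_def Lo_def Hi_def less_imp_le\<close>)
      also have "\<dots> \<le> sum hW Lo + sum hW Hi"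
        using sum_Un[OF fin(2,3), of hW] hW_pos by (simp add: sum_nonneg less_imp_le)
      also have "sum hW Hi \<le> A * (fs 1 / 4) ^ m" unfolding Hi_def by (rule AC)
      finally have f1: "real m * fs m \<le> real m * sum hW Lo + real m * (A * (fs 1 / 4) ^ m)"
        by (metis distrib_left mult_left_mono of_nat_0_le_iff add_left_mono)
      have "real m \<le> 2 ^ m" using of_nat_less_two_power[of m, where 'a = real] by simp
      hence "real m * (A * (fs 1 / 4) ^ m) \<le> 2 ^ m * (A * (fs 1 / 4) ^ m)"
        using A fs_1 by (intro mult_right_mono) auto
      also have "\<dots> = A * (2 * (fs 1 / 4)) ^ m" by (simp only: power_mult_distrib mult_ac)
      also have "\<dots> = A * (fs 1 / 2) ^ m" by simp
      also have "\<dots> \<le> c2 * (fs 1 / 2) ^ m" unfolding c2_def using fs_1 by (intro mult_right_mono) auto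
      finally have f2: "real m * (A * (fs 1 / 4) ^ m) \<le> c2 * (fs 1 / 2) ^ m" .
      let ?g = "\<lambda>\<sigma> a. of_bool (\<not> long_cross \<sigma> (int K) (int a)) :: real"
      have "real m * sum hW Lo = (\<Sum>\<sigma>\<in>Lo. real m * hW \<sigma>)" by (rule sum_distrib_left)
      also have "\<dots> \<le> (\<Sum>\<sigma>\<in>Lo. 4 * (\<Sum>a\<in>{0<..<m}. ?g \<sigma> a * hW \<sigma>))"
      proof (rule sum_mono)
        fix \<sigma> assume s: "\<sigma> \<in> Lo"
        have "real m \<le> 4 * real (card {a \<in> {0<..<m}. \<not> long_cross \<sigma> (int K) (int a)})"
          by (rule good_columns[of _ _ C]) (use s 3 in \<open>auto simp: Lo_def S_def K_def\<close>)
        also have "real (card {a \<in> {0<..<m}. \<not> long_cross \<sigma> (int K) (int a)}) = (\<Sum>a\<in>{0<..<m}. ?g \<sigma> a)"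
        proof -
          have "(\<Sum>a\<in>{0<..<m}. ?g \<sigma> a) = (\<Sum>a\<in>{a \<in> {0<..<m}. \<not> long_cross \<sigma> (int K) (int a)}. 1)"
            by (rule sum.mono_neutral_cong_right) auto
          thus ?thesis by simp
        qed
        finally have "real m * hW \<sigma> \<le> 4 * (\<Sum>a\<in>{0<..<m}. ?g \<sigma> a) * hW \<sigma>" using hW_pos[of \<sigma>] by (intro mult_right_mono) auto
        thus "real m * hW \<sigma> \<le> 4 * (\<Sum>a\<in>{0<..<m}. ?g \<sigma> a * hW \<sigma>)" by (simp only: sum_distrib_right mult.assoc)
      qed
      also have "\<dots> = 4 * (\<Sum>a\<in>{0<..<m}. \<Sum>\<sigma>\<in>Lo. ?g \<sigma> a * hW \<sigma>)"
        by (subst sum.swap) (simp only: sum_distrib_left)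
      also have "\<dots> \<le> 4 * (\<Sum>a\<in>{0<..<m}. cK (int K) *
         (\<Sum>(b, b') | 0 < b \<and> b \<le> a \<and> a \<le> b' \<and> b' < m \<and> b' \<le> b + 2 * K. fs b * (Zs (b' - b) * fs (m - b'))))"
      proof (intro mult_left_mono sum_mono)
        fix a assume a: "a \<in> {0<..<m}"
        have "(\<Sum>\<sigma>\<in>Lo. ?g \<sigma> a * hW \<sigma>) \<le> (\<Sum>\<sigma>\<in>S. ?g \<sigma> a * hW \<sigma>)"
          by (rule sum_mono2[OF fin(1)]) (use hW_pos in \<open>auto simp: Lo_def less_imp_le\<close>)
        also have "\<dots> = (\<Sum>\<sigma> | \<sigma> \<in> TR 0 (int m) \<and> irr 0 (int m) \<sigma> \<and> \<not> long_cross \<sigma> (int K) (int a). hW \<sigma>)"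
          by (rule sum.mono_neutral_cong_right[OF fin(1)]) (auto simp: S_def)
        also have "\<dots> \<le> cK (int K) * (\<Sum>\<sigma> | \<sigma> \<in> TR 0 (int m) \<and> V (int a) \<subseteq> \<sigma> \<and>
            (\<forall>c. 0 < c \<and> c < int m \<and> V c \<subseteq> \<sigma> \<longrightarrow> \<bar>c - int a\<bar> \<le> int K). hW \<sigma>)"
          by (rule surgery_sum) (use a in auto)
        also have "\<dots> \<le> cK (int K) * (\<Sum>(b, b') | 0 < b \<and> b \<le> a \<and> a \<le> b' \<and> b' < m \<and> b' \<le> b + 2 * K. fs b * (Zs (b' - b) * fs (m - b')))"
          using a cK_pos[of "int K"] by (intro mult_left_mono near_column_sum) auto
        finally show "(\<Sum>\<sigma>\<in>Lo. ?g \<sigma> a * hW \<sigma>) \<le> cK (int K) * (\<Sum>(b, b') | 0 < b \<and> b \<le> a \<and> a \<le> b' \<and> b' < m \<and> b' \<le> b + 2 * K. fs b * (Zs (b' - b) * fs (m - b')))" .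
      qed auto
      also have "\<dots> = 4 * cK (int K) * (\<Sum>a\<in>{0<..<m}.
         \<Sum>(b, b') | 0 < b \<and> b \<le> a \<and> a \<le> b' \<and> b' < m \<and> b' \<le> b + 2 * K. fs b * (Zs (b' - b) * fs (m - b')))"
        by (simp only: sum_distrib_left[symmetric] mult.assoc)
      also have "\<dots> \<le> 4 * cK (int K) * ((real (2 * K) + 1) * M * ?R)"
        using cK_pos[of "int K"] by (intro mult_left_mono pair_sum_le) (use fs_nonneg Zs_pos M in \<open>auto simp: less_imp_le\<close>)
      also have "\<dots> = c1 * ?R" unfolding c1_def by (simp only: mult.assoc)
      finally show ?thesis using f1 f2 by linarith
    qed
  qed
  moreover have "c2 \<ge> 0" unfolding c2_def using A by simp
  ultimately show ?thesis using c1 by blast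
qed

end

section \<open>The limit law\<close>

lemma seg_in_rect:
  assumes "p \<in> rect a b c d" "q \<in> rect a b c d" "p \<noteq> q" "toR w \<in> seg {p, q}"
  shows "w \<in> rect a b c d"
proof -
  obtain u where u: "0 < u" "u < 1" "rx w = (1 - u) * rx p + u * rx q" "ry w = (1 - u) * ry p + u * ry q"
    using assms(4) unfolding toR_def seg_param[OF assms(3)] by blast
  have b: "real_of_int lo \<le> (1 - u) * x + u * y \<and> (1 - u) * x + u * y \<le> real_of_int hi"
    if "real_of_int lo \<le> x" "real_of_int lo \<le> y" "x \<le> real_of_int hi" "y \<le> real_of_int hi" for lo hi x y
  proof -
    have "(1 - u) * real_of_int lo + u * real_of_int lo \<le> (1 - u) * x + u * y"
      using u that by (intro add_mono mult_left_mono) auto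
    moreover have "(1 - u) * x + u * y \<le> (1 - u) * real_of_int hi + u * real_of_int hi"
      using u that by (intro add_mono mult_left_mono) auto
    ultimately show ?thesis by (simp add: algebra_simps)
  qed
  have "real_of_int a \<le> rx w \<and> rx w \<le> real_of_int b" "real_of_int c \<le> ry w \<and> ry w \<le> real_of_int d"
    unfolding u(3,4) by (intro b; use assms(1,2) in \<open>auto simp: rect_def\<close>)+
  thus ?thesis unfolding rect_def by (simp add: mem_Times_iff)
qed

context strip
begin

section \<open>The measures of the statement in strip form; integral abscissas see only
  \<open>n div 2\<close>\<close>

lemma box_bx: "box n k = bx (- int (n div 2)) (int (n div 2))"
  by (auto simp: box_def bx_def rect_def)

lemma good_edge_iff: "good_edge n k e \<longleftrightarrow> e \<in> edges (box n k)"
proof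
  assume "good_edge n k e"
  then obtain p q where pq: "p \<in> box n k" "q \<in> box n k" "p \<noteq> q" "e = {p, q}" and d: "seg e \<inter> toR ` box n k = {}"
    unfolding good_edge_def is_edge_def by blast
  have "toR w \<notin> seg {p, q}" for w
  proof
    assume h: "toR w \<in> seg {p, q}"
    have "w \<in> box n k" using seg_in_rect[OF _ _ pq(3) h] pq(1,2) unfolding box_bx bx_def by blast
    thus False using d h pq(4) by blast
  qed
  thus "e \<in> edges (box n k)" unfolding pq(4) by (intro edgesI pq)
next
  assume "e \<in> edges (box n k)"
  thus "good_edge n k e" unfolding edges_def good_edge_def is_edge_def by blast
qed

lemma Omega_TR: "Omega n k = TR (- int (n div 2)) (int (n div 2))"
proof -
  have "triangulation n k \<sigma> \<longleftrightarrow> tri (box n k) \<sigma>" for \<sigma>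
    unfolding triangulation_def tri_def clique_def good_edge_iff subset_eq by (simp only: Ball_def Diff_iff)
  hence "Omega n k = {\<sigma>. tri (box n k) \<sigma>}" unfolding Omega_def by (rule Collect_cong)
  thus ?thesis unfolding TR_def box_bx .
qed

lemma law_hW:
  "law n k l lam A = (\<Sum>\<sigma>\<in>TR (- int (n div 2)) (int (n div 2)). of_bool (restr l \<sigma> \<in> A) * hW \<sigma>) / Zs (2 * (n div 2))"
proof -
  let ?T = "TR (- int (n div 2)) (int (n div 2))"
  have w: "lam powr real_of_int (weight \<sigma>) = lam powr real k * hW \<sigma>" for \<sigma>
    unfolding hW_def powr_add[symmetric] by simp
  have "Zpart n k lam = lam powr real k * Zs (2 * (n div 2))"
    using Z_shift[of "- int (n div 2)" "int (n div 2)"]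
    unfolding Zpart_def Omega_TR w sum_distrib_left[symmetric] by (simp add: nat_mult_distrib)
  moreover have "(\<Sum>\<sigma>\<in>Omega n k. if restr l \<sigma> \<in> A then lam powr real_of_int (weight \<sigma>) else 0)
     = lam powr real k * (\<Sum>\<sigma>\<in>?T. of_bool (restr l \<sigma> \<in> A) * hW \<sigma>)"
    unfolding Omega_TR sum_distrib_left by (rule sum.cong) (auto simp: w)
  ultimately show ?thesis unfolding law_def using lam by simp
qed

lemma law_bounds: "0 \<le> law n k l lam A \<and> law n k l lam A \<le> 1"
proof -
  let ?T = "TR (- int (n div 2)) (int (n div 2))"
  have Z: "Zs (2 * (n div 2)) = (\<Sum>\<sigma>\<in>?T. hW \<sigma>)"
    using Z_shift[of "- int (n div 2)" "int (n div 2)"] by (simp add: nat_mult_distrib)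
  have "(\<Sum>\<sigma>\<in>?T. of_bool (restr l \<sigma> \<in> A) * hW \<sigma>) \<le> Zs (2 * (n div 2))"
    unfolding Z by (rule sum_mono) (use hW_pos in \<open>auto simp: less_imp_le\<close>)
  moreover have "0 \<le> (\<Sum>\<sigma>\<in>?T. of_bool (restr l \<sigma> \<in> A) * hW \<sigma>)"
    by (rule sum_nonneg) (use hW_pos in \<open>auto simp: less_imp_le\<close>)
  ultimately show ?thesis unfolding law_hW using Zs_pos[of "2 * (n div 2)"] by simp
qed

text \<open>\<open>mid2x\<close> is the doubled abscissa of the midpoint. Edges on the outer side of
  a column at distance at least \<open>l\<close> have
  \<open>\<bar>mid2x e\<bar> \<ge> 2 * l\<close>, which exceeds \<open>l\<close> as
  \<open>l \<ge> 1\<close>. The column itself is excluded with them.\<close>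

lemma restr_split:
  assumes s: "\<sigma> \<in> TR a b" and c: "a \<le> c" "c \<le> b" "V c \<subseteq> \<sigma>" and l: "l \<ge> 1"
  shows "c \<le> - int l \<Longrightarrow> restr l (sub c b \<sigma>) = restr l \<sigma>" "c \<ge> int l \<Longrightarrow> restr l (sub a c \<sigma>) = restr l \<sigma>"
proof -
  note sp = split_TR[OF s c]
  have far: "mid2x e \<le> 2 * y" "mid2x e \<ge> 2 * x" if e: "e \<in> edges (bx x y)" for e x y
  proof -
    obtain p q where "e = {p, q}" "p \<noteq> q" "p \<in> bx x y" "q \<in> bx x y" using e unfolding edges_def by blast
    thus "mid2x e \<le> 2 * y" "mid2x e \<ge> 2 * x" by (auto simp: mid2x_def mem_bx)
  qed
  {
    assume h: "c \<le> - int l"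
    have "e \<notin> restr l \<sigma>" if "e \<in> sub a c \<sigma>" for e
    proof -
      have "e \<in> edges (bx a c)" using that sp(1) TR_D by blast
      from far(1)[OF this] show ?thesis using h l unfolding restr_def by auto
    qed
    thus "restr l (sub c b \<sigma>) = restr l \<sigma>" using sp(3) unfolding restr_def by blast
  }
  {
    assume h: "c \<ge> int l"
    have "e \<notin> restr l \<sigma>" if "e \<in> sub c b \<sigma>" for e
    proof -
      have "e \<in> edges (bx c b)" using that sp(2) TR_D by blast
      from far(2)[OF this] show ?thesis using h l unfolding restr_def by auto
    qed
    thus "restr l (sub a c \<sigma>) = restr l \<sigma>" using sp(3) unfolding restr_def by blast
  }
qed

text \<open>The block between the nearest full columns at distance at least \<open>l\<close> on
  either side. It determines \<open>restr l\<close>, and given its position it is independent of the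
  rest.\<close>

definition window :: "nat \<Rightarrow> nat \<Rightarrow> nat \<Rightarrow> edge set set" where
  "window l i j = {\<tau> \<in> TR (- int i) (int j). (\<forall>c. - int i < c \<and> c \<le> - int l \<longrightarrow> \<not> V c \<subseteq> \<tau>) \<and>
      (\<forall>c. int l \<le> c \<and> c < int j \<longrightarrow> \<not> V c \<subseteq> \<tau>)}"

lemma finite_window [simp]: "finite (window l i j)"
  unfolding window_def by (rule finite_subset[OF _ finite_TR]) auto

text \<open>Two cuts, at \<open>- i\<close> and at \<open>j\<close>. The outer pieces are
  unconstrained and contribute partition functions; the observable depends on the middle piece
  only.\<close>

lemma window_sum:
  fixes g :: "edge set \<Rightarrow> real"
  assumes l: "l \<ge> 1" and ij: "l \<le> i" "i \<le> N" "l \<le> j" "j \<le> N"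
  shows "(\<Sum>\<sigma> | \<sigma> \<in> TR (- int N) (int N) \<and> V (- int i) \<subseteq> \<sigma> \<and> V (int j) \<subseteq> \<sigma> \<and>
      sub (- int i) (int j) \<sigma> \<in> window l i j. g (restr l \<sigma>) * hW \<sigma>)
    = Zs (N - i) * Zs (N - j) * (\<Sum>\<tau>\<in>window l i j. g (restr l \<tau>) * hW \<tau>)"
proof -
  let ?a = "- int i" and ?b = "int j" and ?N = "int N"
  let ?H = "\<lambda>\<tau>. of_bool (\<tau> \<in> window l i j) * g (restr l \<tau>)"
  let ?h = "\<lambda>\<sigma>. of_bool (V ?b \<subseteq> \<sigma>) * ?H (sub ?a ?b \<sigma>)"
  have ord: "- ?N \<le> ?a" "?a \<le> ?N" "?a \<le> ?b" "?b \<le> ?N" "?a \<le> - int l" "int l \<le> ?b" using ij by auto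
  have ss: "sub ?a ?b (sub ?a ?N \<sigma>) = sub ?a ?b \<sigma>" for \<sigma>
    unfolding sub_def using bx_mono[of ?a ?a ?b ?N] ord by auto
  have Vb: "V ?b \<subseteq> sub ?a ?N \<sigma> \<longleftrightarrow> V ?b \<subseteq> \<sigma>" for \<sigma> by (rule V_subset_sub) (use ord in auto)
  have r: "restr l (sub ?a ?b \<sigma>) = restr l \<sigma>" if s: "\<sigma> \<in> TR (- ?N) ?N" "V ?a \<subseteq> \<sigma>" "V ?b \<subseteq> \<sigma>" for \<sigma>
  proof -
    have s': "sub ?a ?N \<sigma> \<in> TR ?a ?N" by (rule split_TR(2)[OF s(1) ord(1,2) s(2)])
    have "restr l (sub ?a ?b (sub ?a ?N \<sigma>)) = restr l (sub ?a ?N \<sigma>)"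
      by (rule restr_split(2)[OF s' ord(3,4) _ l ord(6)]) (use Vb s(3) in simp)
    also have "\<dots> = restr l \<sigma>" by (rule restr_split(1)[OF s(1) ord(1,2) s(2) l ord(5)])
    finally show ?thesis unfolding ss .
  qed
  have "(\<Sum>\<sigma> | \<sigma> \<in> TR (- ?N) ?N \<and> V ?a \<subseteq> \<sigma> \<and> V ?b \<subseteq> \<sigma> \<and> sub ?a ?b \<sigma> \<in> window l i j. g (restr l \<sigma>) * hW \<sigma>)
    = (\<Sum>\<sigma> | \<sigma> \<in> TR (- ?N) ?N \<and> V ?a \<subseteq> \<sigma>. 1 * ?h (sub ?a ?N \<sigma>) * hW \<sigma>)"
    by (rule sum.mono_neutral_cong_left) (auto simp: ss Vb r intro: finite_subset[OF _ finite_TR])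
  also have "\<dots> = (\<Sum>\<sigma>\<in>TR (- ?N) ?a. hW \<sigma>) * (\<Sum>\<sigma>\<in>TR ?a ?N. ?h \<sigma> * hW \<sigma>)"
    using split_sum_hW[of "- ?N" ?a ?N "\<lambda>_. 1" ?h] ord by simp
  also have "(\<Sum>\<sigma>\<in>TR (- ?N) ?a. hW \<sigma>) = Zs (N - i)"
  proof -
    have "nat (?a - - ?N) = N - i" using ij by linarith
    thus ?thesis using Z_shift[OF ord(1)] by simp
  qed
  also have "(\<Sum>\<sigma>\<in>TR ?a ?N. ?h \<sigma> * hW \<sigma>) = (\<Sum>\<sigma> | \<sigma> \<in> TR ?a ?N \<and> V ?b \<subseteq> \<sigma>. ?H (sub ?a ?b \<sigma>) * 1 * hW \<sigma>)"
    by (rule sum.mono_neutral_cong_right) auto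
  also have "\<dots> = (\<Sum>\<tau>\<in>TR ?a ?b. ?H \<tau> * hW \<tau>) * (\<Sum>\<sigma>\<in>TR ?b ?N. hW \<sigma>)"
    using split_sum_hW[of ?a ?b ?N ?H "\<lambda>_. 1"] ord by simp
  also have "(\<Sum>\<sigma>\<in>TR ?b ?N. hW \<sigma>) = Zs (N - j)"
  proof -
    have "nat (?N - ?b) = N - j" using ij by linarith
    thus ?thesis using Z_shift[OF ord(4)] by simp
  qed
  also have "(\<Sum>\<tau>\<in>TR ?a ?b. ?H \<tau> * hW \<tau>) = (\<Sum>\<tau>\<in>window l i j. g (restr l \<tau>) * hW \<tau>)"
    by (rule sum.mono_neutral_cong_right) (auto simp: window_def)
  finally show ?thesis by simp
qed

text \<open>The boundary columns at distance \<open>N \<ge> l\<close> are always present, so nearest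
  columns beyond \<open>l\<close> exist on both sides and their positions classify the
  triangulations.\<close>

lemma window_decomposition:
  fixes g :: "edge set \<Rightarrow> real"
  assumes l: "l \<ge> 1" "l \<le> N"
  shows "(\<Sum>\<sigma>\<in>TR (- int N) (int N). g (restr l \<sigma>) * hW \<sigma>)
    = (\<Sum>x\<in>{l..N} \<times> {l..N}. Zs (N - fst x) * Zs (N - snd x) * (\<Sum>\<tau>\<in>window l (fst x) (snd x). g (restr l \<tau>) * hW \<tau>))"
proof -
  define A where "A x = {\<sigma>. \<sigma> \<in> TR (- int N) (int N) \<and> V (- int (fst x)) \<subseteq> \<sigma> \<and> V (int (snd x)) \<subseteq> \<sigma> \<and>
      sub (- int (fst x)) (int (snd x)) \<sigma> \<in> window l (fst x) (snd x)}" for x :: "nat \<times> nat"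
  have A_iff: "\<sigma> \<in> A (i, j) \<longleftrightarrow> \<sigma> \<in> TR (- int N) (int N) \<and> V (- int i) \<subseteq> \<sigma> \<and> V (int j) \<subseteq> \<sigma> \<and>
      (\<forall>c. l \<le> c \<and> c < i \<longrightarrow> \<not> V (- int c) \<subseteq> \<sigma>) \<and> (\<forall>c. l \<le> c \<and> c < j \<longrightarrow> \<not> V (int c) \<subseteq> \<sigma>)"
    if ij: "i \<in> {l..N}" "j \<in> {l..N}" for i j \<sigma>
  proof -
    let ?a = "- int i" and ?b = "int j"
    have ord: "- int N \<le> ?a" "?a \<le> int N" "?a \<le> ?b" "?b \<le> int N" using ij by auto
    have Vs: "V c \<subseteq> sub ?a ?b \<sigma> \<longleftrightarrow> V c \<subseteq> \<sigma>" if "?a \<le> c" "c \<le> ?b" for c by (rule V_subset_sub[OF that])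
    have ss: "sub ?a ?b (sub ?a (int N) \<sigma>) = sub ?a ?b \<sigma>"
      unfolding sub_def using bx_mono[of ?a ?a ?b "int N"] ord by auto
    have mem: "sub ?a ?b \<sigma> \<in> TR ?a ?b" if "\<sigma> \<in> TR (- int N) (int N)" "V ?a \<subseteq> \<sigma>" "V ?b \<subseteq> \<sigma>"
    proof -
      have "sub ?a (int N) \<sigma> \<in> TR ?a (int N)" by (rule split_TR(2)[OF that(1) ord(1,2) that(2)])
      moreover have "V ?b \<subseteq> sub ?a (int N) \<sigma>" using V_subset_sub[of ?a ?b "int N" \<sigma>] ord that(3) by simp
      ultimately show ?thesis using split_TR(1)[of _ ?a "int N" ?b] ord ss by metis
    qed
    have c1: "(\<forall>c. ?a < c \<and> c \<le> - int l \<longrightarrow> \<not> V c \<subseteq> sub ?a ?b \<sigma>) \<longleftrightarrow> (\<forall>c. l \<le> c \<and> c < i \<longrightarrow> \<not> V (- int c) \<subseteq> \<sigma>)"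
    proof (intro iffI allI impI)
      fix c assume h: "\<forall>c. ?a < c \<and> c \<le> - int l \<longrightarrow> \<not> V c \<subseteq> sub ?a ?b \<sigma>" "l \<le> c \<and> c < i"
      thus "\<not> V (- int c) \<subseteq> \<sigma>" using Vs[of "- int c"] by auto
    next
      fix c assume h: "\<forall>c. l \<le> c \<and> c < i \<longrightarrow> \<not> V (- int c) \<subseteq> \<sigma>" "?a < c \<and> c \<le> - int l"
      have e: "- int (nat (- c)) = c" and n: "l \<le> nat (- c) \<and> nat (- c) < i" using h(2) by linarith+
      have "\<not> V (- int (nat (- c))) \<subseteq> \<sigma>" using h(1) n by blast
      thus "\<not> V c \<subseteq> sub ?a ?b \<sigma>" using h(2) Vs[of c] unfolding e by simp
    qed
    have c2: "(\<forall>c. int l \<le> c \<and> c < ?b \<longrightarrow> \<not> V c \<subseteq> sub ?a ?b \<sigma>) \<longleftrightarrow> (\<forall>c. l \<le> c \<and> c < j \<longrightarrow> \<not> V (int c) \<subseteq> \<sigma>)"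
    proof (intro iffI allI impI)
      fix c assume h: "\<forall>c. int l \<le> c \<and> c < ?b \<longrightarrow> \<not> V c \<subseteq> sub ?a ?b \<sigma>" "l \<le> c \<and> c < j"
      thus "\<not> V (int c) \<subseteq> \<sigma>" using Vs[of "int c"] by auto
    next
      fix c assume h: "\<forall>c. l \<le> c \<and> c < j \<longrightarrow> \<not> V (int c) \<subseteq> \<sigma>" "int l \<le> c \<and> c < ?b"
      have e: "int (nat c) = c" and n: "l \<le> nat c \<and> nat c < j" using h(2) by linarith+
      have "\<not> V (int (nat c)) \<subseteq> \<sigma>" using h(1) n by blast
      thus "\<not> V c \<subseteq> sub ?a ?b \<sigma>" using h(2) Vs[of c] unfolding e by simp
    qed
    show ?thesis unfolding A_def window_def mem_Collect_eq fst_conv snd_conv c1 c2 using mem by blast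
  qed
  have un: "TR (- int N) (int N) = (\<Union>x\<in>{l..N} \<times> {l..N}. A x)"
  proof
    show "TR (- int N) (int N) \<subseteq> (\<Union>x\<in>{l..N} \<times> {l..N}. A x)"
    proof
      fix \<sigma> assume s: "\<sigma> \<in> TR (- int N) (int N)"
      define i where "i = (LEAST c. l \<le> c \<and> V (- int c) \<subseteq> \<sigma>)"
      define j where "j = (LEAST c. l \<le> c \<and> V (int c) \<subseteq> \<sigma>)"
      have ex: "l \<le> N \<and> V (- int N) \<subseteq> \<sigma>" "l \<le> N \<and> V (int N) \<subseteq> \<sigma>" using V_left[OF s] V_right[OF s] l by auto
      have i: "l \<le> i \<and> V (- int i) \<subseteq> \<sigma>" "i \<le> N" "\<And>c. c < i \<Longrightarrow> \<not> (l \<le> c \<and> V (- int c) \<subseteq> \<sigma>)"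
        unfolding i_def using LeastI[of "\<lambda>c. l \<le> c \<and> V (- int c) \<subseteq> \<sigma>", OF ex(1)]
          Least_le[of "\<lambda>c. l \<le> c \<and> V (- int c) \<subseteq> \<sigma>", OF ex(1)] not_less_Least by blast+
      have j: "l \<le> j \<and> V (int j) \<subseteq> \<sigma>" "j \<le> N" "\<And>c. c < j \<Longrightarrow> \<not> (l \<le> c \<and> V (int c) \<subseteq> \<sigma>)"
        unfolding j_def using LeastI[of "\<lambda>c. l \<le> c \<and> V (int c) \<subseteq> \<sigma>", OF ex(2)]
          Least_le[of "\<lambda>c. l \<le> c \<and> V (int c) \<subseteq> \<sigma>", OF ex(2)] not_less_Least by blast+
      have m: "i \<in> {l..N}" "j \<in> {l..N}" using i j by auto
      have "\<sigma> \<in> A (i, j)" unfolding A_iff[OF m] using s i j by blast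
      thus "\<sigma> \<in> (\<Union>x\<in>{l..N} \<times> {l..N}. A x)" using m by blast
    qed
    show "(\<Union>x\<in>{l..N} \<times> {l..N}. A x) \<subseteq> TR (- int N) (int N)" unfolding A_def by blast
  qed
  have disj: "A x \<inter> A y = {}" if "x \<in> {l..N} \<times> {l..N}" "y \<in> {l..N} \<times> {l..N}" "x \<noteq> y" for x y
  proof (rule ccontr)
    assume "A x \<inter> A y \<noteq> {}"
    then obtain \<sigma> where s: "\<sigma> \<in> A x" "\<sigma> \<in> A y" by blast
    obtain i j i' j' where e: "x = (i, j)" "y = (i', j')" by (metis prod.exhaust)
    have m: "i \<in> {l..N}" "j \<in> {l..N}" "i' \<in> {l..N}" "j' \<in> {l..N}" using that unfolding e by auto
    have 1: "\<not> i < i'" "\<not> i' < i" using s m A_iff[OF m(1,2)] A_iff[OF m(3,4)] unfolding e by (meson atLeastAtMost_iff)+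
    have 2: "\<not> j < j'" "\<not> j' < j" using s m A_iff[OF m(1,2)] A_iff[OF m(3,4)] unfolding e by (meson atLeastAtMost_iff)+
    show False using 1 2 that(3) unfolding e by auto
  qed
  have finA: "finite (A x)" for x unfolding A_def by (rule finite_subset[OF _ finite_TR]) auto
  have "(\<Sum>\<sigma>\<in>TR (- int N) (int N). g (restr l \<sigma>) * hW \<sigma>) = (\<Sum>x\<in>{l..N} \<times> {l..N}. \<Sum>\<sigma>\<in>A x. g (restr l \<sigma>) * hW \<sigma>)"
    unfolding un by (rule sum.UNION_disjoint) (use disj finA in auto)
  also have "\<dots> = (\<Sum>x\<in>{l..N} \<times> {l..N}. Zs (N - fst x) * Zs (N - snd x) * (\<Sum>\<tau>\<in>window l (fst x) (snd x). g (restr l \<tau>) * hW \<tau>))"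
  proof (rule sum.cong[OF refl])
    fix x assume "x \<in> {l..N} \<times> {l..N}"
    hence "l \<le> fst x" "fst x \<le> N" "l \<le> snd x" "snd x \<le> N" by auto
    from window_sum[OF l(1) this, of g]
    show "(\<Sum>\<sigma>\<in>A x. g (restr l \<sigma>) * hW \<sigma>) = Zs (N - fst x) * Zs (N - snd x) * (\<Sum>\<tau>\<in>window l (fst x) (snd x). g (restr l \<tau>) * hW \<tau>)"
      unfolding A_def .
  qed
  finally show ?thesis .
qed

text \<open>A window need not be symmetric. Arbitrary triangulations glued to its sides complete it
  to a box as in \<open>Gamma\<close> without changing \<open>restr l\<close>.\<close>

lemma window_Gamma:
  assumes l: "l \<ge> 1" "l \<le> i" "l \<le> j" and t: "\<tau> \<in> TR (- int i) (int j)"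
  shows "restr l \<tau> \<in> Gamma k l"
proof -
  define N where "N = max i j"
  have ord: "- int N \<le> - int i" "- int i \<le> int j" "int j \<le> int N" "- int i \<le> int N" unfolding N_def by auto
  obtain \<alpha> \<beta> where ab: "\<alpha> \<in> TR (- int N) (- int i)" "\<beta> \<in> TR (int j) (int N)" using TR_nonempty by blast
  note g1 = glue_TR[OF t ab(2) ord(2,3)]
  note g2 = glue_TR[OF ab(1) g1(1) ord(1,4)]
  let ?s = "\<alpha> \<union> (\<tau> \<union> \<beta>)"
  have "restr l ?s = restr l (sub (- int i) (int N) ?s)"
    by (rule restr_split(1)[symmetric, OF g2(1) ord(1,4) g2(2) l(1)]) (use l in simp)
  also have "\<dots> = restr l (\<tau> \<union> \<beta>)" by (simp add: g2(4))
  also have "\<dots> = restr l (sub (- int i) (int j) (\<tau> \<union> \<beta>))"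
    by (rule restr_split(2)[symmetric, OF g1(1) ord(2,3) g1(2) l(1)]) (use l in simp)
  also have "\<dots> = restr l \<tau>" by (simp add: g1(3))
  finally have e: "restr l \<tau> = restr l ?s" by simp
  have "?s \<in> Omega (2 * N) k" unfolding Omega_TR using g2(1) by simp
  moreover have "l < 2 * N" unfolding N_def using l by auto
  ultimately show ?thesis unfolding Gamma_def e by blast
qed

end

lemma sum_Sigma3:
  assumes "finite A" "\<And>i. finite (B i)" "\<And>i j. finite (W i j)"
  shows "(\<Sum>i\<in>A. \<Sum>j\<in>B i. \<Sum>t\<in>W i j. F i j t) = (\<Sum>(i, j, t)\<in>Sigma A (\<lambda>i. Sigma (B i) (W i)). F i j t)"
proof -
  have "(\<Sum>j\<in>B i. \<Sum>t\<in>W i j. F i j t) = (\<Sum>y\<in>Sigma (B i) (W i). F i (fst y) (snd y))" for i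
    using sum.Sigma[of "B i" "W i" "F i"] assms by (simp add: case_prod_unfold)
  hence "(\<Sum>i\<in>A. \<Sum>j\<in>B i. \<Sum>t\<in>W i j. F i j t) = (\<Sum>i\<in>A. \<Sum>y\<in>Sigma (B i) (W i). F i (fst y) (snd y))" by simp
  also have "\<dots> = (\<Sum>(i, y)\<in>Sigma A (\<lambda>i. Sigma (B i) (W i)). F i (fst y) (snd y))"
    by (rule sum.Sigma) (use assms in auto)
  finally show ?thesis by (simp add: case_prod_unfold)
qed

lemma positive_convergent_bounds:
  fixes u :: "nat \<Rightarrow> real"
  assumes "\<And>n. u n > 0" "u \<longlonglongrightarrow> L" "L > 0"
  obtains c C where "c > 0" "\<And>n. c \<le> u n" "\<And>n. u n \<le> C"
proof -
  have "Bseq u" using assms(2) by (intro convergent_imp_Bseq convergentI)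
  then obtain C where C: "\<And>n. norm (u n) \<le> C" unfolding Bseq_def by blast
  have "(\<lambda>n. inverse (u n)) \<longlonglongrightarrow> inverse L" using assms by (intro tendsto_inverse) auto
  hence "Bseq (\<lambda>n. inverse (u n))" by (intro convergent_imp_Bseq convergentI)
  then obtain K where K: "K > 0" "\<And>n. norm (inverse (u n)) \<le> K" unfolding Bseq_def by blast
  have "inverse K \<le> u n" for n
  proof -
    have "inverse (u n) \<le> K" using K(2)[of n] assms(1)[of n] by simp
    hence "inverse K \<le> inverse (inverse (u n))" using assms(1)[of n] by (intro le_imp_inverse_le) auto
    thus ?thesis by simp
  qed
  moreover have "u n \<le> C" for n using C[of n] by simp
  ultimately show thesis using that[of "inverse K" C] K(1) by simp
qed

context strip
begin

section \<open>Uniqueness and existence of the limit\<close>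

lemma law_prob_bounded: "\<bar>law n k l lam A - measure_pmf.prob p A\<bar> \<le> 1"
proof -
  have "0 \<le> measure_pmf.prob p A" "measure_pmf.prob p A \<le> 1" by (auto simp: measure_pmf.prob_le_1)
  thus ?thesis using law_bounds[of n l A] by linarith
qed

lemma law_prob_le_tv: "\<bar>law n k l lam A - measure_pmf.prob p A\<bar> \<le> tv_dist n k l lam p"
  unfolding tv_dist_def by (rule cSUP_upper) (auto intro!: bdd_aboveI2[where M = 1] law_prob_bounded)

lemma tv_limit_unique:
  assumes "(\<lambda>n. tv_dist n k l lam p) \<longlonglongrightarrow> 0" "(\<lambda>n. tv_dist n k l lam q) \<longlonglongrightarrow> 0"
  shows "p = q"
proof (rule pmf_eqI)
  fix x
  have lim: "(\<lambda>n. tv_dist n k l lam p + tv_dist n k l lam q) \<longlonglongrightarrow> 0" using tendsto_add[OF assms] by simp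
  have "\<bar>measure_pmf.prob p {x} - measure_pmf.prob q {x}\<bar> \<le> tv_dist n k l lam p + tv_dist n k l lam q" for n
    using law_prob_le_tv[of n l "{x}" p] law_prob_le_tv[of n l "{x}" q] by linarith
  hence "\<bar>measure_pmf.prob p {x} - measure_pmf.prob q {x}\<bar> \<le> 0"
    by (intro LIMSEQ_le_const[OF lim]) auto
  thus "pmf p x = pmf q x" by (simp add: measure_pmf_single)
qed

text \<open>A window \<open>x\<close> has probability \<open>\<phi> N x * m x\<close> in the box of
  half-width \<open>N\<close>, where \<open>m\<close> does not depend on \<open>N\<close> and
  \<open>\<phi> N x\<close> is bounded and tends to \<open>L * L / L\<close>. The limit law is thus
  the image of \<open>L * m\<close> under restriction.\<close>

lemma limit_law_exists:
  assumes l: "l \<ge> 1" and \<rho>: "\<rho> > 0" and L: "L > 0" and lim: "(\<lambda>n. Zs n * \<rho> ^ n) \<longlonglongrightarrow> L"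
  shows "\<exists>p. set_pmf p \<subseteq> Gamma k l \<and> (\<lambda>n. tv_dist n k l lam p) \<longlonglongrightarrow> 0"
proof -
  define u where "u n = Zs n * \<rho> ^ n" for n
  have u_pos: "u n > 0" for n unfolding u_def using Zs_pos \<rho> by simp
  have u_lim: "u \<longlonglongrightarrow> L" unfolding u_def by (rule lim)
  obtain c C where c: "c > 0" "\<And>n. c \<le> u n" "\<And>n. u n \<le> C"
    using positive_convergent_bounds[OF u_pos u_lim L] by blast
  have C: "C > 0" using c(1) c(2)[of 0] c(3)[of 0] by linarith
  define X where "X = {(i, j, \<tau>) | i j \<tau>. l \<le> i \<and> l \<le> j \<and> \<tau> \<in> window l i j}"
  define m where "m x = (case x of (i, j, \<tau>) \<Rightarrow> of_bool (x \<in> X) * (hW \<tau> * \<rho> ^ (i + j)))" for x :: "nat \<times> nat \<times> edge set"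
  define \<phi> where "\<phi> N x = (case x of (i, j, \<tau>) \<Rightarrow> of_bool (i \<le> N \<and> j \<le> N) * (u (N - i) * u (N - j) / u (2 * N)))"
    for N and x :: "nat \<times> nat \<times> edge set"
  define rs where "rs x = (case x of (i, j, \<tau>) \<Rightarrow> restr l \<tau>)" for x :: "nat \<times> nat \<times> edge set"
  define XN where "XN N = Sigma {l..N} (\<lambda>i. Sigma {l..N} (\<lambda>j. window l i j))" for N
  have m_nn: "m x \<ge> 0" for x unfolding m_def using hW_pos \<rho> by (auto simp: case_prod_unfold less_imp_le)
  have finXN: "finite (XN N)" for N unfolding XN_def by auto
  have XN_X: "XN N \<subseteq> X" for N unfolding XN_def X_def by auto
  have \<phi>_bd: "0 \<le> \<phi> N x" "\<phi> N x \<le> C * C / c" for N x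
  proof -
    have "u a * u b / u (2 * N) \<le> C * C / c" for a b
      using c u_pos C by (intro frac_le mult_mono) (auto simp: less_imp_le)
    moreover have "0 \<le> C * C / c" using C c by simp
    ultimately show "0 \<le> \<phi> N x" "\<phi> N x \<le> C * C / c" unfolding \<phi>_def using u_pos by (auto simp: case_prod_unfold less_imp_le)
  qed
  have zero: "\<phi> N x * m x = 0" if "x \<notin> XN N" for N x
    using that unfolding \<phi>_def m_def XN_def X_def by (cases x) auto
  have lawN: "law n k l lam A = (\<Sum>x\<in>XN (n div 2). of_bool (rs x \<in> A) * (\<phi> (n div 2) x * m x))" if n: "l \<le> n div 2" for n A
  proof -
    define N where "N = n div 2"
    have lN: "l \<le> N" using n unfolding N_def .
    have "(\<Sum>\<sigma>\<in>TR (- int N) (int N). of_bool (restr l \<sigma> \<in> A) * hW \<sigma>)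
       = (\<Sum>x\<in>{l..N} \<times> {l..N}. Zs (N - fst x) * Zs (N - snd x) * (\<Sum>\<tau>\<in>window l (fst x) (snd x). of_bool (restr l \<tau> \<in> A) * hW \<tau>))"
      by (rule window_decomposition[OF l lN, of "\<lambda>\<sigma>. of_bool (\<sigma> \<in> A)"])
    also have "\<dots> = (\<Sum>i\<in>{l..N}. \<Sum>j\<in>{l..N}. \<Sum>\<tau>\<in>window l i j. Zs (N - i) * Zs (N - j) * (of_bool (restr l \<tau> \<in> A) * hW \<tau>))"
      unfolding sum_distrib_left sum.cartesian_product case_prod_unfold ..
    also have "\<dots> = (\<Sum>(i, j, \<tau>)\<in>XN N. Zs (N - i) * Zs (N - j) * (of_bool (restr l \<tau> \<in> A) * hW \<tau>))"
      unfolding XN_def by (rule sum_Sigma3) auto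
    also have "\<dots> = (\<Sum>x\<in>XN N. of_bool (rs x \<in> A) * (\<phi> N x * m x) * Zs (2 * N))"
    proof (rule sum.cong[OF refl])
      fix x assume xN: "x \<in> XN N"
      obtain i j \<tau> where x: "x = (i, j, \<tau>)" by (metis prod.exhaust)
      have h: "i \<in> {l..N}" "j \<in> {l..N}" "\<tau> \<in> window l i j" using xN unfolding x XN_def by auto
      have "(i, j, \<tau>) \<in> X" unfolding X_def using h by auto
      hence "\<phi> N (i, j, \<tau>) * m (i, j, \<tau>) = u (N - i) * u (N - j) / u (2 * N) * (hW \<tau> * \<rho> ^ (i + j))"
        unfolding \<phi>_def m_def using h by simp
      also have "\<dots> * Zs (2 * N) = Zs (N - i) * Zs (N - j) * hW \<tau>"
      proof -
        \<comment> \<open>The widths of the three blocks add up to that of the box, so the unknown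
          rate \<open>\<rho>\<close> drops out of the probabilities.\<close>
        have "2 * N = (N - i) + (N - j) + (i + j)" using h by auto
        hence p: "\<rho> ^ (2 * N) = \<rho> ^ (N - i) * \<rho> ^ (N - j) * \<rho> ^ (i + j)" by (metis power_add)
        show ?thesis unfolding u_def p using Zs_pos[of "2 * N"] \<rho> by (simp add: field_simps)
      qed
      finally have e: "\<phi> N (i, j, \<tau>) * m (i, j, \<tau>) * Zs (2 * N) = Zs (N - i) * Zs (N - j) * hW \<tau>" .
      have "of_bool (rs x \<in> A) * (\<phi> N x * m x) * Zs (2 * N) = of_bool (restr l \<tau> \<in> A) * (\<phi> N x * m x * Zs (2 * N))"
        unfolding rs_def x by (simp only: mult.assoc case_prod_conv)
      also have "\<dots> = Zs (N - i) * Zs (N - j) * (of_bool (restr l \<tau> \<in> A) * hW \<tau>)"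
        unfolding x e by (simp only: mult_ac)
      finally show "(case x of (i, j, \<tau>) \<Rightarrow> Zs (N - i) * Zs (N - j) * (of_bool (restr l \<tau> \<in> A) * hW \<tau>))
        = of_bool (rs x \<in> A) * (\<phi> N x * m x) * Zs (2 * N)" unfolding x by simp
    qed
    also have "\<dots> = (\<Sum>x\<in>XN N. of_bool (rs x \<in> A) * (\<phi> N x * m x)) * Zs (2 * N)" by (simp add: sum_distrib_right)
    finally show ?thesis unfolding law_hW N_def[symmetric] using Zs_pos[of "2 * N"] by simp
  qed
  have total: "(\<Sum>x\<in>XN N. \<phi> N x * m x) = 1" if "l \<le> N" for N
  proof -
    have "law (2 * N) k l lam UNIV = (\<Sum>x\<in>XN N. \<phi> N x * m x)" using lawN[of "2 * N" UNIV] that by simp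
    moreover have "law (2 * N) k l lam UNIV = 1"
      unfolding law_hW using Z_shift[of "- int N" "int N"] Zs_pos[of "2 * N"] by (simp add: nat_mult_distrib)
    ultimately show ?thesis by simp
  qed
  \<comment> \<open>On windows that fit into the box \<open>\<phi>\<close> is at least
    \<open>c * c / C\<close>, while the probabilities sum to 1. Hence \<open>m\<close> has finite
    total mass.\<close>
  have bdd: "(\<Sum>x\<in>F. m x) \<le> C / (c * c)" if F: "finite F" for F
  proof -
    define N where "N = Max (insert l ((\<lambda>x. fst x) ` F \<union> (\<lambda>x. fst (snd x)) ` F))"
    have N: "l \<le> N" "fst x \<le> N" "fst (snd x) \<le> N" if "x \<in> F" for x unfolding N_def using F that by auto
    have lN: "l \<le> N" unfolding N_def using F by auto
    have low: "c * c / C * m x \<le> \<phi> N x * m x" if x: "x \<in> XN N" for x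
    proof (rule mult_right_mono[OF _ m_nn])
      have "c * c / C \<le> u a * u b / u (2 * N)" for a b
        using c u_pos C by (intro frac_le mult_mono) (auto simp: less_imp_le)
      thus "c * c / C \<le> \<phi> N x" using x unfolding \<phi>_def XN_def by auto
    qed
    have "(\<Sum>x\<in>F. m x) \<le> (\<Sum>x\<in>XN N. m x)"
    proof (rule order_trans[OF eq_refl sum_mono2[OF finXN]])
      show "(\<Sum>x\<in>F. m x) = (\<Sum>x\<in>F \<inter> X. m x)"
        by (rule sum.mono_neutral_right[OF F]) (auto simp: m_def)
      show "F \<inter> X \<subseteq> XN N" using N unfolding X_def XN_def by force
    qed (rule m_nn)
    also have "\<dots> = C / (c * c) * (\<Sum>x\<in>XN N. c * c / C * m x)" unfolding sum_distrib_left[symmetric] using c C by simp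
    also have "\<dots> \<le> C / (c * c) * (\<Sum>x\<in>XN N. \<phi> N x * m x)"
      using c C by (intro mult_left_mono sum_mono low) auto
    also have "\<dots> = C / (c * c)" using total[OF lN] by simp
    finally show ?thesis .
  qed
  have "m summable_on UNIV"
    by (rule nonneg_bdd_above_summable_on) (use m_nn bdd in \<open>auto intro!: bdd_aboveI2[where M = "C / (c * c)"]\<close>)
  hence "(\<lambda>x. norm (m x)) summable_on UNIV" using m_nn by simp
  hence int_m: "integrable (count_space UNIV) m"
    using abs_summable_equivalent[of m UNIV] unfolding abs_summable_on_def by blast
  let ?\<mu> = "count_space (UNIV :: (nat \<times> nat \<times> edge set) set)"
  have \<phi>_lim: "(\<lambda>N. \<phi> N x) \<longlonglongrightarrow> L" for x
  proof -
    obtain i j \<tau> where x: "x = (i, j, \<tau>)" by (metis prod.exhaust)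
    have sh: "(\<lambda>N. u (N - i)) \<longlonglongrightarrow> L" for i
      by (rule LIMSEQ_offset[of _ i]) (use u_lim in simp)
    have s2: "(\<lambda>N. u (2 * N)) \<longlonglongrightarrow> L"
      by (rule filterlim_compose[OF u_lim]) (rule mult_nat_left_at_top, simp)
    have "(\<lambda>N. u (N - i) * u (N - j) / u (2 * N)) \<longlonglongrightarrow> L * L / L"
      by (intro tendsto_intros sh s2) (use L in simp)
    moreover have "eventually (\<lambda>N. \<phi> N x = u (N - i) * u (N - j) / u (2 * N)) sequentially"
      using eventually_ge_at_top[of "max i j"] by eventually_elim (simp add: \<phi>_def x)
    ultimately show ?thesis using L by (simp add: tendsto_cong)
  qed
  \<comment> \<open>One quantity that bounds the discrepancy for all events simultaneously, as total
    variation demands.\<close>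
  define D where "D N = (\<integral>x. \<bar>\<phi> N x - L\<bar> * m x \<partial>?\<mu>)" for N
  define Cb where "Cb = C * C / c + L"
  have \<phi>L: "\<bar>\<phi> N x - L\<bar> \<le> Cb" for N x unfolding Cb_def using \<phi>_bd[of N x] L by linarith
  have dom: "\<bar>\<phi> N x - L\<bar> * m x \<le> Cb * m x" for N x by (intro mult_right_mono m_nn \<phi>L)
  have D_lim: "D \<longlonglongrightarrow> 0"
  proof -
    have "D \<longlonglongrightarrow> (\<integral>x. 0 \<partial>?\<mu>)" unfolding D_def
    proof (rule integral_dominated_convergence[where w = "\<lambda>x. Cb * m x"])
      show "AE x in ?\<mu>. (\<lambda>N. \<bar>\<phi> N x - L\<bar> * m x) \<longlonglongrightarrow> 0"
      proof (rule AE_I2)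
        fix x
        have "(\<lambda>N. \<bar>\<phi> N x - L\<bar> * m x) \<longlonglongrightarrow> \<bar>L - L\<bar> * m x" by (intro tendsto_intros \<phi>_lim)
        thus "(\<lambda>N. \<bar>\<phi> N x - L\<bar> * m x) \<longlonglongrightarrow> 0" by simp
      qed
      show "integrable ?\<mu> (\<lambda>x. Cb * m x)" using int_m by simp
      show "AE x in ?\<mu>. norm (\<bar>\<phi> N x - L\<bar> * m x) \<le> Cb * m x" for N
        using dom[of N] m_nn by (auto simp: abs_mult)
    qed auto
    thus ?thesis by simp
  qed
  have int_bounded: "integrable ?\<mu> (\<lambda>x. g x * m x)" if "\<And>x. \<bar>g x\<bar> \<le> B" for g :: "nat \<times> nat \<times> edge set \<Rightarrow> real" and B
    by (rule Bochner_Integration.integrable_bound[of _ "\<lambda>x. B * m x"])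
       (use int_m that m_nn in \<open>auto simp: abs_mult intro!: mult_right_mono order_trans[OF _ abs_ge_self]\<close>)
  have fin_int: "(\<Sum>x\<in>XN N. h x * (\<phi> N x * m x)) = (\<integral>x. (h x * \<phi> N x) * m x \<partial>?\<mu>)" for N and h :: "nat \<times> nat \<times> edge set \<Rightarrow> real"
  proof -
    have "(\<integral>x. (h x * \<phi> N x) * m x \<partial>?\<mu>) = (\<Sum>x\<in>XN N. (h x * \<phi> N x) * m x)"
      by (rule lebesgue_integral_count_space_finite_support[THEN trans, OF finite_subset[OF _ finXN[of N]]])
         (use zero[where N = N] in \<open>auto simp: mult.assoc intro!: sum.mono_neutral_left finXN\<close>)
    thus ?thesis by (simp add: mult.assoc)
  qed
  have close: "\<bar>(\<Sum>x\<in>XN N. h x * (\<phi> N x * m x)) - (\<integral>x. h x * (L * m x) \<partial>?\<mu>)\<bar> \<le> D N"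
    if h: "\<And>x. 0 \<le> h x" "\<And>x. h x \<le> 1" for N and h :: "nat \<times> nat \<times> edge set \<Rightarrow> real"
  proof -
    have hb: "\<bar>h x * \<phi> N x\<bar> \<le> 1 * (C * C / c)" for x
      unfolding abs_mult using h[of x] \<phi>_bd[of N x] by (intro mult_mono) auto
    have hL: "\<bar>h x * L\<bar> \<le> 1 * L" for x
      unfolding abs_mult using h[of x] L by (intro mult_mono) auto
    have i1: "integrable ?\<mu> (\<lambda>x. (h x * \<phi> N x) * m x)" by (rule int_bounded[OF hb])
    have i2: "integrable ?\<mu> (\<lambda>x. (h x * L) * m x)" by (rule int_bounded[OF hL])
    have i3: "integrable ?\<mu> (\<lambda>x. \<bar>\<phi> N x - L\<bar> * m x)"
      by (rule int_bounded[of _ Cb]) (simp add: \<phi>L)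
    have "(\<Sum>x\<in>XN N. h x * (\<phi> N x * m x)) - (\<integral>x. h x * (L * m x) \<partial>?\<mu>)
      = (\<integral>x. (h x * \<phi> N x) * m x - (h x * L) * m x \<partial>?\<mu>)"
      unfolding fin_int using Bochner_Integration.integral_diff[OF i1 i2] by (simp add: mult.assoc)
    also have "\<bar>\<dots>\<bar> \<le> (\<integral>x. \<bar>(h x * \<phi> N x) * m x - (h x * L) * m x\<bar> \<partial>?\<mu>)" by (rule integral_abs_bound)
    also have "\<dots> \<le> D N" unfolding D_def
    proof (rule integral_mono)
      show "integrable ?\<mu> (\<lambda>x. \<bar>(h x * \<phi> N x) * m x - (h x * L) * m x\<bar>)"
        using i1 i2 by (intro integrable_abs Bochner_Integration.integrable_diff)
      fix x
      have "(h x * \<phi> N x) * m x - (h x * L) * m x = h x * ((\<phi> N x - L) * m x)" by (simp add: algebra_simps)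
      hence "\<bar>(h x * \<phi> N x) * m x - (h x * L) * m x\<bar> = h x * (\<bar>\<phi> N x - L\<bar> * m x)"
        using h[of x] m_nn[of x] by (simp add: abs_mult)
      also have "\<dots> \<le> 1 * (\<bar>\<phi> N x - L\<bar> * m x)" using h m_nn by (intro mult_right_mono) auto
      finally show "\<bar>(h x * \<phi> N x) * m x - (h x * L) * m x\<bar> \<le> \<bar>\<phi> N x - L\<bar> * m x" by simp
    qed (rule i3)
    finally show ?thesis .
  qed
  \<comment> \<open>No mass escapes to wide windows: the total is 1 in every large box and the
    discrepancy tends to 0.\<close>
  have mass: "(\<integral>x. L * m x \<partial>?\<mu>) = 1"
  proof -
    have "\<bar>1 - (\<integral>x. L * m x \<partial>?\<mu>)\<bar> \<le> D N" if "l \<le> N" for N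
      using close[of "\<lambda>_. 1" N] total[OF that] by simp
    hence "\<bar>1 - (\<integral>x. L * m x \<partial>?\<mu>)\<bar> \<le> 0" by (intro LIMSEQ_le_const[OF D_lim]) auto
    thus ?thesis by simp
  qed
  have nn_mass: "(\<integral>\<^sup>+x. ennreal (L * m x) \<partial>?\<mu>) = 1"
    using nn_integral_eq_integral[of ?\<mu> "\<lambda>x. L * m x"] int_m m_nn L mass by simp
  define p0 where "p0 = embed_pmf (\<lambda>x. L * m x)"
  have pmf_p0: "pmf p0 x = L * m x" for x
    unfolding p0_def by (rule pmf_embed_pmf) (use m_nn L nn_mass in auto)
  define p where "p = map_pmf rs p0"
  have probA: "measure_pmf.prob p A = (\<integral>x. of_bool (rs x \<in> A) * (L * m x) \<partial>?\<mu>)" for A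
  proof -
    have "measure_pmf.prob p A = measure_pmf.prob p0 (rs -` A)" unfolding p_def by (simp add: measure_map_pmf)
    also have "\<dots> = infsetsum (pmf p0) (rs -` A)" by (rule measure_pmf_conv_infsetsum)
    also have "\<dots> = (\<integral>x. indicator (rs -` A) x * pmf p0 x \<partial>?\<mu>)"
      unfolding infsetsum_altdef set_lebesgue_integral_def by simp
    also have "\<dots> = (\<integral>x. of_bool (rs x \<in> A) * (L * m x) \<partial>?\<mu>)"
      by (rule Bochner_Integration.integral_cong) (auto simp: pmf_p0 indicator_def)
    finally show ?thesis .
  qed
  have tv: "tv_dist n k l lam p \<le> D (n div 2)" if n: "l \<le> n div 2" for n
    unfolding tv_dist_def
  proof (rule cSUP_least)
    fix A
    show "\<bar>law n k l lam A - measure_pmf.prob p A\<bar> \<le> D (n div 2)"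
      unfolding lawN[OF n] probA by (rule close) auto
  qed simp
  have tv0: "0 \<le> tv_dist n k l lam p" for n using law_prob_le_tv[of n l "{}" p] by linarith
  have "(\<lambda>n. tv_dist n k l lam p) \<longlonglongrightarrow> 0"
  proof (rule tendsto_sandwich[of "\<lambda>_. 0" _ _ "\<lambda>n. D (n div 2)"])
    show "eventually (\<lambda>n. tv_dist n k l lam p \<le> D (n div 2)) sequentially"
      using eventually_ge_at_top[of "2 * l"] by eventually_elim (intro tv, linarith)
    have "filterlim (\<lambda>n :: nat. n div 2) at_top sequentially"
      unfolding filterlim_at_top
    proof
      fix Z :: nat
      show "eventually (\<lambda>n. Z \<le> n div 2) sequentially"
        using eventually_ge_at_top[of "2 * Z"] by eventually_elim linarith
    qed
    thus "(\<lambda>n. D (n div 2)) \<longlonglongrightarrow> 0" by (rule filterlim_compose[OF D_lim])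
  qed (use tv0 in auto)
  moreover have "set_pmf p \<subseteq> Gamma k l"
  proof
    fix y assume "y \<in> set_pmf p"
    then obtain x where x: "x \<in> set_pmf p0" "y = rs x" unfolding p_def by auto
    hence "m x \<noteq> 0" using pmf_p0[of x] by (metis mult_zero_right set_pmf_iff)
    hence "x \<in> X" unfolding m_def by (cases x) (auto split: if_splits)
    then obtain i j \<tau> where ij: "x = (i, j, \<tau>)" "l \<le> i" "l \<le> j" "\<tau> \<in> window l i j" unfolding X_def by blast
    have "\<tau> \<in> TR (- int i) (int j)" using ij(4) unfolding window_def by blast
    thus "y \<in> Gamma k l" unfolding x(2) rs_def ij(1) using window_Gamma[OF l ij(2,3)] by simp
  qed
  ultimately show ?thesis by blast
qed

lemma Zs_limit: "\<exists>\<rho>>0. \<exists>L>0. (\<lambda>n. Zs n * \<rho> ^ n) \<longlonglongrightarrow> L"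
proof -
  obtain c1 c2 D where s: "c1 \<ge> 0" "c2 \<ge> 0"
      "\<And>m. real m * fs m \<le> c1 * (\<Sum>d\<le>D. \<Sum>(i, j) | i + d + j = m. fs i * fs j) + c2 * (fs 1 / 2) ^ m"
    using surgery_inequality by blast
  obtain A g where g: "A > 0" "g > 0" "\<And>m. Zs m \<le> A * g ^ m"
    using Zs_growth by blast
  show ?thesis
  proof (rule renewal_theorem[OF fs_nonneg _ fs_1 _ g(1,2) Zs_0 renewal s])
    show "fs 0 = 0" by (simp add: fs_def)
    show "fs m \<le> A * g ^ m" for m using fs_le_Zs[of m] g(3)[of m] by linarith
  qed
qed

end

theorem mainTheorem20:
  fixes k l :: nat and lam :: real
  assumes "k \<ge> 1" and "l \<ge> 1" and "0 < lam" and "lam < 1"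
  shows "\<exists>!p :: edge set pmf. set_pmf p \<subseteq> Gamma k l \<and>
           (\<lambda>n. tv_dist n k l lam p) \<longlonglongrightarrow> 0"
proof -
  interpret strip k lam using assms by unfold_locales
  obtain \<rho> L where "\<rho> > 0" "L > 0" "(\<lambda>n. Zs n * \<rho> ^ n) \<longlonglongrightarrow> L" using Zs_limit by blast
  from limit_law_exists[OF assms(2) this] tv_limit_unique[of l] show ?thesis by blast
qed

end
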